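(* For every weak composition $s$, the $s$-weak order on $s$-decreasing trees is an $\mathcal{HH}$-lattice. Hence, it is polygonal, semidistributive and congruence uniform.
   Context: A weak composition is a finite sequence $s=(s(1),\dots,s(n))$ of nonnegative integers. An $s$-decreasing tree is a rooted planar tree with exactly $n$ internal nodes, labelled bijectively by $1,\dots,n$ (an internal node is identified with its label; the other nodes are unlabelled leaves), such that internal node $i$ has exactly $s(i)+1$ ordered children and all internal nodes that are descendants of $i$ have labels smaller than $i$. For a node $y$ of $T$, $T^y_0,\dots,T^y_{s(y)}$ denote its child subtrees from left to right, and $x\in T^y_i$ means that internal node $x$ lies in that subtree. If $x<y$ and $x$ is not a descendant of $y$, let $z$ be the first (closest) common ancestor of $x$ and $y$, with $x\in T^z_j$, $y\in T^z_i$, $i\neq j$; $x$ is left of $y$ if $j<i$ and right of $y$ if $j>i$. For $x<y$ the cardinality $\#_T(y,x)$ is: $0$ if $x$ is left of $y$; $i$ if $x\in T^y_i$; $s(y)$ if $x$ is right of $y$. The $s$-weak order is defined by $R\preccurlyeq T$ iff $\#_R(y,x)\le \#_T(y,x)$ for all $1\le x<y\le n$; it is a lattice. Lattice notions. A polygon is an interval $[x,y]$ formed by two finite maximal chains that are disjoint except at $x$ and $y$. A lattice is polygonal if: (1) whenever distinct $y_1,y_2$ both cover $x$, $[x,y_1\vee y_2]$ is a polygon; and (2) whenever $y$ covers two distinct elements $x_1,x_2$, $[x_1\wedge x_2,y]$ is a polygon. A lattice is semidistributive if for all $x,y,z$: $z\wedge x=z\wedge y$ implies $z\wedge(x\vee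 y)=z\wedge x$, and $z\vee x=z\vee y$ implies $z\vee(x\wedge y)=z\vee x$. A finite lattice is congruence uniform if it can be obtained (up to isomorphism) from the one-element lattice by a finite sequence of doublings of intervals, where the doubling of $L$ at an interval $I$ is the subposet $(L_{\le I}\times\{0\})\cup\bigl(((L\setminus L_{\le I})\cup I)\times\{1\}\bigr)$ of $L\times\{0<1\}$, with $L_{\le I}=\{x\in L: x\le y\text{ for some }y\in I\}$. A lattice $L$ is an $\mathcal{HH}$-lattice if it is finite, semidistributive, polygonal, and there exist a set of labels $\mathcal L$, a labeling $\ell:E(L)\to\mathcal L$ of the set $E(L)$ of cover relations of $L$, and a ranking function $r:\mathcal L\to\mathbb N$ such that for every polygon $[x,y]$ of $L$, denoting by $x_1,x_2$ the two elements of the polygon covering $x$ and by $y_1,y_2$ the two elements of the polygon covered by $y$, with $x_1,y_1$ on the same maximal chain and $x_2,y_2$ on the same maximal chain: (1) $\ell(x,x_1)=\ell(y_2,y)$ and $\ell(x,x_2)=\ell(y_1,y)$; (2) if $t_1,\dots,t_k$ are the successive labels (from bottom to top) of the cover relations of a maximal chain of the polygon, then $r(t_1),r(t_k)<r(t_2),r(t_{k-1})<\cdots<r(t_{(k+1)/2})$ if $k$ is odd, and $r(t_1),r(t_k)<r(t_2),r(t_{k-1})<\cdots<r(t_{k/2}),r(t_{k/2+1})$ if $k$ is even; i.e. $\max(r(t_i),r(t_{k+1-i}))<\min(r(t_{i+1}),r(t_{k-i}))$ for all $1\le i<\lceil k/2\rceil$. *)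

theory Defs
  imports "HOL-Algebra.Complete_Lattice"
begin

section \<open>Decreasing trees and the s-weak order\<close>

datatype ptree = Leaf | Node nat "ptree list"

fun labels :: "ptree \<Rightarrow> nat list" where
  "labels Leaf = []"
| "labels (Node i ts) = i # concat (map labels ts)"

fun subtrees :: "ptree \<Rightarrow> ptree set" where
  "subtrees Leaf = {Leaf}"
| "subtrees (Node i ts) = insert (Node i ts) (\<Union>t\<in>set ts. subtrees t)"

text \<open>
  A weak composition \<open>(s(1), \<dots>, s(n))\<close> is a list of naturals; its entries are indexed from \<open>1\<close>.
\<close>

definition entry :: "nat list \<Rightarrow> nat \<Rightarrow> nat" where
  "entry s i = s ! (i - 1)"

definition decreasing_tree :: "nat list \<Rightarrow> ptree \<Rightarrow> bool" where
  "decreasing_tree s T \<longleftrightarrow>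
     distinct (labels T) \<and> set (labels T) = {1..length s} \<and>
     (\<forall>i ts. Node i ts \<in> subtrees T \<longrightarrow>
        length ts = entry s i + 1 \<and> (\<forall>t\<in>set ts. \<forall>j\<in>set (labels t). j < i))"

text \<open>\<open>in_child T y i x\<close> is the relation \<open>x \<in> T\<^sup>y\<^sub>i\<close>; children are numbered from \<open>0\<close>.\<close>

definition in_child :: "ptree \<Rightarrow> nat \<Rightarrow> nat \<Rightarrow> nat \<Rightarrow> bool" where
  "in_child T y i x \<longleftrightarrow>
     (\<exists>ts. Node y ts \<in> subtrees T \<and> i < length ts \<and> x \<in> set (labels (ts ! i)))"

definition descendant :: "ptree \<Rightarrow> nat \<Rightarrow> nat \<Rightarrow> bool" where
  "descendant T x y \<longleftrightarrow> (\<exists>i. in_child T y i x)"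

definition first_common_ancestor :: "ptree \<Rightarrow> nat \<Rightarrow> nat \<Rightarrow> nat \<Rightarrow> bool" where
  "first_common_ancestor T z x y \<longleftrightarrow>
     descendant T x z \<and> descendant T y z \<and>
     (\<forall>w. descendant T x w \<and> descendant T y w \<longrightarrow> w = z \<or> descendant T z w)"

definition left_of :: "ptree \<Rightarrow> nat \<Rightarrow> nat \<Rightarrow> bool" where
  "left_of T x y \<longleftrightarrow>
     (\<exists>z i j. first_common_ancestor T z x y \<and> in_child T z j x \<and> in_child T z i y \<and> j < i)"

text \<open>
  Only used for \<open>x < y\<close> in a decreasing tree, where \<open>y\<close> is not a descendant of \<open>x\<close>. So in the last
  case, where \<open>x\<close> is neither a descendant of \<open>y\<close> nor left of \<open>y\<close>, it is right of \<open>y\<close>.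
\<close>

definition cardinality :: "nat list \<Rightarrow> ptree \<Rightarrow> nat \<Rightarrow> nat \<Rightarrow> nat" where
  "cardinality s T y x =
     (if descendant T x y then (THE i. in_child T y i x)
      else if left_of T x y then 0
      else entry s y)"

definition s_weak_order :: "nat list \<Rightarrow> ptree gorder" where
  "s_weak_order s =
     \<lparr> carrier = {T. decreasing_tree s T},
       eq = (=),
       le = (\<lambda>R T. \<forall>x y. 1 \<le> x \<and> x < y \<and> y \<le> length s \<longrightarrow>
                cardinality s R y x \<le> cardinality s T y x) \<rparr>"

section \<open>Covers, polygons, semidistributivity\<close>

definition covers :: "('a, 'b) gorder_scheme \<Rightarrow> 'a \<Rightarrow> 'a \<Rightarrow> bool" where
  "covers L y x \<longleftrightarrow>
     x \<in> carrier L \<and> y \<in> carrier L \<and> x \<sqsubset>\<^bsub>L\<^esub> y \<and>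
     \<not> (\<exists>z\<in>carrier L. x \<sqsubset>\<^bsub>L\<^esub> z \<and> z \<sqsubset>\<^bsub>L\<^esub> y)"

text \<open>
  The interval \<open>[x, y]\<close> has exactly two maximal chains \<open>C\<close> and \<open>D\<close>, both finite, which are disjoint
  except at the ends. It would not be enough that \<open>[x, y]\<close> is a union of two such chains: the product
  of a two-element and a three-element chain is such a union, but has a third maximal chain and is
  not a polygon.
\<close>

definition polygon_chains :: "('a, 'b) gorder_scheme \<Rightarrow> 'a \<Rightarrow> 'a \<Rightarrow> 'a set \<Rightarrow> 'a set \<Rightarrow> bool" where
  "polygon_chains L x y C D \<longleftrightarrow>
     {E. pred_on.maxchain \<lbrace>x..y\<rbrace>\<^bsub>L\<^esub> (le L) E} = {C, D} \<and> C \<noteq> D \<and>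
     finite C \<and> finite D \<and> C \<inter> D = {x, y}"

definition polygon :: "('a, 'b) gorder_scheme \<Rightarrow> 'a \<Rightarrow> 'a \<Rightarrow> bool" where
  "polygon L x y \<longleftrightarrow> (\<exists>C D. polygon_chains L x y C D)"

definition polygonal :: "('a, 'b) gorder_scheme \<Rightarrow> bool" where
  "polygonal L \<longleftrightarrow>
     lattice L \<and>
     (\<forall>x y1 y2. covers L y1 x \<and> covers L y2 x \<and> y1 \<noteq> y2 \<longrightarrow> polygon L x (y1 \<squnion>\<^bsub>L\<^esub> y2)) \<and>
     (\<forall>y x1 x2. covers L y x1 \<and> covers L y x2 \<and> x1 \<noteq> x2 \<longrightarrow> polygon L (x1 \<sqinter>\<^bsub>L\<^esub> x2) y)"

definition semidistributive :: "('a, 'b) gorder_scheme \<Rightarrow> bool" where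
  "semidistributive L \<longleftrightarrow>
     lattice L \<and>
     (\<forall>x\<in>carrier L. \<forall>y\<in>carrier L. \<forall>z\<in>carrier L.
        (z \<sqinter>\<^bsub>L\<^esub> x = z \<sqinter>\<^bsub>L\<^esub> y \<longrightarrow> z \<sqinter>\<^bsub>L\<^esub> (x \<squnion>\<^bsub>L\<^esub> y) = z \<sqinter>\<^bsub>L\<^esub> x) \<and>
        (z \<squnion>\<^bsub>L\<^esub> x = z \<squnion>\<^bsub>L\<^esub> y \<longrightarrow> z \<squnion>\<^bsub>L\<^esub> (x \<sqinter>\<^bsub>L\<^esub> y) = z \<squnion>\<^bsub>L\<^esub> x))"

section \<open>Congruence uniform lattices\<close>

definition order_isomorphic :: "('a, 'c) gorder_scheme \<Rightarrow> ('b, 'd) gorder_scheme \<Rightarrow> bool" where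
  "order_isomorphic L M \<longleftrightarrow>
     (\<exists>f. bij_betw f (carrier L) (carrier M) \<and>
          (\<forall>x\<in>carrier L. \<forall>y\<in>carrier L. x \<sqsubseteq>\<^bsub>L\<^esub> y \<longleftrightarrow> f x \<sqsubseteq>\<^bsub>M\<^esub> f y))"

definition down_closure :: "('a, 'b) gorder_scheme \<Rightarrow> 'a set \<Rightarrow> 'a set" where
  "down_closure L I = {x \<in> carrier L. \<exists>y\<in>I. x \<sqsubseteq>\<^bsub>L\<^esub> y}"

text \<open>The two-element chain \<open>0 < 1\<close> is \<^typ>\<open>bool\<close>.\<close>

definition doubling :: "('a, 'b) gorder_scheme \<Rightarrow> 'a set \<Rightarrow> ('a \<times> bool) gorder" where
  "doubling L I =
     \<lparr> carrier = down_closure L I \<times> {False} \<union> ((carrier L - down_closure L I) \<union> I) \<times> {True},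
       eq = (=),
       le = (\<lambda>(x, a) (y, b). x \<sqsubseteq>\<^bsub>L\<^esub> y \<and> a \<le> b) \<rparr>"

text \<open>
  A doubling has another element type than the lattice it comes from. As all lattices in the
  sequence are finite, copies of them on natural numbers are used.
\<close>

inductive interval_doubling_built :: "nat gorder \<Rightarrow> bool" where
  singleton:
    "partial_order M \<Longrightarrow> carrier M = {a} \<Longrightarrow> interval_doubling_built M"
| doubling:
    "interval_doubling_built M \<Longrightarrow> a \<in> carrier M \<Longrightarrow> b \<in> carrier M \<Longrightarrow> a \<sqsubseteq>\<^bsub>M\<^esub> b \<Longrightarrow>
     partial_order N \<Longrightarrow> order_isomorphic N (doubling M \<lbrace>a..b\<rbrace>\<^bsub>M\<^esub>) \<Longrightarrow>
     interval_doubling_built N"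

definition congruence_uniform :: "('a, 'b) gorder_scheme \<Rightarrow> bool" where
  "congruence_uniform L \<longleftrightarrow>
     lattice L \<and> finite (carrier L) \<and>
     (\<exists>M. interval_doubling_built M \<and> order_isomorphic L M)"

section \<open>HH-lattices\<close>

text \<open>
  Chains are listed from bottom to top. A labeling is a function of two elements, of which only the
  values \<open>l a b\<close> for cover relations (\<open>b\<close> covers \<open>a\<close>) matter.
\<close>

definition lists_chain :: "('a, 'b) gorder_scheme \<Rightarrow> 'a list \<Rightarrow> 'a set \<Rightarrow> bool" where
  "lists_chain L xs C \<longleftrightarrow> sorted_wrt (lless L) xs \<and> set xs = C"

definition chain_labels :: "('a \<Rightarrow> 'a \<Rightarrow> 'l) \<Rightarrow> 'a list \<Rightarrow> 'l list" where
  "chain_labels l xs = map (\<lambda>i. l (xs ! i) (xs ! (i + 1))) [0..<length xs - 1]"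

text \<open>
  With \<open>t\<^sub>1, \<dots>, t\<^sub>k\<close> the entries of the list, which Isabelle indexes from \<open>0\<close>; the bound
  \<open>(k + 1) div 2\<close> is the ceiling of \<open>k / 2\<close>.
\<close>

definition ranks_increase_inwards :: "('l \<Rightarrow> nat) \<Rightarrow> 'l list \<Rightarrow> bool" where
  "ranks_increase_inwards r ts \<longleftrightarrow>
     (let k = length ts; t = (\<lambda>i. ts ! (i - 1)) in
      \<forall>i. 1 \<le> i \<and> i < (k + 1) div 2 \<longrightarrow>
        max (r (t i)) (r (t (k + 1 - i))) < min (r (t (i + 1))) (r (t (k - i))))"

definition HH_labeling ::
    "('a, 'b) gorder_scheme \<Rightarrow> ('a \<Rightarrow> 'a \<Rightarrow> 'l) \<Rightarrow> ('l \<Rightarrow> nat) \<Rightarrow> bool" where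
  "HH_labeling L l r \<longleftrightarrow>
     (\<forall>x y C D xs ys.
        polygon_chains L x y C D \<and> lists_chain L xs C \<and> lists_chain L ys D \<longrightarrow>
        (let x1 = xs ! 1; y1 = xs ! (length xs - 2);
             x2 = ys ! 1; y2 = ys ! (length ys - 2)
         in l x x1 = l y2 y \<and> l x x2 = l y1 y) \<and>
        ranks_increase_inwards r (chain_labels l xs) \<and>
        ranks_increase_inwards r (chain_labels l ys))"

text \<open>
  The set of cover relations of a finite lattice is finite, so taking the labels to be natural
  numbers is no restriction.
\<close>

definition HH_lattice :: "('a, 'b) gorder_scheme \<Rightarrow> bool" where
  "HH_lattice L \<longleftrightarrow>
     lattice L \<and> finite (carrier L) \<and> semidistributive L \<and> polygonal L \<and>
     (\<exists>(l :: 'a \<Rightarrow> 'a \<Rightarrow> nat) r. HH_labeling L l r)"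

end

theory Submission
  imports Defs
begin

text \<open>
  A decreasing tree is determined by its function \<open>f (c, a) = #(c, a)\<close>, and the functions that arise are
  those which satisfy, for \<open>a < b < c\<close>, transitivity (\<open>f (b, a) > 0\<close> implies
  \<open>f (c, b) \<le> f (c, a)\<close>) and planarity (\<open>f (b, a) < s b\<close> implies \<open>f (c, a) \<le> f (c, b)\<close>). So the
  \<open>s\<close>-weak order becomes the pointwise order on these functions.

  Above \<open>f\<close>, the covers are the rotations of \<open>f\<close> at its ascents. Two rotations, at \<open>(a, c)\<close> and at
  \<open>(b, d)\<close> with \<open>a < b\<close>, have as their join the rotation of the first one at \<open>(b, d)\<close>; the interval
  below the join is a square unless \<open>c = b\<close>, when each side may contain one more element. Labeling a
  cover by the difference \<open>c - a\<close> of its ascent then gives the labels \<open>b - a, d - a, d - b\<close> in one or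
  the other order. Polygons below an element are treated by the antiautomorphism
  \<open>f \<mapsto> s - f\<close>, the mirror image of trees.

  For congruence uniformity, build up the order by truncating: start with all values capped at \<open>0\<close> and
  raise the caps one unit at a time, those of pairs \<open>(c, k)\<close> with larger \<open>k\<close> first and, for the same
  \<open>k\<close>, with smaller \<open>c\<close> first. Each such step doubles a set of functions that splits into disjoint
  intervals, according to the set of those \<open>b\<close> between \<open>k\<close> and \<open>c\<close> with \<open>f (b, k) = s b > 0\<close>.
  Doublings of intervals preserve semidistributive lattices (Day), so this also yields the lattice
  property and semidistributivity.
\<close>

text \<open>Joins of inversion functions are not pointwise: raising one entry sets off further
  raises by transitivity and planarity. Hence the lattice property is read off from the doublings,
  and joins are computed explicitly only for two covers of one element, where the cascade is short.
  The order in which the caps grow isolates one entry at a time. When the cap at (c, k) is raised,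
  the entries (b, k) and (c, b) with k < b < c have their full caps, while (e, k) with e > c and (d,
  x) with x < k are still capped at 0. So the value at (c, k) is restricted only by a lower and an
  upper condition for each such b. Both values i and i + 1 are possible exactly if for each b either
  f (b, k) = s b and f (c, b) \<le> i, or f (b, k) = 0 and f (c, b) > i. Along the order both
  entries can only grow, whereas for s b > 0 a change between the alternatives makes one of them
  fall. So functions with different choices are incomparable, and the doubled set splits into
  components that are doubled one after the other.\<close>

section \<open>Inversion functions\<close>

text \<open>
  The cap \<open>u\<close> bounds the values; the \<open>min\<close> keeps the transitivity condition meaningful for functions
  that are truncated at \<open>u\<close>.
\<close>

definition inversion_functions :: "(nat \<Rightarrow> nat) \<Rightarrow> (nat \<times> nat \<Rightarrow> nat) \<Rightarrow> (nat \<times> nat \<Rightarrow> nat) set" where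
  "inversion_functions s u =
     {f. f \<le> u \<and>
       (\<forall>a b c. a < b \<and> b < c \<longrightarrow>
          (f (b, a) = 0 \<or> min (f (c, b)) (u (c, a)) \<le> f (c, a)) \<and>
          (f (b, a) = s b \<or> f (c, a) \<le> f (c, b)))}"

definition full_cap :: "(nat \<Rightarrow> nat) \<Rightarrow> nat \<Rightarrow> nat \<times> nat \<Rightarrow> nat" where
  "full_cap s n = (\<lambda>(c, a). if 1 \<le> a \<and> a < c \<and> c \<le> n then s c else 0)"

lemma inversion_functions_iff:
  "f \<in> inversion_functions s u \<longleftrightarrow>
     f \<le> u \<and>
     (\<forall>a b c. a < b \<and> b < c \<longrightarrow>
        (f (b, a) = 0 \<or> min (f (c, b)) (u (c, a)) \<le> f (c, a)) \<and> (f (b, a) = s b \<or> f (c, a) \<le> f (c, b)))"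
  by (simp add: inversion_functions_def)

abbreviation tree_inversions :: "(nat \<Rightarrow> nat) \<Rightarrow> nat \<Rightarrow> (nat \<times> nat \<Rightarrow> nat) set" where
  "tree_inversions s n \<equiv> inversion_functions s (full_cap s n)"

lemma tree_inversions_bound:
  assumes "f \<in> tree_inversions s n"
  shows "f (c, a) \<le> s c" and "0 < f (c, a) \<Longrightarrow> 1 \<le> a \<and> a < c \<and> c \<le> n"
proof -
  have "f (c, a) \<le> full_cap s n (c, a)"
    using assms by (auto simp: inversion_functions_def le_fun_def)
  then show "f (c, a) \<le> s c" and "0 < f (c, a) \<Longrightarrow> 1 \<le> a \<and> a < c \<and> c \<le> n"
    by (auto simp: full_cap_def split: if_splits)
qed

text \<open>With the full cap the \<open>min\<close> disappears: a positive f (c, b) forces c \<le>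
  n, so the cap at (c, a) is s c, which bounds f (c, b).\<close>

lemma tree_inversions_trans:
  assumes "f \<in> tree_inversions s n" "0 < f (b, a)" "b < c"
  shows "f (c, b) \<le> f (c, a)"
proof -
  have ab: "1 \<le> a \<and> a < b" using tree_inversions_bound(2)[OF assms(1,2)] by auto
  then have *: "min (f (c, b)) (full_cap s n (c, a)) \<le> f (c, a)"
    using assms by (fastforce simp: inversion_functions_def)
  show ?thesis
  proof (cases "f (c, b) = 0")
    case False
    then have "c \<le> n" using tree_inversions_bound(2)[OF assms(1), of c b] by auto
    then have "full_cap s n (c, a) = s c" using ab assms(3) by (auto simp: full_cap_def)
    then show ?thesis using * tree_inversions_bound(1)[OF assms(1), of c b] by auto
  qed auto
qed

lemma tree_inversions_planar:
  assumes "f \<in> tree_inversions s n" "f (b, a) < s b" "a < b" "b < c"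
  shows "f (c, a) \<le> f (c, b)"
  using assms unfolding inversion_functions_def by (metis (mono_tags, lifting) mem_Collect_eq nat_neq_iff)

lemma tree_inversionsI:
  assumes "\<And>c a. f (c, a) \<le> s c"
    and "\<And>c a. 0 < f (c, a) \<Longrightarrow> 1 \<le> a \<and> a < c \<and> c \<le> n"
    and "\<And>a b c. 1 \<le> a \<Longrightarrow> a < b \<Longrightarrow> b < c \<Longrightarrow> c \<le> n \<Longrightarrow> 0 < f (b, a) \<Longrightarrow> f (c, b) \<le> f (c, a)"
    and "\<And>a b c. 1 \<le> a \<Longrightarrow> a < b \<Longrightarrow> b < c \<Longrightarrow> c \<le> n \<Longrightarrow> f (b, a) < s b \<Longrightarrow> f (c, a) \<le> f (c, b)"
  shows "f \<in> tree_inversions s n"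
proof -
  have le: "f \<le> full_cap s n"
    using assms(1,2) by (force simp: le_fun_def full_cap_def)
  moreover have "(f (b, a) = 0 \<or> min (f (c, b)) (full_cap s n (c, a)) \<le> f (c, a)) \<and>
      (f (b, a) = s b \<or> f (c, a) \<le> f (c, b))" if "a < b" "b < c" for a b c
  proof (cases "1 \<le> a \<and> c \<le> n")
    case True
    then show ?thesis
      using assms(3)[of a b c] assms(4)[of a b c] assms(1)[of b a] that
      by (cases "f (b, a) = 0"; cases "f (b, a) = s b") (auto simp: min_le_iff_disj)
  next
    case False
    then have "full_cap s n (c, a) = 0" "f (c, a) = 0"
      using assms(2)[of c a] by (auto simp: full_cap_def)
    then show ?thesis by simp
  qed
  ultimately show ?thesis by (auto simp: inversion_functions_def)
qed

lemma finite_inversion_functions: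
  assumes "finite {p. u p \<noteq> 0}"
  shows "finite (inversion_functions s u)"
proof -
  let ?S = "{p. u p \<noteq> 0}"
  have "inversion_functions s u \<subseteq> {f. \<forall>p. (p \<in> ?S \<longrightarrow> f p \<in> {..sum u ?S}) \<and> (p \<notin> ?S \<longrightarrow> f p = 0)}"
  proof
    fix f assume "f \<in> inversion_functions s u"
    then have le: "f p \<le> u p" for p unfolding inversion_functions_iff le_fun_def by blast
    have "f p \<le> sum u ?S" if "p \<in> ?S" for p
      using le[of p] member_le_sum[of p ?S u] assms that by simp
    moreover have "f p = 0" if "p \<notin> ?S" for p
      using le[of p] that by simp
    ultimately show "f \<in> {f. \<forall>p. (p \<in> ?S \<longrightarrow> f p \<in> {..sum u ?S}) \<and> (p \<notin> ?S \<longrightarrow> f p = 0)}"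
      by blast
  qed
  then show ?thesis
    by (rule finite_subset) (rule finite_set_of_finite_funs[OF assms], simp)
qed

lemma finite_tree_inversions: "finite (tree_inversions s n)"
proof (rule finite_inversion_functions)
  have "{p. full_cap s n p \<noteq> 0} \<subseteq> {..n} \<times> {..n}"
    by (auto simp: full_cap_def split: if_splits)
  then show "finite {p. full_cap s n p \<noteq> 0}" by (rule finite_subset) auto
qed

section \<open>Ascents and rotations\<close>

text \<open>
  The two last conditions say that the rotation of \<open>a\<close> past its ancestor \<open>c\<close> is again a tree:
  \<open>a\<close> is last in every smaller subtree which contains it, and \<open>a\<close> is not to the left of \<open>c\<close>. The
  rotation is a cover only if, in addition, the last child of \<open>a\<close> is a leaf, which is what a proper
  ascent requires.
\<close>

definition ascent :: "(nat \<Rightarrow> nat) \<Rightarrow> nat \<Rightarrow> (nat \<times> nat \<Rightarrow> nat) \<Rightarrow> nat \<Rightarrow> nat \<Rightarrow> bool" where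
  "ascent s n f a c \<longleftrightarrow>
     1 \<le> a \<and> a < c \<and> c \<le> n \<and> f (c, a) < s c \<and>
     (\<forall>b. a < b \<and> b < c \<and> f (c, b) \<le> f (c, a) \<longrightarrow> f (b, a) = s b) \<and>
     (\<forall>d>c. f (d, c) \<le> f (d, a))"

definition proper_ascent :: "(nat \<Rightarrow> nat) \<Rightarrow> nat \<Rightarrow> (nat \<times> nat \<Rightarrow> nat) \<Rightarrow> nat \<Rightarrow> nat \<Rightarrow> bool" where
  "proper_ascent s n f a c \<longleftrightarrow>
     ascent s n f a c \<and> (\<forall>x<a. f (c, x) = f (c, a) \<and> 0 < f (a, x) \<longrightarrow> f (a, x) < s a)"

text \<open>For an ascent in a tree these are a and its descendants outside its first child: the
  labels that pass to the next child of c.\<close>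

definition moved :: "(nat \<times> nat \<Rightarrow> nat) \<Rightarrow> nat \<Rightarrow> nat \<Rightarrow> nat set" where
  "moved f a c = insert a {x. x < a \<and> f (c, x) = f (c, a) \<and> 0 < f (a, x)}"

definition rotation :: "(nat \<times> nat \<Rightarrow> nat) \<Rightarrow> nat \<Rightarrow> nat \<Rightarrow> nat \<times> nat \<Rightarrow> nat" where
  "rotation f a c = (\<lambda>(d, x). if d = c \<and> x \<in> moved f a c then Suc (f (c, a)) else f (d, x))"

lemma ascentD:
  assumes "ascent s n f a c"
  shows "1 \<le> a" "a < c" "c \<le> n" "f (c, a) < s c"
    "\<And>b. a < b \<Longrightarrow> b < c \<Longrightarrow> f (c, b) \<le> f (c, a) \<Longrightarrow> f (b, a) = s b"
    "\<And>d. c < d \<Longrightarrow> f (d, c) \<le> f (d, a)"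
  using assms by (auto simp: ascent_def)

lemma proper_ascentD:
  assumes "proper_ascent s n f a c"
  shows "ascent s n f a c"
    "\<And>x. x < a \<Longrightarrow> f (c, x) = f (c, a) \<Longrightarrow> 0 < f (a, x) \<Longrightarrow> f (a, x) < s a"
  using assms by (auto simp: proper_ascent_def)

lemma movedD:
  assumes "x \<in> moved f a c"
  shows "f (c, x) = f (c, a)" "x \<le> a" "x \<noteq> a \<Longrightarrow> x < a" "x \<noteq> a \<Longrightarrow> 0 < f (a, x)"
  using assms by (auto simp: moved_def)

lemma moved_self [simp]: "a \<in> moved f a c"
  by (simp add: moved_def)

lemma rotation_apply:
  "rotation f a c (d, x) = (if d = c \<and> x \<in> moved f a c then Suc (f (d, x)) else f (d, x))"
  by (auto simp: rotation_def movedD)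

lemma rotation_ge: "f \<le> rotation f a c"
  by (auto simp: le_fun_def rotation_apply)

text \<open>Only row c changes, by one on the moved set. An inequality within this row can break
  only where both sides were equal and just the left one moves, so the work is to show that the
  right one then moves too. In later rows a condition can be new only because f (c, x) has become
  positive, and this is covered by the ascent condition on d > c.\<close>

lemma rotation_in_tree_inversions:
  assumes f: "f \<in> tree_inversions s n" and asc: "ascent s n f a c"
  shows "rotation f a c \<in> tree_inversions s n"
proof (rule tree_inversionsI)
  note B = tree_inversions_bound[OF f] and Tr = tree_inversions_trans[OF f]
    and Pl = tree_inversions_planar[OF f] and A = ascentD[OF asc] and M = movedD[of _ f a c]
  have pos: "0 < x" if "x \<in> moved f a c" for x
    using B(2)[of a x] M(4)[OF that] A(1) by (cases "x = a") auto
  show "rotation f a c (d, x) \<le> s d" for d x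
    using B(1)[of d x] A(4) M(1)[of x] by (auto simp: rotation_apply)
  show "1 \<le> x \<and> x < d \<and> d \<le> n" if "0 < rotation f a c (d, x)" for d x
    using that B(2)[of d x] A(2,3) M(2)[of x] pos[of x]
    by (auto simp: rotation_apply split: if_splits)
  show "rotation f a c (z, y) \<le> rotation f a c (z, x)"
    if xyz: "x < y" "y < z" and pos: "0 < rotation f a c (y, x)" for x y z
  proof (cases "y = c \<and> x \<in> moved f a c")
    case True
    then have "f (z, a) \<le> f (z, x)" if "x \<noteq> a"
      using Tr[of a x z] M(4)[of x] that xyz A(2) by auto
    moreover have "f (z, c) \<le> f (z, a)" using A(6)[of z] True xyz by auto
    ultimately show ?thesis using True xyz by (cases "x = a") (auto simp: rotation_apply)
  next
    case False
    then have p: "0 < f (y, x)" using pos by (auto simp: rotation_apply split: if_splits)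
    have le: "f (z, y) \<le> f (z, x)" using Tr[OF p] xyz by auto
    have "x \<in> moved f a c" if "z = c" "y \<in> moved f a c" "f (c, x) = f (c, y)"
    proof -
      have "x < a" using xyz M(2)[OF that(2)] by simp
      moreover have "0 < f (a, x)"
        using Tr[OF p, of a] M(3,4)[OF that(2)] p by (cases "y = a") auto
      ultimately show ?thesis using that M(1)[OF that(2)] by (simp add: moved_def)
    qed
    then show ?thesis using le by (auto simp: rotation_apply Suc_le_eq nat_less_le)
  qed
  show "rotation f a c (z, x) \<le> rotation f a c (z, y)"
    if xyz: "x < y" "y < z" and lt: "rotation f a c (y, x) < s y" for x y z
  proof -
    have lt': "f (y, x) < s y" using lt rotation_ge[of f a c] by (auto simp: le_fun_def intro: le_less_trans)
    then have le: "f (z, x) \<le> f (z, y)" using Pl xyz by auto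
    have "y \<in> moved f a c" if "z = c" "x \<in> moved f a c" "f (c, x) = f (c, y)"
    proof (rule ccontr)
      assume y: "y \<notin> moved f a c"
      have eq: "f (c, y) = f (c, a)" using that M(1)[OF that(2)] by simp
      show False
      proof (cases "a < y")
        case True
        then have "f (y, a) = s y" using A(5)[of y] eq xyz that by simp
        then show False using Tr[of a x y] True M(4)[OF that(2)] lt' by (cases "x = a") auto
      next
        case False
        then have "y < a" using y by (cases "y = a") auto
        then have "f (a, y) = 0" using y eq by (auto simp: moved_def)
        moreover have "0 < f (a, x)" using M(4)[OF that(2)] \<open>y < a\<close> xyz by auto
        ultimately show False using Pl[of y x a] lt' xyz \<open>y < a\<close> by auto
      qed
    qed
    then show ?thesis using le by (auto simp: rotation_apply Suc_le_eq nat_less_le)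
  qed
qed

text \<open>Once the entry at (c, a) is raised, transitivity through a drags the whole moved set
  along. So the rotation is a least element, which identifies both covers and joins.\<close>

lemma rotation_le:
  assumes f: "f \<in> tree_inversions s n" and g: "g \<in> tree_inversions s n"
    and le: "f \<le> g" and lt: "f (c, a) < g (c, a)" and ac: "a < c"
  shows "rotation f a c \<le> g"
proof -
  have le': "f (d, x) \<le> g (d, x)" for d x using le by (simp add: le_fun_def)
  have "Suc (f (c, x)) \<le> g (c, x)" if "x \<in> moved f a c" for x
  proof (cases "x = a")
    case False
    then have "0 < g (a, x)" using movedD(4)[OF that] le'[of a x] by simp
    then have "g (c, a) \<le> g (c, x)" using tree_inversions_trans[OF g] ac by simp
    then show ?thesis using lt movedD(1)[OF that] by simp
  qed (use lt in simp)
  then show ?thesis using le' by (auto simp: le_fun_def rotation_apply)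
qed

lemma exists_proper_ascent:
  assumes f: "f \<in> tree_inversions s n" and g: "g \<in> tree_inversions s n" and less: "f < g"
  obtains a c where "proper_ascent s n f a c" "f (c, a) < g (c, a)"
proof -
  note Tr = tree_inversions_trans[OF f] and Pl = tree_inversions_planar[OF f]
  note Bg = tree_inversions_bound[OF g]
  have le: "f (d, x) \<le> g (d, x)" for d x using less by (simp add: less_le le_fun_def)
  \<comment> \<open>Take \<open>a\<close> maximal, then \<open>c\<close> maximal subject to \<open>A2\<close>, then \<open>a\<close> minimal subject to \<open>A2\<close> and \<open>A4\<close>:
    a violation of \<open>A2\<close>, of \<open>A4\<close> and of properness leads to a smaller \<open>c\<close> or larger \<open>a\<close>, to a larger
    \<open>c\<close>, and to a smaller \<open>a\<close>, respectively.\<close>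
  define diff where "diff c a \<longleftrightarrow> f (c, a) < g (c, a)" for c a
  have diffD: "1 \<le> a \<and> a < c \<and> c \<le> n" if "diff c a" for c a
    using that Bg(2)[of c a] by (auto simp: diff_def)
  define A2 where "A2 c a \<longleftrightarrow> (\<forall>b. a < b \<and> b < c \<and> f (c, b) \<le> f (c, a) \<longrightarrow> f (b, a) = s b)" for c a
  define A4 where "A4 c a \<longleftrightarrow> (\<forall>d>c. f (d, c) \<le> f (d, a))" for c a
  have "\<exists>d x. diff d x"
    using less by (auto simp: less_fun_def le_fun_def diff_def not_le)
  then have ex: "\<exists>a. \<exists>c. diff c a" by auto
  define a where "a = (GREATEST a. \<exists>c. diff c a)"
  have bd: "\<forall>a. (\<exists>c. diff c a) \<longrightarrow> a \<le> n" using diffD by fastforce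
  have "\<exists>c. diff c a" unfolding a_def by (rule GreatestI_ex_nat[OF ex]) (use bd in auto)
  have amax: "x \<le> a" if "diff c x" for c x
    unfolding a_def by (rule Greatest_le_nat) (use that bd in auto)
  define c0 where "c0 = (LEAST c. diff c a)"
  have c0: "diff c0 a" unfolding c0_def by (rule LeastI_ex) fact
  have c0min: "\<not> diff d a" if "d < c0" for d using that not_less_Least unfolding c0_def by blast
  \<comment> \<open>By minimality of c0 and maximality of a, f and g agree at (b, a) and at (c0, b),
    so planarity of g at this triple gives the claim for f.\<close>
  have "A2 c0 a" unfolding A2_def
  proof (intro allI impI, rule ccontr)
    fix b assume b: "a < b \<and> b < c0 \<and> f (c0, b) \<le> f (c0, a)" and ne: "f (b, a) \<noteq> s b"
    have "\<not> diff b a" "\<not> diff c0 b" using b c0min amax[of c0 b] by auto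
    then have eq: "g (b, a) = f (b, a)" "g (c0, b) = f (c0, b)"
      using le[of b a] le[of c0 b] by (auto simp: diff_def)
    have "g (b, a) < s b" using eq ne Bg(1)[of b a] by simp
    then have "g (c0, a) \<le> g (c0, b)" using tree_inversions_planar[OF g] b by simp
    then show False using eq b c0 by (simp add: diff_def)
  qed
  then have ex2: "\<exists>c. diff c a \<and> A2 c a" using c0 by auto
  define c where "c = (GREATEST c. diff c a \<and> A2 c a)"
  have bd2: "\<forall>c. diff c a \<and> A2 c a \<longrightarrow> c \<le> n" using diffD by fastforce
  have c: "diff c a" "A2 c a"
    using GreatestI_ex_nat[OF ex2, of n] bd2 by (auto simp: c_def)
  have cmax: "\<not> (diff d a \<and> A2 d a)" if "c < d" for d
    using that Greatest_le_nat[of "\<lambda>c. diff c a \<and> A2 c a" d n] bd2 by (auto simp: c_def)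
  have "A4 c a"
  proof (rule ccontr)
    assume "\<not> A4 c a"
    then have ex3: "\<exists>d. c < d \<and> f (d, a) < f (d, c)" by (auto simp: A4_def not_le)
    \<comment> \<open>The least violation is taken for the sake of labels b between c and d: it
      gives f (b, c) \<le> f (b, a), while planarity forces f (b, c) = s b.\<close>
    define d where "d = (LEAST d. c < d \<and> f (d, a) < f (d, c))"
    have d: "c < d" "f (d, a) < f (d, c)" using LeastI_ex[OF ex3] by (auto simp: d_def)
    have dmin: "f (e, c) \<le> f (e, a)" if "c < e" "e < d" for e
      using not_less_Least[of e "\<lambda>d. c < d \<and> f (d, a) < f (d, c)"] that by (auto simp: d_def)
    have ac: "a < c" using diffD c by simp
    have z: "f (c, a) = 0" using Tr[of c a d] d by auto
    have "g (d, c) \<le> g (d, a)" using tree_inversions_trans[OF g, of c a d] c d by (auto simp: diff_def)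
    then have "diff d a" using d le[of d c] by (simp add: diff_def)
    moreover have "A2 d a" unfolding A2_def
    proof (intro allI impI)
      fix b assume b: "a < b \<and> b < d \<and> f (d, b) \<le> f (d, a)"
      consider "b = c" | "b < c" | "c < b" by linarith
      then show "f (b, a) = s b"
      proof cases
        case 1
        then show ?thesis using b d by simp
      next
        case 2
        have "f (c, b) = 0" using Tr[of c b d] b d by auto
        then show ?thesis using c(2) b 2 by (auto simp: A2_def)
      next
        case 3
        have "\<not> f (b, c) < s b" using Pl[of b c d] b d 3 by auto
        then show ?thesis
          using dmin[of b] 3 b tree_inversions_bound(1)[OF f, of b a] by auto
      qed
    qed
    ultimately show False using cmax d by blast
  qed
  then have ex4: "\<exists>a. diff c a \<and> A2 c a \<and> A4 c a" using c by auto
  define a' where "a' = (LEAST a. diff c a \<and> A2 c a \<and> A4 c a)"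
  have a': "diff c a'" "A2 c a'" "A4 c a'" using LeastI_ex[OF ex4] by (auto simp: a'_def)
  have a'min: "\<not> (diff c x \<and> A2 c x \<and> A4 c x)" if "x < a'" for x
    using not_less_Least[of x "\<lambda>a. diff c a \<and> A2 c a \<and> A4 c a"] that by (auto simp: a'_def)
  have a'c: "a' < c" "1 \<le> a'" "c \<le> n" using diffD a' by auto
  have "f (a', y) < s a'" if y: "y < a'" "f (c, y) = f (c, a')" "0 < f (a', y)" for y
  proof (rule ccontr)
    assume ns: "\<not> f (a', y) < s a'"
    let ?P = "\<lambda>x. x < a' \<and> f (c, x) = f (c, a') \<and> f (a', x) = s a'"
    have sp: "0 < s a'" and Py: "?P y" using y ns tree_inversions_bound(1)[OF f, of a' y] by auto
    \<comment> \<open>The greatest x is taken because a label b between x and a' that violates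
      \<open>A2\<close> would satisfy \<open>?P\<close> as well, by planarity at b and transitivity
      at a'.\<close>
    define x where "x = (GREATEST x. ?P x)"
    have x: "?P x" using GreatestI_nat[of ?P y a'] Py by (auto simp: x_def)
    have xmax: "\<not> ?P z" if "x < z" for z
      using Greatest_le_nat[of ?P z a'] that by (auto simp: x_def)
    have "g (c, a') \<le> g (c, x)"
      using tree_inversions_trans[OF g, of a' x c] le[of a' x] x sp a'c by simp
    then have "diff c x" using a'(1) x by (simp add: diff_def)
    moreover have "A4 c x" unfolding A4_def
    proof (intro allI impI)
      fix d assume d: "c < d"
      have "f (d, a') \<le> f (d, x)" using Tr[of a' x d] x sp a'c d by simp
      moreover have "f (d, c) \<le> f (d, a')" using a'(3) d by (simp add: A4_def)
      ultimately show "f (d, c) \<le> f (d, x)" by simp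
    qed
    moreover have "A2 c x" unfolding A2_def
    proof (intro allI impI, rule ccontr)
      fix b assume b: "x < b \<and> b < c \<and> f (c, b) \<le> f (c, x)" and ne: "f (b, x) \<noteq> s b"
      have lt: "f (b, x) < s b" using ne tree_inversions_bound(1)[OF f, of b x] by simp
      consider "b = a'" | "b < a'" | "a' < b" by linarith
      then show False
      proof cases
        case 1
        then show ?thesis using ne x by simp
      next
        case 2
        have eq: "f (a', b) = s a'"
          using Pl[of b x a'] lt b 2 x tree_inversions_bound(1)[OF f, of a' b] by simp
        have "f (c, a') \<le> f (c, b)" using Tr[of a' b c] eq sp a'c by simp
        then show ?thesis using xmax[of b] b 2 x eq by simp
      next
        case 3
        have "f (b, a') = s b" using a'(2) 3 b x by (simp add: A2_def)
        then show ?thesis using Tr[of a' x b] x sp 3 lt by simp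
      qed
    qed
    ultimately show False using a'min[of x] x by blast
  qed
  moreover have "f (c, a') < s c" using a'(1) Bg(1)[of c a'] by (simp add: diff_def)
  ultimately have "proper_ascent s n f a' c"
    using a' a'c by (simp add: proper_ascent_def ascent_def A2_def A4_def)
  then show thesis using that a'(1) by (simp add: diff_def)
qed

section \<open>Polygons above an element\<close>

definition pord :: "'a::order set \<Rightarrow> 'a gorder" where
  "pord X = \<lparr> carrier = X, eq = (=), le = (\<le>) \<rparr>"

lemma pord_simps [simp]:
  "carrier (pord X) = X" "x \<sqsubseteq>\<^bsub>pord X\<^esub> y \<longleftrightarrow> x \<le> y" "x .=\<^bsub>pord X\<^esub> y \<longleftrightarrow> x = y"
  "x \<sqsubset>\<^bsub>pord X\<^esub> y \<longleftrightarrow> x < y" "le (pord X) = (\<le>)" "lless (pord X) = (<)"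
  by (auto simp: pord_def lless_def fun_eq_iff)

lemma partial_order_pord: "partial_order (pord X)"
  by unfold_locales (auto simp: pord_def)

lemma interval_pord [simp]: "\<lbrace>x..y\<rbrace>\<^bsub>pord X\<^esub> = {z \<in> X. x \<le> z \<and> z \<le> y}"
  by (auto simp: at_least_at_most_def)

text \<open>A chain cannot contain interior elements of both sides, so it lies in C or in D. Neither
  of these contains the other, hence both are maximal and there is no third one.\<close>

lemma polygon_chains_pordI:
  fixes X :: "'a::order set"
  assumes fin: "finite C" "finite D" and inter: "C \<inter> D = {x, y}" and neq: "C \<noteq> {x, y}" "D \<noteq> {x, y}"
    and union: "C \<union> D = {z \<in> X. x \<le> z \<and> z \<le> y}"
    and chain: "\<And>u v. u \<in> C \<Longrightarrow> v \<in> C \<Longrightarrow> u \<le> v \<or> v \<le> u" "\<And>u v. u \<in> D \<Longrightarrow> v \<in> D \<Longrightarrow> u \<le> v \<or> v \<le> u"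
    and incomp: "\<And>u v. u \<in> C - {x, y} \<Longrightarrow> v \<in> D - {x, y} \<Longrightarrow> \<not> u \<le> v \<and> \<not> v \<le> u"
  shows "polygon_chains (pord X) x y C D"
proof -
  let ?I = "{z \<in> X. x \<le> z \<and> z \<le> y}"
  interpret pred_on ?I "(\<le>)" .
  have chain_iff: "chain E \<longleftrightarrow> E \<subseteq> ?I \<and> (\<forall>u\<in>E. \<forall>v\<in>E. u \<le> v \<or> v \<le> u)" for E
    by (auto simp: chain_def)
  have CD: "chain C" "chain D" using chain union by (auto simp: chain_iff)
  have sub: "E \<subseteq> C \<or> E \<subseteq> D" if "chain E" for E
  proof (rule ccontr)
    assume "\<not> (E \<subseteq> C \<or> E \<subseteq> D)"
    then obtain u v where "u \<in> E" "u \<notin> D" "v \<in> E" "v \<notin> C" by blast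
    moreover from this that union have "u \<in> C" "v \<in> D" by (auto simp: chain_iff)
    ultimately have "u \<in> C - {x, y}" "v \<in> D - {x, y}" using inter by auto
    then show False using incomp[of u v] that \<open>u \<in> E\<close> \<open>v \<in> E\<close> by (auto simp: chain_iff)
  qed
  have nsub: "\<not> C \<subseteq> D" "\<not> D \<subseteq> C" using inter neq by auto
  have "maxchain E \<longleftrightarrow> E = C \<or> E = D" for E
  proof
    assume E: "maxchain E"
    then show "E = C \<or> E = D" using sub[of E] CD by (auto simp: maxchain_def)
  next
    assume "E = C \<or> E = D"
    moreover have "\<not> chain S" if "E \<subset> S" for S
      using that sub[of S] nsub \<open>E = C \<or> E = D\<close> by blast
    ultimately show "maxchain E" using CD by (auto simp: maxchain_def)
  qed
  then show ?thesis using fin inter nsub by (auto simp: polygon_chains_def)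
qed

text \<open>The elements m1 and m2 are mere candidates: if one of them is not in X or not strictly
  between, its side has length two. The sides are incomparable because y is the only element of the
  interval above both atoms.\<close>

lemma two_sided_polygon:
  fixes X :: "'a::order set"
  assumes X: "x \<in> X" "y1 \<in> X" "y2 \<in> X" "y \<in> X"
    and lt: "x < y1" "x < y2" "y1 < y" "y2 < y"
    and cover: "\<And>z. z \<in> X \<Longrightarrow> x \<le> z \<Longrightarrow> z \<le> y \<Longrightarrow> z = x \<or> y1 \<le> z \<or> y2 \<le> z"
    and both: "\<And>z. z \<in> X \<Longrightarrow> y1 \<le> z \<Longrightarrow> y2 \<le> z \<Longrightarrow> z \<le> y \<Longrightarrow> z = y"
    and side1: "\<And>z. z \<in> X \<Longrightarrow> y1 \<le> z \<Longrightarrow> z \<le> y \<Longrightarrow> z = y1 \<or> z = m1 \<or> z = y"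
    and side2: "\<And>z. z \<in> X \<Longrightarrow> y2 \<le> z \<Longrightarrow> z \<le> y \<Longrightarrow> z = y2 \<or> z = m2 \<or> z = y"
  obtains xs ys where "polygon_chains (pord X) x y (set xs) (set ys)"
    "sorted_wrt (<) xs" "sorted_wrt (<) ys"
    "xs = [x, y1, y] \<or> xs = [x, y1, m1, y] \<and> m1 \<in> X \<and> y1 < m1 \<and> m1 < y"
    "ys = [x, y2, y] \<or> ys = [x, y2, m2, y] \<and> m2 \<in> X \<and> y2 < m2 \<and> m2 < y"
proof -
  have side: "\<exists>zs. set zs = insert x {z \<in> X. w \<le> z \<and> z \<le> y} \<and> sorted_wrt (<) zs \<and>
      (zs = [x, w, y] \<or> zs = [x, w, m, y] \<and> m \<in> X \<and> w < m \<and> m < y)"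
    if "w \<in> X" "x < w" "w < y" and "\<And>z. z \<in> X \<Longrightarrow> w \<le> z \<Longrightarrow> z \<le> y \<Longrightarrow> z = w \<or> z = m \<or> z = y" for w m
  proof (cases "m \<in> X \<and> w < m \<and> m < y")
    case True
    then have "insert x {z \<in> X. w \<le> z \<and> z \<le> y} = {x, w, m, y}"
      using that X by auto
    then show ?thesis using True that by (intro exI[of _ "[x, w, m, y]"]) auto
  next
    case False
    have "insert x {z \<in> X. w \<le> z \<and> z \<le> y} = {x, w, y}"
      using that(1-3) X False by (auto dest: that(4))
    then show ?thesis using that by (intro exI[of _ "[x, w, y]"]) auto
  qed
  obtain xs where xs: "set xs = insert x {z \<in> X. y1 \<le> z \<and> z \<le> y}" "sorted_wrt (<) xs"
      "xs = [x, y1, y] \<or> xs = [x, y1, m1, y] \<and> m1 \<in> X \<and> y1 < m1 \<and> m1 < y"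
    using side[OF X(2) lt(1,3) side1] by auto
  obtain ys where ys: "set ys = insert x {z \<in> X. y2 \<le> z \<and> z \<le> y}" "sorted_wrt (<) ys"
      "ys = [x, y2, y] \<or> ys = [x, y2, m2, y] \<and> m2 \<in> X \<and> y2 < m2 \<and> m2 < y"
    using side[OF X(3) lt(2,4) side2] by auto
  have n12: "\<not> y1 \<le> y2" "\<not> y2 \<le> y1"
    using both[of y2] both[of y1] X lt by (auto simp: less_le)
  have chain: "u \<le> v \<or> v \<le> u" if "sorted_wrt (<) zs" "u \<in> set zs" "v \<in> set zs" for zs and u v :: 'a
    using that by (induction zs) (auto dest: less_imp_le)
  have "polygon_chains (pord X) x y (set xs) (set ys)"
  proof (rule polygon_chains_pordI)
    show "set xs \<inter> set ys = {x, y}"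
      using lt X both unfolding xs(1) ys(1) by (auto simp: less_le)
    show "set xs \<noteq> {x, y}" "set ys \<noteq> {x, y}" using xs(3) ys(3) lt by auto
    show "set xs \<union> set ys = {z \<in> X. x \<le> z \<and> z \<le> y}"
      using cover lt X unfolding xs(1) ys(1) by (auto intro: order.trans less_imp_le)
    show "u \<le> v \<or> v \<le> u" if "u \<in> set xs" "v \<in> set xs" for u v using chain[OF xs(2) that] .
    show "u \<le> v \<or> v \<le> u" if "u \<in> set ys" "v \<in> set ys" for u v using chain[OF ys(2) that] .
    show "\<not> u \<le> v \<and> \<not> v \<le> u" if "u \<in> set xs - {x, y}" "v \<in> set ys - {x, y}" for u v
      using that both[of u] both[of v] unfolding xs(1) ys(1) by (auto intro: order.trans)
  qed auto
  then show thesis using that xs ys by blast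
qed

text \<open>On the cover by a rotation of \<open>a\<close> past \<open>c\<close> this is \<open>c - a\<close>; it also serves as its own rank.\<close>

definition inversion_label :: "(nat \<times> nat \<Rightarrow> nat) \<Rightarrow> (nat \<times> nat \<Rightarrow> nat) \<Rightarrow> nat" where
  "inversion_label f g = (LEAST m. \<exists>c a. f (c, a) \<noteq> g (c, a) \<and> m = c - a)"

lemma inversion_label_eqI:
  assumes "f (c, a) \<noteq> g (c, a)" "\<And>e x. f (e, x) \<noteq> g (e, x) \<Longrightarrow> c - a \<le> e - x"
  shows "inversion_label f g = c - a"
  unfolding inversion_label_def by (rule Least_equality) (use assms in auto)

text \<open>All changed entries are (c, x) with x \<le> a, and (a, c) itself gives the least
  difference.\<close>

lemma inversion_label_rotation: "inversion_label f (rotation f a c) = c - a"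
  by (rule inversion_label_eqI) (auto simp: rotation_apply dest: movedD split: if_splits)

section \<open>The join of two covers of f and the interval below it\<close>

locale two_ascents =
  fixes s n f a c b d
  assumes f: "f \<in> tree_inversions s n"
    and ac: "proper_ascent s n f a c" and bd: "proper_ascent s n f b d" and ab: "a < b"
begin

abbreviation "X \<equiv> moved f a c"
abbreviation "Y \<equiv> moved f b d"
abbreviation "k1 \<equiv> rotation f a c"
abbreviation "k2 \<equiv> rotation f b d"
abbreviation "J \<equiv> rotation k1 b d"

lemmas Tr = tree_inversions_trans[OF f] and Pl = tree_inversions_planar[OF f]
lemmas A1 = ascentD[OF proper_ascentD(1)[OF ac]] and A2 = ascentD[OF proper_ascentD(1)[OF bd]]
lemmas P1 = proper_ascentD(2)[OF ac] and P2 = proper_ascentD(2)[OF bd]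
lemmas M1 = movedD[of _ f a c] and M2 = movedD[of _ f b d]

lemma b_notin_X: "b \<notin> X" using M1(2)[of b] ab by auto

lemma k1_in: "k1 \<in> tree_inversions s n"
  by (rule rotation_in_tree_inversions[OF f proper_ascentD(1)[OF ac]])

lemma k2_in: "k2 \<in> tree_inversions s n"
  by (rule rotation_in_tree_inversions[OF f proper_ascentD(1)[OF bd]])

text \<open>The first rotation changes only entries with second component at most a, and an ascent
  at (b, d) concerns only second components from b on.\<close>

lemma ascent_k1: "ascent s n k1 b d"
proof -
  have "k1 (e, x) = f (e, x)" if "b \<le> x" for e x
    using that ab M1(2)[of x] by (auto simp: rotation_apply)
  then have eq: "k1 (e, b) = f (e, b)" "b < x \<Longrightarrow> k1 (e, x) = f (e, x)" for e x by auto
  show ?thesis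
    unfolding ascent_def eq(1) using A2(1-4,6) by (auto simp: eq(2)[OF A2(2)] eq(2) intro: A2(5))
qed

lemma J_in: "J \<in> tree_inversions s n"
  by (rule rotation_in_tree_inversions[OF k1_in ascent_k1])

text \<open>A cycle f (d, x) \<le> f (d, b) \<le> f (d, a) \<le> f (d, x): planarity at b, the
  condition on d > c in the first ascent, and transitivity through a.\<close>

lemma d_row:
  assumes "c = b" "x \<in> X"
  shows "f (d, x) = f (d, b)"
proof -
  have "f (d, x) \<le> f (d, b)"
    using Pl[of b x d] M1(1,2)[OF assms(2)] A1(4) A2(2) ab assms(1) by simp
  moreover have "f (d, b) \<le> f (d, a)" using A1(6)[of d] assms(1) A2(2) by simp
  moreover have "f (d, a) \<le> f (d, x)"
    using Tr[of a x d] M1(4)[OF assms(2)] ab A2(2) by (cases "x = a") auto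
  ultimately show ?thesis by simp
qed

text \<open>A common x gives f (d, a) = f (d, b), so the first ascent forces f (b, a) = s b. By
  transitivity through a also f (b, x) = s b, against properness of the second ascent.\<close>

lemma disjoint_moved:
  assumes "c = d" "x \<in> X"
  shows "x \<notin> Y"
proof
  assume x: "x \<in> Y"
  have "f (b, a) = s b" using A1(5)[of b] ab A2(2) assms M1(1)[OF assms(2)] M2(1)[OF x] by simp
  moreover have "x \<noteq> b" "x < b" using M1(2)[OF assms(2)] ab by auto
  moreover from this have "f (b, x) < s b" using P2[of x] M2(1,4)[OF x] by simp
  moreover have "f (b, a) \<le> f (b, x)" using Tr[of a x b] M1(4)[OF assms(2)] ab by (cases "x = a") auto
  ultimately show False by simp
qed

text \<open>The first rotation influences the second one only if c = b: then the entries (b, x) with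
  x in X have become positive, and by \<open>d_row\<close> these x now move together with b.\<close>

lemma moved_k1: "moved k1 b d = (if c = b then Y \<union> X else Y)"
proof (cases "c = b")
  case True
  then show ?thesis
    using d_row M1(2) ab A2(2) b_notin_X
    by (auto simp: moved_def[of _ b d] rotation_apply intro: le_less_trans)
next
  case False
  \<comment> \<open>For c = d an x of X could have been raised to the value f (d, b) and so join the
    moved set; transitivity excludes it.\<close>
  have "\<not> (x < b \<and> Suc (f (d, x)) = f (d, b) \<and> 0 < f (b, x))" for x
    using Tr[of b x d] A2(2) by (metis Suc_n_not_le_n)
  then show ?thesis
    using False disjoint_moved
    by (auto simp: moved_def[of _ b d] rotation_apply b_notin_X)
qed

lemma J_apply:
  "J (e, x) = (if e = c \<and> x \<in> X \<or> e = d \<and> (x \<in> Y \<or> c = b \<and> x \<in> X) then Suc (f (e, x)) else f (e, x))"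
  using disjoint_moved A2(2) by (auto simp: rotation_apply[of _ b d] moved_k1 rotation_apply[of f a])

lemma k2_le_J: "k2 \<le> J"
  by (auto simp: le_fun_def J_apply rotation_apply[of f b])

text \<open>The bound k2 \<le> z raises (d, b) above its value in k1, so the minimality of the
  rotation of k1 applies. With \<open>k2_le_J\<close> this makes J the join.\<close>

lemma J_least:
  assumes z: "z \<in> tree_inversions s n" and "k1 \<le> z" "k2 \<le> z"
  shows "J \<le> z"
proof (rule rotation_le[OF k1_in z \<open>k1 \<le> z\<close> _ A2(2)])
  have "k2 (d, b) \<le> z (d, b)" using \<open>k2 \<le> z\<close> by (simp add: le_fun_def)
  then show "k1 (d, b) < z (d, b)" by (simp add: rotation_apply b_notin_X)
qed

context
  fixes z assumes z: "z \<in> tree_inversions s n" and fz: "f \<le> z" and zJ: "z \<le> J"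
begin

lemma z_bounds: "f (e, x) \<le> z (e, x)" "z (e, x) \<le> J (e, x)"
  using fz zJ by (auto simp: le_fun_def)

lemma row_a: "z (a, x) = f (a, x)"
  using z_bounds[of a x] A1(2) A2(2) ab by (auto simp: J_apply)

text \<open>Properness gives f (a, x) < s a, and row a is the same in z, so planarity bounds z (c,
  x) by z (c, a).\<close>

lemma X_unchanged:
  assumes "z (c, a) = f (c, a)" "x \<in> X"
  shows "z (c, x) = f (c, x)"
proof (cases "x = a")
  case False
  then have "z (a, x) < s a" using P1[of x] M1[OF assms(2)] row_a by simp
  then have "z (c, x) \<le> z (c, a)" using tree_inversions_planar[OF z] M1(3)[OF assms(2) False] A1(2) by simp
  then show ?thesis using assms(1) M1(1)[OF assms(2)] z_bounds(1)[of c x] by simp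
qed (use assms in simp)

text \<open>By properness f (a, x) lies strictly between 0 and s a, so transitivity and planarity
  give both inequalities: in row d the set X moves as a block.\<close>

lemma row_d_X:
  assumes "c = b" "x \<in> X"
  shows "z (d, x) = z (d, a)"
proof (cases "x = a")
  case False
  have "0 < z (a, x)" "z (a, x) < s a" using P1[of x] M1[OF assms(2)] row_a False by auto
  then show ?thesis
    using tree_inversions_trans[OF z, of a x d] tree_inversions_planar[OF z, of a x d]
      M1(3)[OF assms(2) False] ab A2(2) by simp
qed simp

text \<open>If (d, x) grows and (d, b) does not, planarity forces z (b, x) = s b. Since f (b, x) < s
  b, the entry (b, x) has changed, and below J this happens only for c = b and x in X.\<close>

lemma Y_changed:
  assumes "z (d, b) = f (d, b)" "z (d, x) \<noteq> f (d, x)" "d \<noteq> c \<or> x \<in> Y"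
  shows "c = b \<and> z (c, a) \<noteq> f (c, a) \<and> x \<in> X"
proof -
  have x: "x \<in> Y \<or> c = b \<and> x \<in> X"
    using assms(2,3) z_bounds[of d x] by (auto simp: J_apply split: if_splits)
  then have eq: "f (d, x) = f (d, b)" using d_row[of x] M2(1)[of x] by blast
  have "x \<noteq> b" using assms(1,2) by auto
  then have xb: "x < b" using x M2(3)[of x] M1(2)[of x] ab by linarith
  have "\<not> z (b, x) < s b"
    using tree_inversions_planar[OF z, of b x d] xb A2(2) assms(1,2) eq z_bounds(1)[of d x] by auto
  moreover have "f (b, x) < s b"
    using x
  proof
    assume "x \<in> Y"
    then show ?thesis using P2[of x] M2(1,4)[of x] xb by simp
  next
    assume "c = b \<and> x \<in> X"
    then show ?thesis using M1(1)[of x] A1(4) by metis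
  qed
  ultimately have "z (b, x) \<noteq> f (b, x)" by auto
  then have "b = c \<and> x \<in> X" using z_bounds[of b x] A2(2) by (auto simp: J_apply split: if_splits)
  then show ?thesis using X_unchanged \<open>z (b, x) \<noteq> f (b, x)\<close> by auto
qed

lemma ge_k1: "z (c, a) \<noteq> f (c, a) \<Longrightarrow> k1 \<le> z"
  using rotation_le[OF f z fz, of c a] z_bounds(1)[of c a] A1(2) by simp

lemma ge_k2: "z (d, b) \<noteq> f (d, b) \<Longrightarrow> k2 \<le> z"
  using rotation_le[OF f z fz, of d b] z_bounds(1)[of d b] A2(2) by simp

lemma interval_cover: "z = f \<or> k1 \<le> z \<or> k2 \<le> z"
proof (cases "z (c, a) = f (c, a) \<and> z (d, b) = f (d, b)")
  case True
  have "z (e, x) = f (e, x)" for e x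
  proof (cases "e = c \<and> x \<in> X")
    case True
    then show ?thesis using X_unchanged \<open>z (c, a) = f (c, a) \<and> _\<close> by simp
  next
    case False
    then show ?thesis
      using Y_changed[of x] True z_bounds[of e x] by (auto simp: J_apply split: if_splits)
  qed
  then show ?thesis by auto
qed (use ge_k1 ge_k2 in blast)

end

text \<open>The only elements that may lie between \<open>k1\<close> and \<open>J\<close>, respectively \<open>k2\<close> and \<open>J\<close>.\<close>

definition m1 where "m1 = (if c = b then (\<lambda>(e, x). if e = d \<and> x \<in> X then Suc (f (e, x)) else k1 (e, x)) else k1)"
definition m2 where "m2 = (if c = b then (\<lambda>(e, x). if e = d \<and> x \<in> X then Suc (f (e, x)) else k2 (e, x)) else k2)"

lemma m1_apply: "m1 (e, x) = (if c = b \<and> e = d \<and> x \<in> X then Suc (f (e, x)) else k1 (e, x))"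
  by (auto simp: m1_def)

lemma m2_apply: "m2 (e, x) = (if c = b \<and> e = d \<and> x \<in> X then Suc (f (e, x)) else k2 (e, x))"
  by (auto simp: m2_def)

text \<open>If (d, b) is raised, z lies above k2 too and equals J. Otherwise only the entries (d, x)
  with x in X can still move, and only for c = b; they move together and by one, which leaves
  \<open>m1\<close>.\<close>

lemma above_k1:
  assumes z: "z \<in> tree_inversions s n" "k1 \<le> z" "z \<le> J"
  shows "z = k1 \<or> z = m1 \<or> z = J"
proof -
  have fz: "f \<le> z" using rotation_ge[of f a c] z(2) by (rule order.trans)
  note zz = z(1) fz z(3)
  have k1z: "k1 (e, x) \<le> z (e, x)" and zJ: "z (e, x) \<le> J (e, x)" for e x using z by (auto simp: le_fun_def)
  show ?thesis
  proof (cases "z (d, b) = f (d, b)")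
    case False
    then have "J \<le> z" using J_least[OF z(1,2)] ge_k2[OF zz] by blast
    then show ?thesis using z(3) by auto
  next
    case True
    have Y: "z (d, x) = f (d, x)" if "x \<in> Y" "c \<noteq> b \<or> x \<notin> X" for x
      using Y_changed[OF zz True, of x] that by auto
    have eq: "z (e, x) = k1 (e, x)" if "c = b \<Longrightarrow> e = d \<Longrightarrow> x \<notin> X" for e x
      using k1z[of e x] zJ[of e x] Y[of x] that
      by (cases "e = c \<and> x \<in> X") (auto simp: J_apply rotation_apply[of f a] split: if_splits)
    show ?thesis
    proof (cases "c = b")
      case False
      then show ?thesis using eq by (auto simp: fun_eq_iff)
    next
      case cb: True
      have X: "z (d, x) = z (d, a)" "f (d, x) = f (d, a)" if "x \<in> X" for x
        using row_d_X[OF zz cb that] d_row[OF cb that] d_row[OF cb moved_self] by auto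
      have "z (d, a) = f (d, a) \<or> z (d, a) = Suc (f (d, a))"
        using zJ[of d a] z_bounds(1)[OF zz, of d a] by (auto simp: J_apply split: if_splits)
      then show ?thesis
      proof
        assume "z (d, a) = f (d, a)"
        then have "z (e, x) = k1 (e, x)" for e x
          using eq[of e x] X[of x] cb A2(2) by (cases "e = d \<and> x \<in> X") (auto simp: rotation_apply)
        then show ?thesis by (auto simp: fun_eq_iff)
      next
        assume "z (d, a) = Suc (f (d, a))"
        then have "z (e, x) = m1 (e, x)" for e x
          unfolding m1_apply using eq[of e x] X[of x] cb by (cases "e = d \<and> x \<in> X") auto
        then show ?thesis by (auto simp: fun_eq_iff)
      qed
    qed
  qed
qed

text \<open>The same argument with the entry (c, a) in place of (d, b): if it is not raised, X stays
  put in row c, and only the block X of row d is left.\<close>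

lemma above_k2:
  assumes z: "z \<in> tree_inversions s n" "k2 \<le> z" "z \<le> J"
  shows "z = k2 \<or> z = m2 \<or> z = J"
proof -
  have fz: "f \<le> z" using rotation_ge[of f b d] z(2) by (rule order.trans)
  note zz = z(1) fz z(3)
  have k2z: "k2 (e, x) \<le> z (e, x)" and zJ: "z (e, x) \<le> J (e, x)" for e x using z by (auto simp: le_fun_def)
  show ?thesis
  proof (cases "z (c, a) = f (c, a)")
    case False
    then have "J \<le> z" using J_least[OF z(1) _ z(2)] ge_k1[OF zz] by blast
    then show ?thesis using z(3) by auto
  next
    case True
    have X: "z (c, x) = f (c, x)" if "x \<in> X" for x
      by (rule X_unchanged[OF zz True that])
    have eq: "z (e, x) = k2 (e, x)" if "c = b \<Longrightarrow> e = d \<Longrightarrow> x \<notin> X" for e x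
      using k2z[of e x] zJ[of e x] X[of x] that disjoint_moved
      by (cases "e = c \<and> x \<in> X") (auto simp: J_apply rotation_apply[of f b] split: if_splits)
    show ?thesis
    proof (cases "c = b")
      case False
      then show ?thesis using eq by (auto simp: fun_eq_iff)
    next
      case cb: True
      have Xd: "z (d, x) = z (d, a)" "f (d, x) = f (d, a)" if "x \<in> X" for x
        using row_d_X[OF zz cb that] d_row[OF cb that] d_row[OF cb moved_self] by auto
      have "z (d, a) = f (d, a) \<or> z (d, a) = Suc (f (d, a))"
        using zJ[of d a] z_bounds(1)[OF zz, of d a] by (auto simp: J_apply split: if_splits)
      then show ?thesis
      proof
        assume da: "z (d, a) = f (d, a)"
        have "z (e, x) = k2 (e, x)" for e x
        proof (cases "e = d \<and> x \<in> X")
          case True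
          then show ?thesis using Xd[of x] da k2z[of d x] by (auto simp: rotation_apply split: if_splits)
        qed (rule eq, blast)
        then show ?thesis by (auto simp: fun_eq_iff)
      next
        assume "z (d, a) = Suc (f (d, a))"
        then have "z (e, x) = m2 (e, x)" for e x
          unfolding m2_apply using eq[of e x] Xd[of x] cb by (cases "e = d \<and> x \<in> X") auto
        then show ?thesis by (auto simp: fun_eq_iff)
      qed
    qed
  qed
qed

section \<open>The labels on the two sides of the polygon\<close>

lemma label_k1_J: "inversion_label k1 J = d - b"
  by (rule inversion_label_rotation)

lemma label_k2_J: "inversion_label k2 J = c - a"
proof (rule inversion_label_eqI)
  show "k2 (c, a) \<noteq> J (c, a)"
    using disjoint_moved[of a] by (auto simp: J_apply rotation_apply[of f b])
  fix e x assume "k2 (e, x) \<noteq> J (e, x)"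
  then have "x \<in> X \<and> c \<le> e"
    using A2(2) by (auto simp: J_apply rotation_apply[of f b] split: if_splits)
  then show "c - a \<le> e - x" using M1(2)[of x] by auto
qed

lemma label_k1_m1:
  assumes "c = b" "k1 \<noteq> m1"
  shows "inversion_label k1 m1 = d - a"
proof (rule inversion_label_eqI)
  show "k1 (d, a) \<noteq> m1 (d, a)" unfolding m1_apply using assms(1) A2(2) by (simp add: rotation_apply)
  show "d - a \<le> e - x" if "k1 (e, x) \<noteq> m1 (e, x)" for e x
    using that M1(2)[of x] unfolding m1_apply by (auto split: if_splits)
qed

lemma label_m1_J:
  assumes "c = b"
  shows "inversion_label m1 J = d - b"
proof (rule inversion_label_eqI)
  show "m1 (d, b) \<noteq> J (d, b)"
    unfolding m1_apply J_apply rotation_apply[of f a] using assms A2(2) b_notin_X by auto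
  show "d - b \<le> e - x" if "m1 (e, x) \<noteq> J (e, x)" for e x
    using that M2(2)[of x] assms A2(2) unfolding m1_apply J_apply rotation_apply[of f a]
    by (auto split: if_splits)
qed

lemma label_k2_m2:
  assumes "c = b" "k2 \<noteq> m2"
  shows "inversion_label k2 m2 = d - a"
proof (rule inversion_label_eqI)
  \<comment> \<open>If a moves along with b, so does the rest of X, and \<open>m2\<close> coincides
    with \<open>k2\<close>. So a is not in Y and the entry (d, a) does change.\<close>
  have "X \<subseteq> Y" if "a \<in> Y"
  proof
    fix x assume "x \<in> X"
    then show "x \<in> Y"
      using that d_row[OF assms(1), of x] M1(1,2)[of x] M2(4)[OF that] ab assms(1)
      by (auto simp: moved_def[of f b])
  qed
  moreover have "k2 = m2" if "X \<subseteq> Y"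
    unfolding fun_eq_iff using that by (auto simp: m2_apply rotation_apply[of f b] subset_iff)
  ultimately have "a \<notin> Y" using assms(2) by blast
  then show "k2 (d, a) \<noteq> m2 (d, a)" unfolding m2_apply rotation_apply using assms(1) by simp
  show "d - a \<le> e - x" if "k2 (e, x) \<noteq> m2 (e, x)" for e x
    using that M1(2)[of x] unfolding m2_apply by (auto split: if_splits)
qed

lemma label_m2_J:
  assumes "c = b"
  shows "inversion_label m2 J = b - a"
proof (rule inversion_label_eqI)
  show "m2 (b, a) \<noteq> J (b, a)"
    unfolding m2_apply J_apply rotation_apply[of f b] using assms A2(2) by auto
  show "b - a \<le> e - x" if "m2 (e, x) \<noteq> J (e, x)" for e x
    using that M1(2)[of x] assms unfolding m2_apply J_apply rotation_apply[of f b]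
    by (auto split: if_splits)
qed

end

lemma ranks_increase_inwards_2: "ranks_increase_inwards r [p, q]"
  by (simp add: ranks_increase_inwards_def)

lemma ranks_increase_inwards_3:
  "max (r p) (r t) < r q \<Longrightarrow> ranks_increase_inwards r [p, q, t]"
proof -
  assume "max (r p) (r t) < r q"
  moreover have "i = 1" if "1 \<le> i" "i < (length [p, q, t] + 1) div 2" for i
    using that by simp
  ultimately show ?thesis by (auto simp: ranks_increase_inwards_def Let_def)
qed

lemma chain_labels_3: "chain_labels l [x, y, z] = [l x y, l y z]"
  by (simp add: chain_labels_def upt_rec)

lemma chain_labels_4: "chain_labels l [w, x, y, z] = [l w x, l x y, l y z]"
  by (simp add: chain_labels_def upt_rec)

definition HH_polygon :: "'a::order set \<Rightarrow> ('a \<Rightarrow> 'a \<Rightarrow> nat) \<Rightarrow> 'a \<Rightarrow> 'a \<Rightarrow> 'a list \<Rightarrow> 'a list \<Rightarrow> bool" where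
  "HH_polygon X l x y xs ys \<longleftrightarrow>
     polygon_chains (pord X) x y (set xs) (set ys) \<and> sorted_wrt (<) xs \<and> sorted_wrt (<) ys \<and>
     l x (xs ! 1) = l (ys ! (length ys - 2)) y \<and> l x (ys ! 1) = l (xs ! (length xs - 2)) y \<and>
     ranks_increase_inwards id (chain_labels l xs) \<and> ranks_increase_inwards id (chain_labels l ys)"

lemma HH_polygon_commute: "HH_polygon X l x y xs ys \<Longrightarrow> HH_polygon X l x y ys xs"
  by (auto simp: HH_polygon_def polygon_chains_def)

context two_ascents
begin

lemma HH_polygon_join:
  obtains xs ys where "HH_polygon (tree_inversions s n) inversion_label f J xs ys"
proof -
  have lt: "f < rotation f a' c'" for a' c'
    using rotation_ge[of f a' c'] by (auto simp: less_le fun_eq_iff rotation_apply intro!: exI[of _ c'] exI[of _ a'])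
  have k1J: "k1 \<le> J" by (rule rotation_ge)
  have ne: "k1 \<noteq> J" "k2 \<noteq> J"
  proof -
    have "k1 (d, b) \<noteq> J (d, b)" by (simp add: rotation_apply[of _ b d])
    then show "k1 \<noteq> J" by metis
    have "k2 (c, a) \<noteq> J (c, a)"
      using disjoint_moved[of a] by (auto simp: J_apply rotation_apply[of f b])
    then show "k2 \<noteq> J" by metis
  qed
  obtain xs ys where pol: "polygon_chains (pord (tree_inversions s n)) f J (set xs) (set ys)"
      "sorted_wrt (<) xs" "sorted_wrt (<) ys"
    and xs: "xs = [f, k1, J] \<or> xs = [f, k1, m1, J] \<and> m1 \<in> tree_inversions s n \<and> k1 < m1 \<and> m1 < J"
    and ys: "ys = [f, k2, J] \<or> ys = [f, k2, m2, J] \<and> m2 \<in> tree_inversions s n \<and> k2 < m2 \<and> m2 < J"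
  proof (rule two_sided_polygon[OF f k1_in k2_in J_in lt lt, of m1 m2])
    show "z = f \<or> k1 \<le> z \<or> k2 \<le> z" if "z \<in> tree_inversions s n" "f \<le> z" "z \<le> J" for z
      using interval_cover that .
    show "z = J" if "z \<in> tree_inversions s n" "k1 \<le> z" "k2 \<le> z" "z \<le> J" for z
      using J_least that by (simp add: antisym)
  qed (use k1J k2_le_J ne above_k1 above_k2 in \<open>auto simp: less_le\<close>)
  have cb: "c = b" if "xs = [f, k1, m1, J] \<and> k1 < m1 \<or> ys = [f, k2, m2, J] \<and> k2 < m2"
    using that by (auto simp: m1_def m2_def split: if_splits)
  have "HH_polygon (tree_inversions s n) inversion_label f J xs ys"
    unfolding HH_polygon_def
  proof (intro conjI pol)
    have x1: "inversion_label f (xs ! 1) = c - a" using xs inversion_label_rotation by auto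
    have y1: "inversion_label f (ys ! 1) = d - b" using ys inversion_label_rotation by auto
    have xl: "inversion_label (xs ! (length xs - 2)) J = d - b"
      using xs cb label_m1_J label_k1_J by auto
    have yl: "inversion_label (ys ! (length ys - 2)) J = c - a"
      using ys cb label_m2_J label_k2_J by auto
    show "inversion_label f (xs ! 1) = inversion_label (ys ! (length ys - 2)) J"
      "inversion_label f (ys ! 1) = inversion_label (xs ! (length xs - 2)) J"
      using x1 y1 xl yl by auto
    \<comment> \<open>For c = b the middle label d - a is the sum of the outer labels b - a and d -
      b, both of which are positive.\<close>
    have max: "max (c - a) (d - b) < d - a" "max (d - b) (b - a) < d - a" if "c = b"
      using that A1(2) A2(2) ab by auto
    show "ranks_increase_inwards id (chain_labels inversion_label xs)"
      using xs
    proof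
      assume x: "xs = [f, k1, m1, J] \<and> m1 \<in> tree_inversions s n \<and> k1 < m1 \<and> m1 < J"
      then have "c = b" "k1 \<noteq> m1" using cb by auto
      then have "chain_labels inversion_label xs = [c - a, d - a, d - b]"
        using x label_k1_m1 label_m1_J inversion_label_rotation by (metis chain_labels_4)
      then show ?thesis using max(1)[OF \<open>c = b\<close>] by (simp add: ranks_increase_inwards_3)
    qed (simp add: chain_labels_3 ranks_increase_inwards_2)
    show "ranks_increase_inwards id (chain_labels inversion_label ys)"
      using ys
    proof
      assume y: "ys = [f, k2, m2, J] \<and> m2 \<in> tree_inversions s n \<and> k2 < m2 \<and> m2 < J"
      then have "c = b" "k2 \<noteq> m2" using cb by auto
      then have "chain_labels inversion_label ys = [d - b, d - a, b - a]"
        using y label_k2_m2 label_m2_J inversion_label_rotation by (metis chain_labels_4)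
      then show ?thesis using max(2)[OF \<open>c = b\<close>] by (simp add: ranks_increase_inwards_3)
    qed (simp add: chain_labels_3 ranks_increase_inwards_2)
  qed
  then show thesis using that by blast
qed

end

section \<open>Criteria for joins, meets and lattices\<close>

lemma join_eqI:
  assumes "partial_order L" "x \<in> carrier L" "y \<in> carrier L" "j \<in> carrier L" "x \<sqsubseteq>\<^bsub>L\<^esub> j" "y \<sqsubseteq>\<^bsub>L\<^esub> j"
    and "\<And>z. z \<in> carrier L \<Longrightarrow> x \<sqsubseteq>\<^bsub>L\<^esub> z \<Longrightarrow> y \<sqsubseteq>\<^bsub>L\<^esub> z \<Longrightarrow> j \<sqsubseteq>\<^bsub>L\<^esub> z"
  shows "x \<squnion>\<^bsub>L\<^esub> y = j"
proof -
  interpret partial_order L by fact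
  have "least L j (Upper L {x, y})"
    using assms by (auto simp: least_def Upper_def)
  then show ?thesis
    unfolding join_def sup_def using least_unique by (blast intro: some_equality)
qed

lemma meet_eqI:
  assumes "partial_order L" "x \<in> carrier L" "y \<in> carrier L" "j \<in> carrier L" "j \<sqsubseteq>\<^bsub>L\<^esub> x" "j \<sqsubseteq>\<^bsub>L\<^esub> y"
    and "\<And>z. z \<in> carrier L \<Longrightarrow> z \<sqsubseteq>\<^bsub>L\<^esub> x \<Longrightarrow> z \<sqsubseteq>\<^bsub>L\<^esub> y \<Longrightarrow> z \<sqsubseteq>\<^bsub>L\<^esub> j"
  shows "x \<sqinter>\<^bsub>L\<^esub> y = j"
proof -
  interpret partial_order L by fact
  have "greatest L j (Lower L {x, y})"
    using assms by (auto simp: greatest_def Lower_def)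
  then show ?thesis
    unfolding meet_def inf_def using greatest_unique by (blast intro: some_equality)
qed

lemma latticeI:
  assumes "partial_order L"
    and "\<And>x y. x \<in> carrier L \<Longrightarrow> y \<in> carrier L \<Longrightarrow>
      \<exists>j\<in>carrier L. x \<sqsubseteq>\<^bsub>L\<^esub> j \<and> y \<sqsubseteq>\<^bsub>L\<^esub> j \<and> (\<forall>z\<in>carrier L. x \<sqsubseteq>\<^bsub>L\<^esub> z \<and> y \<sqsubseteq>\<^bsub>L\<^esub> z \<longrightarrow> j \<sqsubseteq>\<^bsub>L\<^esub> z)"
    and "\<And>x y. x \<in> carrier L \<Longrightarrow> y \<in> carrier L \<Longrightarrow>
      \<exists>j\<in>carrier L. j \<sqsubseteq>\<^bsub>L\<^esub> x \<and> j \<sqsubseteq>\<^bsub>L\<^esub> y \<and> (\<forall>z\<in>carrier L. z \<sqsubseteq>\<^bsub>L\<^esub> x \<and> z \<sqsubseteq>\<^bsub>L\<^esub> y \<longrightarrow> z \<sqsubseteq>\<^bsub>L\<^esub> j)"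
  shows "lattice L"
proof -
  interpret partial_order L by fact
  show ?thesis
  proof
    fix x y assume xy: "x \<in> carrier L" "y \<in> carrier L"
    show "\<exists>s. least L s (Upper L {x, y})"
      using assms(2)[OF xy] xy by (auto simp: least_def Upper_def)
    show "\<exists>s. greatest L s (Lower L {x, y})"
      using assms(3)[OF xy] xy by (auto simp: greatest_def Lower_def)
  qed
qed

section \<open>Covers as rotations, and arbitrary polygons\<close>

lemma covers_pord:
  "covers (pord X) y x \<longleftrightarrow> x \<in> X \<and> y \<in> X \<and> x < y \<and> \<not> (\<exists>z\<in>X. x < z \<and> z < y)"
  by (simp add: covers_def)

text \<open>Some proper ascent of f lies at an entry where g is larger; its rotation is then
  strictly above f and at most g.\<close>

lemma covers_tree_inversionsE:
  assumes "covers (pord (tree_inversions s n)) g f"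
  obtains a c where "proper_ascent s n f a c" "g = rotation f a c"
proof -
  have fg: "f \<in> tree_inversions s n" "g \<in> tree_inversions s n" "f < g"
    and cov: "\<And>z. z \<in> tree_inversions s n \<Longrightarrow> f < z \<Longrightarrow> \<not> z < g"
    using assms by (auto simp: covers_pord)
  obtain a c where ac: "proper_ascent s n f a c" "f (c, a) < g (c, a)"
    using exists_proper_ascent[OF fg] .
  have "rotation f a c \<le> g"
    using rotation_le[OF fg(1,2)] fg(3) ac ascentD(2)[OF proper_ascentD(1)[OF ac(1)]] by simp
  moreover have "rotation f a c \<noteq> f"
    by (auto simp: fun_eq_iff rotation_apply intro!: exI[of _ c] exI[of _ a])
  then have "f < rotation f a c" using rotation_ge[of f a c] by (simp add: less_le)
  ultimately have "g = rotation f a c"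
    using cov[OF rotation_in_tree_inversions[OF fg(1) proper_ascentD(1)[OF ac(1)]]] by (auto simp: less_le)
  then show thesis using that ac(1) by blast
qed

text \<open>If c < d, the first ascent gives f (d, c) \<le> f (d, a), so the second one forces f (c,
  a) = s c, but c can still be passed. Hence distinct covers belong to distinct a and can be ordered
  by them.\<close>

lemma ascent_unique:
  assumes "ascent s n f a c" "ascent s n f a d"
  shows "c = d"
proof -
  have "\<not> c < d" if "ascent s n f a c" "ascent s n f a d" for c d
    using ascentD(2,4,6)[OF that(1)] ascentD(5)[OF that(2)] by fastforce
  then show ?thesis using assms by (metis nat_neq_iff)
qed

lemma HH_polygon_tree_inversions:
  assumes "covers (pord (tree_inversions s n)) y1 f" "covers (pord (tree_inversions s n)) y2 f" "y1 \<noteq> y2"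
  obtains J xs ys where "HH_polygon (tree_inversions s n) inversion_label f J xs ys"
    "J \<in> tree_inversions s n" "y1 \<le> J" "y2 \<le> J"
    "\<And>z. z \<in> tree_inversions s n \<Longrightarrow> y1 \<le> z \<Longrightarrow> y2 \<le> z \<Longrightarrow> J \<le> z"
proof -
  have f: "f \<in> tree_inversions s n" using assms(1) by (simp add: covers_pord)
  obtain a c where ac: "proper_ascent s n f a c" "y1 = rotation f a c"
    using covers_tree_inversionsE[OF assms(1)] .
  obtain b d where bd: "proper_ascent s n f b d" "y2 = rotation f b d"
    using covers_tree_inversionsE[OF assms(2)] .
  have "a \<noteq> b"
    using ascent_unique proper_ascentD(1) ac bd assms(3) by metis
  then consider "a < b" | "b < a" by linarith
  then show thesis
  proof cases
    case 1
    interpret TA: two_ascents s n f a c b d by unfold_locales (use f ac bd 1 in auto)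
    obtain xs ys where "HH_polygon (tree_inversions s n) inversion_label f TA.J xs ys"
      using TA.HH_polygon_join .
    then show thesis
      using that TA.J_in rotation_ge TA.k2_le_J TA.J_least unfolding ac(2) bd(2) by blast
  next
    case 2
    interpret TA: two_ascents s n f b d a c by unfold_locales (use f ac bd 2 in auto)
    obtain xs ys where "HH_polygon (tree_inversions s n) inversion_label f TA.J xs ys"
      using TA.HH_polygon_join .
    then show thesis
      using that TA.J_in rotation_ge TA.k2_le_J TA.J_least unfolding ac(2) bd(2) by blast
  qed
qed

lemma sorted_wrt_less_unique:
  fixes xs ys :: "'a::order list"
  assumes "sorted_wrt (<) xs" "sorted_wrt (<) ys" "set xs = set ys"
  shows "xs = ys"
  using assms
proof (induction xs arbitrary: ys)
  case (Cons x xs)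
  then obtain y ys' where ys: "ys = y # ys'" by (cases ys) auto
  have "x \<in> insert y (set ys')" "y \<in> insert x (set xs)" using Cons.prems ys by auto
  then have "x = y" using Cons.prems ys by (auto dest: order.asym)
  moreover have "x \<notin> set xs" "y \<notin> set ys'" using Cons.prems ys by auto
  ultimately have "set xs = set ys'" using Cons.prems(3) ys by auto
  then show ?case using Cons ys \<open>x = y\<close> by simp
qed simp

lemma polygon_chains_commute: "polygon_chains L x y C D \<Longrightarrow> polygon_chains L x y D C"
  by (auto simp: polygon_chains_def)

text \<open>\<open>HH_labeling\<close> quantifies over all polygons, so the covers at the bottom
  must be recovered from the chains alone. The second element w of C is such a cover, and since w is
  not in D, every maximal chain through w is C.\<close>

lemma polygon_chains_atom:
  fixes X :: "'a::order set"
  assumes pol: "polygon_chains (pord X) x y C D"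
  obtains w where "covers (pord X) w x" "w \<in> C" "w \<noteq> y" "w \<le> y"
    "\<And>z. z \<in> X \<Longrightarrow> w \<le> z \<Longrightarrow> z \<le> y \<Longrightarrow> z \<in> C"
proof -
  let ?I = "{z \<in> X. x \<le> z \<and> z \<le> y}"
  interpret pred_on ?I "(\<le>)" .
  have chain_iff: "chain E \<longleftrightarrow> E \<subseteq> ?I \<and> (\<forall>u\<in>E. \<forall>v\<in>E. u \<le> v \<or> v \<le> u)" for E
    by (auto simp: chain_def)
  have max: "maxchain E \<longleftrightarrow> E = C \<or> E = D" for E
    using pol by (auto simp: polygon_chains_def)
  have fin: "finite C" and CD: "C \<noteq> D" "C \<inter> D = {x, y}" using pol by (auto simp: polygon_chains_def)
  have mC: "maxchain C" and mD: "maxchain D" using max by auto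
  then have cC: "chain C" and cD: "chain D" by (auto simp: maxchain_def)
  have xyC: "x \<in> C" "y \<in> C" using CD by auto
  then have xy: "x \<in> X" "y \<in> X" "x \<le> y" using cC by (auto simp: chain_iff)
  have "C \<noteq> {x, y}" using mC cD CD by (auto simp: maxchain_def)
  then have "C - {x, y} \<noteq> {}" using xyC by auto
  then obtain w where w: "w \<in> C - {x, y}" and wmin: "\<And>z. z \<in> C - {x, y} \<Longrightarrow> \<not> z < w"
    using finite_has_minimal[of "C - {x, y}"] fin by (metis finite_Diff order.strict_iff_order)
  have wI: "w \<in> X" "x < w" "w \<le> y" "w \<noteq> y" using w cC by (auto simp: chain_iff less_le)
  have wmin': "z = x \<or> w \<le> z" if "z \<in> C" for z
    using that wmin[of z] w cC wI by (auto simp: chain_iff less_le)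
  have "covers (pord X) w x"
    unfolding covers_pord
  proof (intro conjI notI)
    assume "\<exists>z\<in>X. x < z \<and> z < w"
    then obtain z where z: "z \<in> X" "x < z" "z < w" by auto
    then have "z \<notin> C" using wmin'[of z] by auto
    moreover have "chain (insert z C)"
    proof -
      have "u \<le> z \<or> z \<le> u" if "u \<in> C" for u
        using wmin'[OF that] z by (auto intro: order.trans less_imp_le)
      then show ?thesis using cC z wI unfolding chain_iff by (auto intro: order.trans less_imp_le)
    qed
    ultimately show False using mC by (auto simp: maxchain_def)
  qed (use xy wI in auto)
  moreover have "z \<in> C" if z: "z \<in> X" "w \<le> z" "z \<le> y" for z
  proof -
    \<comment> \<open>A maximal chain among the elements comparable with both w and z contains w and
      z, and it stays maximal in the whole interval.\<close>
    let ?A = "{v \<in> ?I. (v \<le> w \<or> w \<le> v) \<and> (v \<le> z \<or> z \<le> v)}"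
    obtain M where M: "pred_on.maxchain ?A (\<le>) M" using pred_on.Hausdorff by blast
    have Mc: "M \<subseteq> ?A" "\<forall>u\<in>M. \<forall>v\<in>M. u \<le> v \<or> v \<le> u"
      using M by (auto simp: pred_on.maxchain_def pred_on.chain_def)
    have Mmax: "v \<in> M" if "v \<in> ?A" "\<forall>u\<in>M. u \<le> v \<or> v \<le> u" for v
    proof (rule ccontr)
      assume "v \<notin> M"
      then have "M \<subset> insert v M" by auto
      moreover have "pred_on.chain ?A (\<le>) (insert v M)"
        using Mc that unfolding pred_on.chain_def by auto
      ultimately show False using M by (auto simp: pred_on.maxchain_def)
    qed
    have wM: "w \<in> M" and zM: "z \<in> M"
      using Mc wI z by (auto intro!: Mmax intro: order.trans less_imp_le)
    have "chain M" using Mc by (auto simp: chain_iff)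
    moreover have "\<not> (chain S \<and> M \<subset> S)" for S
    proof
      assume S: "chain S \<and> M \<subset> S"
      then obtain v where v: "v \<in> S" "v \<notin> M" by auto
      then have "v \<in> ?A" "\<forall>u\<in>M. u \<le> v \<or> v \<le> u" using S wM zM unfolding chain_iff by blast+
      then show False using Mmax v by blast
    qed
    ultimately have "maxchain M" by (auto simp: maxchain_def)
    then have "M = C \<or> M = D" using max by simp
    moreover have "w \<notin> D" using w CD by auto
    ultimately show ?thesis using wM zM by auto
  qed
  ultimately show thesis using that w wI by auto
qed

text \<open>The meet of y with a common upper bound of the two atoms lies in C and in D but is not
  x, so it is y. Every polygon thus spans the interval from an element to the join of two of its
  covers.\<close>

lemma polygon_chains_atoms:
  fixes X :: "'a::order set"
  assumes L: "lattice (pord X)" and pol: "polygon_chains (pord X) x y C D"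
  obtains y1 y2 where "covers (pord X) y1 x" "covers (pord X) y2 x" "y1 \<noteq> y2" "y1 \<le> y" "y2 \<le> y" "y \<in> X"
    "\<And>z. z \<in> X \<Longrightarrow> y1 \<le> z \<Longrightarrow> y2 \<le> z \<Longrightarrow> y \<le> z"
proof -
  interpret lattice "pord X" by fact
  obtain y1 where y1: "covers (pord X) y1 x" "y1 \<in> C" "y1 \<noteq> y" "y1 \<le> y"
      "\<And>z. z \<in> X \<Longrightarrow> y1 \<le> z \<Longrightarrow> z \<le> y \<Longrightarrow> z \<in> C"
    using polygon_chains_atom[OF pol] by blast
  obtain y2 where y2: "covers (pord X) y2 x" "y2 \<in> D" "y2 \<noteq> y" "y2 \<le> y"
      "\<And>z. z \<in> X \<Longrightarrow> y2 \<le> z \<Longrightarrow> z \<le> y \<Longrightarrow> z \<in> D"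
    using polygon_chains_atom[OF polygon_chains_commute[OF pol]] by blast
  have CD: "C \<inter> D = {x, y}" using pol by (simp add: polygon_chains_def)
  have "C \<in> {E. pred_on.maxchain \<lbrace>x..y\<rbrace>\<^bsub>pord X\<^esub> (le (pord X)) E}"
    using pol by (auto simp: polygon_chains_def)
  then have "C \<subseteq> X" by (auto simp: pred_on.maxchain_def pred_on.chain_def)
  then have yX: "y \<in> X" using CD by auto
  have c: "x < y1" "x < y2" "y1 \<in> X" "y2 \<in> X" using y1(1) y2(1) by (auto simp: covers_pord)
  have "y \<le> z" if z: "z \<in> X" "y1 \<le> z" "y2 \<le> z" for z
  proof -
    let ?w = "z \<sqinter>\<^bsub>pord X\<^esub> y"
    have w: "?w \<in> X" "?w \<le> z" "?w \<le> y" using meet_closed meet_left meet_right z yX by auto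
    have "y1 \<le> ?w" "y2 \<le> ?w" using meet_le[of y1 z y] meet_le[of y2 z y] y1 y2 c yX z by auto
    then have "?w \<in> C \<inter> D" using y1(5) y2(5) w by auto
    then have "?w = y" using CD c \<open>y1 \<le> ?w\<close> by auto
    then show ?thesis using w by simp
  qed
  moreover have "y1 \<notin> D" using y1(2,3) c(1) CD by auto
  then have "y1 \<noteq> y2" using y2(2) by auto
  ultimately show thesis using that y1 y2 yX by blast
qed

text \<open>A polygon has the same ends as the one constructed from its two atoms, hence the same
  two maximal chains; only the roles of C and D may be exchanged.\<close>

lemma HH_labeling_tree_inversions:
  assumes L: "lattice (pord (tree_inversions s n))"
  shows "HH_labeling (pord (tree_inversions s n)) inversion_label id"
proof -
  let ?F = "tree_inversions s n" and ?l = "inversion_label"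
  have main: "?l x (xs ! 1) = ?l (ys ! (length ys - 2)) y \<and> ?l x (ys ! 1) = ?l (xs ! (length xs - 2)) y \<and>
      ranks_increase_inwards id (chain_labels ?l xs) \<and> ranks_increase_inwards id (chain_labels ?l ys)"
    if pol: "polygon_chains (pord ?F) x y C D"
      and xs: "sorted_wrt (<) xs" "set xs = C" and ys: "sorted_wrt (<) ys" "set ys = D"
    for x y C D and xs ys :: "(nat \<times> nat \<Rightarrow> nat) list"
  proof -
    obtain y1 y2 where y: "covers (pord ?F) y1 x" "covers (pord ?F) y2 x" "y1 \<noteq> y2" "y1 \<le> y" "y2 \<le> y" "y \<in> ?F"
        "\<And>z. z \<in> ?F \<Longrightarrow> y1 \<le> z \<Longrightarrow> y2 \<le> z \<Longrightarrow> y \<le> z"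
      using polygon_chains_atoms[OF L pol] by blast
    obtain J xs' ys' where J: "HH_polygon ?F ?l x J xs' ys'" "J \<in> ?F" "y1 \<le> J" "y2 \<le> J"
        "\<And>z. z \<in> ?F \<Longrightarrow> y1 \<le> z \<Longrightarrow> y2 \<le> z \<Longrightarrow> J \<le> z"
      using HH_polygon_tree_inversions[OF y(1-3)] by blast
    have "J = y" using y(4-) J(2-) by (meson order.antisym)
    then have HH: "HH_polygon ?F ?l x y xs' ys'" "HH_polygon ?F ?l x y ys' xs'"
      using J(1) HH_polygon_commute by auto
    then have "{C, D} = {set xs', set ys'}"
      using pol by (simp add: HH_polygon_def polygon_chains_def)
    then have "xs = xs' \<and> ys = ys' \<or> xs = ys' \<and> ys = xs'"
      using sorted_wrt_less_unique xs ys HH by (auto simp: HH_polygon_def doubleton_eq_iff)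
    then show ?thesis using HH by (auto simp: HH_polygon_def)
  qed
  then show ?thesis
    unfolding HH_labeling_def lists_chain_def Let_def pord_simps by blast
qed

section \<open>Doublings\<close>

lemma order_isomorphic_trans:
  assumes "order_isomorphic L M" "order_isomorphic M N"
  shows "order_isomorphic L N"
proof -
  obtain f g where f: "bij_betw f (carrier L) (carrier M)"
      "\<forall>x\<in>carrier L. \<forall>y\<in>carrier L. x \<sqsubseteq>\<^bsub>L\<^esub> y \<longleftrightarrow> f x \<sqsubseteq>\<^bsub>M\<^esub> f y"
    and g: "bij_betw g (carrier M) (carrier N)"
      "\<forall>x\<in>carrier M. \<forall>y\<in>carrier M. x \<sqsubseteq>\<^bsub>M\<^esub> y \<longleftrightarrow> g x \<sqsubseteq>\<^bsub>N\<^esub> g y"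
    using assms by (auto simp: order_isomorphic_def)
  have "f x \<in> carrier M" if "x \<in> carrier L" for x using f(1) that by (auto simp: bij_betw_def)
  then show ?thesis
    using f(2) g(2) bij_betw_trans[OF f(1) g(1)]
    unfolding order_isomorphic_def by (intro exI[of _ "g \<circ> f"]) auto
qed

lemma order_isomorphic_sym:
  assumes "order_isomorphic L M"
  shows "order_isomorphic M L"
proof -
  obtain f where f: "bij_betw f (carrier L) (carrier M)"
      "\<forall>x\<in>carrier L. \<forall>y\<in>carrier L. x \<sqsubseteq>\<^bsub>L\<^esub> y \<longleftrightarrow> f x \<sqsubseteq>\<^bsub>M\<^esub> f y"
    using assms by (auto simp: order_isomorphic_def)
  let ?g = "inv_into (carrier L) f"
  have g: "?g x \<in> carrier L" "f (?g x) = x" if "x \<in> carrier M" for x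
    using that f(1) by (auto simp: bij_betw_def inv_into_into f_inv_into_f)
  show ?thesis
    unfolding order_isomorphic_def
    by (intro exI[of _ ?g] conjI bij_betw_inv_into f(1) ballI) (use f(2) g in simp)
qed

text \<open>Congruence uniformity separated from the lattice property: the doublings are found
  first, and the lattice property is deduced from them.\<close>

definition doubling_constructible :: "('a, 'b) gorder_scheme \<Rightarrow> bool" where
  "doubling_constructible L \<longleftrightarrow> (\<exists>M. interval_doubling_built M \<and> order_isomorphic L M)"

lemma doubling_constructible_iso:
  "order_isomorphic L M \<Longrightarrow> doubling_constructible M \<Longrightarrow> doubling_constructible L"
  unfolding doubling_constructible_def using order_isomorphic_trans by blast

lemma nat_copy:
  fixes X :: "'a::order set"
  assumes "finite X"
  obtains N :: "nat gorder" where "partial_order N" "order_isomorphic N (pord X)"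
proof -
  obtain h where h: "bij_betw h {0..<card X} X" using ex_bij_betw_nat_finite[OF assms] by auto
  define N :: "nat gorder" where
    "N = \<lparr> carrier = {0..<card X}, eq = (=), le = (\<lambda>i j. h i \<le> h j) \<rparr>"
  have inj: "i = j" if "h i = h j" "i < card X" "j < card X" for i j
    using h that by (auto simp: bij_betw_def inj_on_def)
  have "partial_order N"
    by unfold_locales (auto simp: N_def intro: inj)
  moreover have "order_isomorphic N (pord X)"
    unfolding order_isomorphic_def using h by (intro exI[of _ h]) (auto simp: N_def)
  ultimately show thesis using that by blast
qed

lemma doubling_constructible_singleton: "doubling_constructible (pord {x})"
proof -
  obtain N :: "nat gorder" where N: "partial_order N" "order_isomorphic N (pord {x})"
    using nat_copy[of "{x}"] by auto
  then have "card (carrier N) = 1"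
    by (auto simp: order_isomorphic_def dest: bij_betw_same_card)
  then obtain m where "carrier N = {m}" by (auto simp: card_1_singleton_iff)
  then show ?thesis
    using N interval_doubling_built.singleton order_isomorphic_sym
    unfolding doubling_constructible_def by blast
qed

text \<open>Recognizes a doubling inside one ordered type. Elements of X below b sit on the lower
  level, the others on the upper level, and t z is the upper copy of z. The clause that x is not
  below b in \<open>t_le\<close> says that x has to be on the upper level.\<close>

lemma doubling_constructible_double:
  fixes X :: "'a::order set"
  assumes X: "doubling_constructible (pord X)" "finite X"
    and ab: "a \<in> X" "b \<in> X" "a \<le> b" and I: "I = {z \<in> X. a \<le> z \<and> z \<le> b}"
    and t: "inj_on t I" "t ` I \<inter> X = {}"
    and le_t: "\<And>x z. x \<in> X \<Longrightarrow> z \<in> I \<Longrightarrow> x \<le> t z \<longleftrightarrow> x \<le> z"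
    and t_le: "\<And>x z. x \<in> X \<Longrightarrow> z \<in> I \<Longrightarrow> t z \<le> x \<longleftrightarrow> z \<le> x \<and> \<not> x \<le> b"
    and t_t: "\<And>z z'. z \<in> I \<Longrightarrow> z' \<in> I \<Longrightarrow> t z \<le> t z' \<longleftrightarrow> z \<le> z'"
  shows "doubling_constructible (pord (X \<union> t ` I))"
proof -
  obtain M g where M: "interval_doubling_built M"
    and g: "bij_betw g X (carrier M)" "\<And>x y. x \<in> X \<Longrightarrow> y \<in> X \<Longrightarrow> g x \<sqsubseteq>\<^bsub>M\<^esub> g y \<longleftrightarrow> x \<le> y"
    using X(1) by (auto simp: doubling_constructible_def order_isomorphic_def)
  have gX: "g ` X = carrier M" "inj_on g X" using g(1) by (auto simp: bij_betw_def)
  have IX: "I \<subseteq> X" using I by auto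
  let ?D = "doubling M \<lbrace>g a..g b\<rbrace>\<^bsub>M\<^esub>"
  have int: "\<lbrace>g a..g b\<rbrace>\<^bsub>M\<^esub> = g ` I"
    using ab g(2) unfolding I at_least_at_most_def gX(1)[symmetric] by auto
  have down: "down_closure M (g ` I) = g ` {x \<in> X. x \<le> b}"
    unfolding down_closure_def gX(1)[symmetric] using ab g(2) IX
    by (auto simp: I intro: order.trans)
  have notin: "g x \<notin> g ` {x \<in> X. x \<le> b} \<longleftrightarrow> \<not> x \<le> b" if "x \<in> X" for x
    using gX(2) that by (auto simp: inj_on_def)
  have D: "carrier ?D = (\<lambda>x. (g x, \<not> x \<le> b)) ` X \<union> (\<lambda>z. (g z, True)) ` I"
    unfolding doubling_def int down gX(1)[symmetric] using notin IX by auto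
  have leD: "p \<sqsubseteq>\<^bsub>?D\<^esub> q \<longleftrightarrow> fst p \<sqsubseteq>\<^bsub>M\<^esub> fst q \<and> (snd p \<longrightarrow> snd q)" for p q
    by (auto simp: doubling_def split: prod.split)
  define \<phi> where "\<phi> y = (if y \<in> X then (g y, \<not> y \<le> b) else (g (inv_into I t y), True))" for y
  have \<phi>X: "\<phi> x = (g x, \<not> x \<le> b)" if "x \<in> X" for x using that by (simp add: \<phi>_def)
  have \<phi>t: "\<phi> (t z) = (g z, True)" if "z \<in> I" for z using that t by (auto simp: \<phi>_def)
  have bij: "bij_betw \<phi> (X \<union> t ` I) (carrier ?D)"
    unfolding bij_betw_def
  proof
    show "\<phi> ` (X \<union> t ` I) = carrier ?D"
      unfolding D image_Un image_image using \<phi>X \<phi>t by (simp cong: image_cong)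
    have "x = y" if "x \<in> X" "y \<in> X" "\<phi> x = \<phi> y" for x y
      using that gX(2) by (auto simp: \<phi>X inj_on_def)
    moreover have "\<phi> x \<noteq> \<phi> (t z)" if "x \<in> X" "z \<in> I" for x z
      using that gX(2) IX by (auto simp: \<phi>X \<phi>t inj_on_def I)
    moreover have "t z = t z'" if "z \<in> I" "z' \<in> I" "\<phi> (t z) = \<phi> (t z')" for z z'
      using that gX(2) IX by (auto simp: \<phi>t inj_on_def)
    ultimately show "inj_on \<phi> (X \<union> t ` I)" by (fastforce simp: inj_on_def)
  qed
  have leD': "u \<le> v \<longleftrightarrow> \<phi> u \<sqsubseteq>\<^bsub>?D\<^esub> \<phi> v" if "u \<in> X \<union> t ` I" "v \<in> X \<union> t ` I" for u v
  proof -
    consider "u \<in> X" "v \<in> X" | z where "u \<in> X" "z \<in> I" "v = t z" | z where "z \<in> I" "u = t z" "v \<in> X"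
      | z z' where "z \<in> I" "z' \<in> I" "u = t z" "v = t z'"
      using \<open>u \<in> _\<close> \<open>v \<in> _\<close> by blast
    then show ?thesis
    proof cases
      case 1 then show ?thesis using g(2) by (auto simp: leD \<phi>X intro: order.trans)
    next
      case 2 then show ?thesis using g(2) le_t IX by (auto simp: leD \<phi>X \<phi>t)
    next
      case 3 then show ?thesis using g(2) t_le IX by (auto simp: leD \<phi>X \<phi>t)
    next
      case 4 then show ?thesis using g(2)[of z z'] t_t[of z z'] IX by (auto simp: leD \<phi>t)
    qed
  qed
  have iso: "order_isomorphic (pord (X \<union> t ` I)) ?D"
    unfolding order_isomorphic_def pord_simps using bij leD' by (intro exI[of _ \<phi>] conjI ballI) auto
  have "finite (X \<union> t ` I)" using X(2) IX by (auto intro: finite_subset)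
  then obtain N :: "nat gorder" where N: "partial_order N" "order_isomorphic N (pord (X \<union> t ` I))"
    by (rule nat_copy)
  have "interval_doubling_built N"
    using interval_doubling_built.doubling[OF M _ _ _ N(1) order_isomorphic_trans[OF N(2) iso]]
      ab gX(1) g(2) by auto
  then show ?thesis
    using N(2) order_isomorphic_sym unfolding doubling_constructible_def by blast
qed

section \<open>Raising the caps\<close>

text \<open>The row of \<open>k\<close> is filled up to \<open>(c, k)\<close>, where the cap has reached \<open>i\<close>; larger \<open>x\<close> are done.\<close>

definition stage_cap :: "(nat \<Rightarrow> nat) \<Rightarrow> nat \<Rightarrow> nat \<Rightarrow> nat \<Rightarrow> nat \<Rightarrow> nat \<times> nat \<Rightarrow> nat" where
  "stage_cap s n k c i = (\<lambda>(d, x).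
     if 1 \<le> x \<and> x < d \<and> d \<le> n \<and> (k < x \<or> x = k \<and> d < c) then s d
     else if x = k \<and> d = c then i else 0)"

locale cap_step =
  fixes s :: "nat \<Rightarrow> nat" and n k c :: nat
  assumes k1: "1 \<le> k" and kc: "k < c" and cn: "c \<le> n"
begin

abbreviation "stage i \<equiv> inversion_functions s (stage_cap s n k c i)"

text \<open>Transitivity and, in \<open>upper_ok\<close>, planarity for the triples k < b < c, with
  the value v at (c, k).\<close>

definition lower_ok :: "(nat \<times> nat \<Rightarrow> nat) \<Rightarrow> nat \<Rightarrow> bool" where
  "lower_ok f v \<longleftrightarrow> (\<forall>b. k < b \<and> b < c \<longrightarrow> f (b, k) = 0 \<or> f (c, b) \<le> v)"

definition upper_ok :: "(nat \<times> nat \<Rightarrow> nat) \<Rightarrow> nat \<Rightarrow> bool" where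
  "upper_ok f v \<longleftrightarrow> (\<forall>b. k < b \<and> b < c \<longrightarrow> f (b, k) = s b \<or> v \<le> f (c, b))"

text \<open>The lower condition is required only below the cap: at the value i the
  \<open>min\<close> with the cap makes transitivity automatic.\<close>

lemma stage_iff:
  "f \<in> stage i \<longleftrightarrow>
     f((c, k) := 0) \<in> stage 0 \<and> f (c, k) \<le> i \<and>
     (f (c, k) < i \<longrightarrow> lower_ok f (f (c, k))) \<and> upper_ok f (f (c, k))" (is "_ \<longleftrightarrow> ?rhs")
proof
  let ?u = "stage_cap s n k c"
  have u: "?u i (e, x) = ?u 0 (e, x)" if "e \<noteq> c \<or> x \<noteq> k" for e x
    using that by (auto simp: stage_cap_def)
  have uc: "?u j (c, k) = j" for j by (auto simp: stage_cap_def)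
  have u0: "?u j (e, x) = 0" if "x < k \<or> x = k \<and> c < e" for j e x
    using that kc by (auto simp: stage_cap_def)
  {
    assume f: "f \<in> stage i"
    then have le: "f p \<le> ?u i p" for p unfolding inversion_functions_iff le_fun_def by blast
    have z: "f (e, x) = 0" if "x < k \<or> x = k \<and> c < e" for e x
      using le[of "(e, x)"] u0[OF that] by simp
    have tp: "f (b, a) = 0 \<or> min (f (e, b)) (?u i (e, a)) \<le> f (e, a)" "f (b, a) = s b \<or> f (e, a) \<le> f (e, b)"
      if "a < b" "b < e" for a b e
      using f that by (auto simp: inversion_functions_iff)
    have "f((c, k) := 0) \<le> ?u 0"
    proof (rule le_funI)
      fix p :: "nat \<times> nat"
      obtain e x where p: "p = (e, x)" by (cases p)
      show "(f((c, k) := 0)) p \<le> ?u 0 p"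
        using le[of p] u[of e x] unfolding p by (cases "e = c \<and> x = k") auto
    qed
    moreover have "((f((c, k) := 0)) (b, a) = 0 \<or> min ((f((c, k) := 0)) (e, b)) (?u 0 (e, a)) \<le> (f((c, k) := 0)) (e, a)) \<and>
        ((f((c, k) := 0)) (b, a) = s b \<or> (f((c, k) := 0)) (e, a) \<le> (f((c, k) := 0)) (e, b))"
      if ab: "a < b" "b < e" for a b e
    proof -
      consider "(e, a) = (c, k)" | "(b, a) = (c, k)" | "(e, b) = (c, k)"
        | "(e, a) \<noteq> (c, k)" "(b, a) \<noteq> (c, k)" "(e, b) \<noteq> (c, k)" by blast
      then show ?thesis
      proof cases
        case 4
        then show ?thesis using tp[OF ab] u[of e a] by auto
      qed (use ab z[of a e] u0[of a e 0] uc in auto)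
    qed
    ultimately have "f((c, k) := 0) \<in> stage 0" unfolding inversion_functions_iff by blast
    moreover have "f (c, k) \<le> i" using le[of "(c, k)"] uc by simp
    moreover have "lower_ok f (f (c, k))" if "f (c, k) < i"
      using tp(1)[of k _ c] uc that by (fastforce simp: lower_ok_def)
    moreover have "upper_ok f (f (c, k))"
      using tp(2)[of k _ c] by (auto simp: upper_ok_def)
    ultimately show ?rhs by simp
  }
  {
    assume r: ?rhs
    let ?h = "f((c, k) := 0)"
    have h: "?h \<in> stage 0" using r by simp
    then have le: "?h p \<le> ?u 0 p" for p unfolding inversion_functions_iff le_fun_def by blast
    have z: "f (e, x) = 0" if "x < k \<or> x = k \<and> c < e" for e x
      using le[of "(e, x)"] u0[OF that] that by (auto split: if_splits)
    have tp: "?h (b, a) = 0 \<or> min (?h (e, b)) (?u 0 (e, a)) \<le> ?h (e, a)" "?h (b, a) = s b \<or> ?h (e, a) \<le> ?h (e, b)"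
      if "a < b" "b < e" for a b e
      using h that unfolding inversion_functions_iff by blast+
    have "f p \<le> ?u i p" for p
      using le[of p] u[of "fst p" "snd p"] uc r by (cases p) (auto split: if_splits)
    then have "f \<le> ?u i" by (simp add: le_fun_def)
    moreover have "(f (b, a) = 0 \<or> min (f (e, b)) (?u i (e, a)) \<le> f (e, a)) \<and>
        (f (b, a) = s b \<or> f (e, a) \<le> f (e, b))" if ab: "a < b" "b < e" for a b e
    proof -
      \<comment> \<open>In the roles (b, a) and (e, b) the entry (c, k) comes with an f (e, a) that
        is capped at 0, so its value matters only in the role (e, a).\<close>
      consider "(e, a) = (c, k)" | "(b, a) = (c, k)" | "(e, b) = (c, k)"
        | "(e, a) \<noteq> (c, k)" "(b, a) \<noteq> (c, k)" "(e, b) \<noteq> (c, k)" by blast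
      then show ?thesis
      proof cases
        case 1
        then show ?thesis
          using r ab uc[of i] unfolding lower_ok_def upper_ok_def by (cases "f (c, k) < i") auto
      next
        case 4
        then show ?thesis using tp[OF ab] u[of e a] by auto
      qed (use ab z[of a e] u0[of a e i] in auto)
    qed
    ultimately show "f \<in> stage i" unfolding inversion_functions_iff by blast
  }
qed

text \<open>In this range the cap at (e, a) is already the full s e, so the \<open>min\<close> is
  absorbed.\<close>

lemma stage_0_trans:
  assumes "h \<in> stage 0" "k \<le> a" "a < b" "b < e" "e < c \<or> e = c \<and> k < a" "0 < h (b, a)"
  shows "h (e, b) \<le> h (e, a)"
proof -
  have "h (e, b) \<le> stage_cap s n k c 0 (e, b)" using assms(1) by (auto simp: inversion_functions_iff le_fun_def)
  also have "\<dots> \<le> stage_cap s n k c 0 (e, a)" using assms(2-5) k1 cn by (auto simp: stage_cap_def)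
  moreover have "h (b, a) = 0 \<or> min (h (e, b)) (stage_cap s n k c 0 (e, a)) \<le> h (e, a)"
    using assms(1,3,4) unfolding inversion_functions_iff by blast
  ultimately show ?thesis using assms(6) by (auto simp: min_absorb1)
qed

lemma stage_trans:
  assumes "f \<in> stage i" "k \<le> a" "a < b" "b < e" "e < c \<or> e = c \<and> k < a" "0 < f (b, a)"
  shows "f (e, b) \<le> f (e, a)"
  using stage_0_trans[of "f((c, k) := 0)" a b e] assms stage_iff[of f i] by auto

lemma stage_planar:
  assumes "f \<in> stage i" "a < b" "b < e" "f (b, a) \<noteq> s b"
  shows "f (e, a) \<le> f (e, b)"
  using assms by (auto simp: inversion_functions_iff)

lemma stage_bound:
  assumes "f \<in> stage i" "e \<noteq> c \<or> x \<noteq> k"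
  shows "f (e, x) \<le> s e"
proof -
  have "f (e, x) \<le> stage_cap s n k c i (e, x)"
    using assms(1) by (simp add: inversion_functions_iff le_fun_def)
  also have "\<dots> \<le> s e" using assms(2) by (auto simp: stage_cap_def)
  finally show ?thesis .
qed

text \<open>Let b obstruct the value v from below and b' obstruct v + 1 from above, so f (c, b') < f
  (c, b). If b < b', planarity gives f (b', b) = s b' and transitivity then f (b', k) = s b'. If b'
  < b, transitivity gives f (b, b') = 0 and planarity then f (b, k) = 0. Both are contradictions.
  Hence a value at the old cap can be kept or raised when the cap grows.\<close>

lemma lower_or_upper_ok:
  assumes f: "f \<in> stage i"
  shows "lower_ok f v \<or> upper_ok f (Suc v)"
proof (rule ccontr)
  assume "\<not> ?thesis"
  then obtain b b' where b: "k < b" "b < c" "0 < f (b, k)" "v < f (c, b)"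
    and b': "k < b'" "b' < c" "f (b', k) \<noteq> s b'" "f (c, b') \<le> v"
    by (auto simp: lower_ok_def upper_ok_def not_le less_Suc_eq_le)
  consider "b = b'" | "b < b'" | "b' < b" by linarith
  then show False
  proof cases
    case 2
    have "f (b', b) = s b'" using stage_planar[OF f, of b b' c] 2 b b' by auto
    then have "s b' \<le> f (b', k)" using stage_trans[OF f, of k b b'] 2 b b' by auto
    then show False using stage_bound[OF f, of b' k] b' by auto
  next
    case 3
    have "f (b, b') = 0" using stage_trans[OF f, of b' b c] 3 b b' by auto
    then show False using stage_planar[OF f, of k b' b] 3 b b' by auto
  qed (use b b' in auto)
qed

end

lemma finite_stage: "finite (inversion_functions s (stage_cap s n k c i))"
proof (rule finite_inversion_functions)
  have "{p. stage_cap s n k c i p \<noteq> 0} \<subseteq> insert (c, k) ({..n} \<times> {..n})"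
    by (auto simp: stage_cap_def split: if_splits)
  then show "finite {p. stage_cap s n k c i p \<noteq> 0}" by (rule finite_subset) auto
qed

context cap_step
begin

definition pattern :: "(nat \<times> nat \<Rightarrow> nat) \<Rightarrow> nat set" where
  "pattern f = {b. k < b \<and> b < c \<and> 0 < s b \<and> f (b, k) = s b}"

text \<open>
  Both copies are present of the intervals with pattern in \<open>Q\<close>, and only the lower copy of the others.
\<close>

definition partial_stage :: "nat \<Rightarrow> nat set set \<Rightarrow> (nat \<times> nat \<Rightarrow> nat) set" where
  "partial_stage i Q = {g \<in> stage (Suc i). g (c, k) = Suc i \<and> lower_ok g i \<longrightarrow> pattern g \<in> Q}"

lemma conditions_upd [simp]:
  "lower_ok (f((c, k) := v)) w = lower_ok f w" "upper_ok (f((c, k) := v)) w = upper_ok f w"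
  "pattern (f((c, k) := v)) = pattern f"
  by (auto simp: lower_ok_def upper_ok_def pattern_def)

lemma upper_ok_mono: "upper_ok f w \<Longrightarrow> v \<le> w \<Longrightarrow> upper_ok f v"
  by (fastforce simp: upper_ok_def)

lemma stage_upd:
  "f((c, k) := v) \<in> stage i \<longleftrightarrow>
     f((c, k) := 0) \<in> stage 0 \<and> v \<le> i \<and> (v < i \<longrightarrow> lower_ok f v) \<and> upper_ok f v"
  by (subst stage_iff) simp

lemma stageD:
  assumes "f \<in> stage i"
  shows "f((c, k) := 0) \<in> stage 0" "f (c, k) \<le> i" "f (c, k) < i \<Longrightarrow> lower_ok f (f (c, k))"
    "upper_ok f (f (c, k))"
  using iffD1[OF stage_iff assms] by auto

text \<open>The upper condition passes from g up to h and the lower one from h down to g. If h (b,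
  k) = s b > 0, then g (c, b) \<le> h (c, b) \<le> i, and the upper condition for g forces g (b, k)
  = s b. So comparable copies belong to the same component.\<close>

lemma doubled_pattern:
  assumes g: "g \<in> stage (Suc i)" "g (c, k) = Suc i" and h: "h \<in> stage (Suc i)" "h (c, k) = i"
    and le: "g((c, k) := i) \<le> h"
  shows "lower_ok g i" "upper_ok h (Suc i)" "pattern g = pattern h"
proof -
  have le': "g (b, k) \<le> h (b, k)" "g (c, b) \<le> h (c, b)" if "k < b" "b < c" for b
    using le_funD[OF le, of "(b, k)"] le_funD[OF le, of "(c, b)"] that by auto
  have up: "g (b, k) = s b \<or> Suc i \<le> g (c, b)" if "k < b" "b < c" for b
    using stageD(4)[OF g(1)] g(2) that by (auto simp: upper_ok_def)
  have lo: "h (b, k) = 0 \<or> h (c, b) \<le> i" if "k < b" "b < c" for b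
    using stageD(3)[OF h(1)] h(2) that by (auto simp: lower_ok_def)
  have bd: "h (b, k) \<le> s b" if "b < c" for b
    using stage_bound[OF h(1)] that by simp
  show "lower_ok g i"
    unfolding lower_ok_def
  proof (intro allI impI)
    fix b assume "k < b \<and> b < c"
    then show "g (b, k) = 0 \<or> g (c, b) \<le> i" using le'[of b] lo[of b] by auto
  qed
  show "upper_ok h (Suc i)"
    unfolding upper_ok_def
  proof (intro allI impI)
    fix b assume "k < b \<and> b < c"
    then show "h (b, k) = s b \<or> Suc i \<le> h (c, b)" using le'[of b] up[of b] bd[of b] by auto
  qed
  have "g (b, k) = s b \<longleftrightarrow> h (b, k) = s b" if "k < b" "b < c" "0 < s b" for b
    using le'[of b] up[of b] lo[of b] bd[of b] that by auto
  then show "pattern g = pattern h" by (auto simp: pattern_def)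
qed

text \<open>The ends of the interval of functions with pattern \<open>P\<close>.\<close>

definition low :: "nat \<Rightarrow> nat set \<Rightarrow> nat \<times> nat \<Rightarrow> nat" where
  "low i P = (\<lambda>(d, x).
     if d = c \<and> x = k then i
     else if x = k \<and> d \<in> P then s d
     else if d = c \<and> k < x \<and> x < c \<and> 0 < s x \<and> x \<notin> P then Suc i
     else if k < x \<and> x < d \<and> d \<in> P \<and> x \<notin> P \<and> 0 < s x then s d
     else 0)"

definition high :: "nat \<Rightarrow> nat set \<Rightarrow> nat \<times> nat \<Rightarrow> nat" where
  "high i P = (\<lambda>(d, x).
     if d = c \<and> x = k then i
     else if x = k then (if d \<in> P then s d else 0)
     else if \<not> (k < x \<and> x < d \<and> d \<le> n) then 0
     else if d = c \<and> x \<in> P then i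
     else if d < c \<and> d \<notin> P \<and> x \<in> P then 0
     else s d)"

context
  fixes i P
  assumes i: "i < s c" and P: "P \<subseteq> {b. k < b \<and> b < c \<and> 0 < s b}"
begin

lemma P_bounds: "b \<in> P \<Longrightarrow> k < b \<and> b < c \<and> 0 < s b \<and> b \<le> n"
  using P cn by auto

lemma low_simps:
  "x < k \<Longrightarrow> low i P (d, x) = 0"
  "low i P (d, k) = (if d = c then i else if d \<in> P then s d else 0)"
  "k < x \<Longrightarrow> low i P (d, x) =
     (if 0 < s x \<and> x \<notin> P then if d = c \<and> x < c then Suc i else if x < d \<and> d \<in> P then s d else 0 else 0)"
  using P_bounds by (auto simp: low_def)

lemma high_simps:
  "x < k \<Longrightarrow> high i P (d, x) = 0"
  "high i P (d, k) = (if d = c then i else if d \<in> P then s d else 0)"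
  "k < x \<Longrightarrow> x < d \<Longrightarrow> d \<le> n \<Longrightarrow> high i P (d, x) =
     (if x \<in> P then if d = c then i else if d < c \<and> d \<notin> P then 0 else s d else s d)"
  "n < d \<Longrightarrow> high i P (d, x) = 0"
  using P_bounds[of d] cn by (auto simp: high_def)

lemma cap_simps:
  "x < k \<Longrightarrow> stage_cap s n k c v (d, x) = 0"
  "k < d \<Longrightarrow> stage_cap s n k c v (d, k) = (if d < c then s d else if d = c then v else 0)"
  "k < x \<Longrightarrow> x < d \<Longrightarrow> stage_cap s n k c v (d, x) = (if d \<le> n then s d else 0)"
  using k1 kc cn by (auto simp: stage_cap_def)

lemma low_in: "low i P \<in> stage (Suc i)"
  unfolding inversion_functions_iff
proof (intro conjI allI impI)
  show "low i P \<le> stage_cap s n k c (Suc i)"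
    using i k1 kc cn P_bounds by (auto simp: le_fun_def low_def stage_cap_def)
  fix a b e :: nat assume "a < b \<and> b < e"
  then have ab: "a < b" "b < e" by auto
  have P: "k < b \<and> b < c \<and> 0 < s b" if "b \<in> P" for b using P_bounds that by auto
  show "low i P (b, a) = 0 \<or> min (low i P (e, b)) (stage_cap s n k c (Suc i) (e, a)) \<le> low i P (e, a)"
  proof (rule linorder_cases[of a k])
    assume "a = k"
    then show ?thesis
      using ab P[of b] P[of e] kc by (cases "e = c") (auto simp: low_simps cap_simps)
  next
    assume "k < a"
    then show ?thesis
      using ab P[of b] P[of e] P[of a] kc cn by (cases "e = c") (auto simp: low_simps cap_simps)
  qed (simp add: low_simps cap_simps)
  show "low i P (b, a) = s b \<or> low i P (e, a) \<le> low i P (e, b)"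
  proof (rule linorder_cases[of a k])
    assume "a = k"
    then show ?thesis
      using ab P[of b] P[of e] kc by (cases "e = c") (auto simp: low_simps)
  next
    assume "k < a"
    then show ?thesis
      using ab P[of b] P[of e] P[of a] kc by (cases "e = c") (auto simp: low_simps)
  qed (simp add: low_simps)
qed

lemma high_in: "high i P \<in> stage (Suc i)"
  unfolding inversion_functions_iff
proof (intro conjI allI impI)
  show "high i P \<le> stage_cap s n k c (Suc i)"
    using i k1 kc cn P_bounds by (auto simp: le_fun_def high_def stage_cap_def)
  fix a b e :: nat assume "a < b \<and> b < e"
  then have ab: "a < b" "b < e" by auto
  have P: "k < b \<and> b < c \<and> 0 < s b" if "b \<in> P" for b using P_bounds that by auto
  consider "n < e" | "a < k" | "e \<le> n" "a = k" | "e \<le> n" "k < a" by linarith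
  note cases = this
  show "high i P (b, a) = 0 \<or> min (high i P (e, b)) (stage_cap s n k c (Suc i) (e, a)) \<le> high i P (e, a)"
    using cases
  proof cases
    case 3
    then show ?thesis
      using ab P[of b] P[of e] kc cn i by (cases "e = c") (auto simp: high_simps cap_simps)
  next
    case 4
    then have "b \<le> n" using ab by simp
    then show ?thesis
      using 4 ab P[of b] P[of e] P[of a] kc cn i by (cases "e = c") (auto simp: high_simps cap_simps)
  qed (simp_all add: high_simps cap_simps)
  show "high i P (b, a) = s b \<or> high i P (e, a) \<le> high i P (e, b)"
    using cases
  proof cases
    case 3
    then show ?thesis
      using ab P[of b] P[of e] kc cn i by (cases "e = c") (auto simp: high_simps)
  next
    case 4
    then have "b \<le> n" using ab by simp
    then show ?thesis
      using 4 ab P[of b] P[of e] P[of a] kc cn i by (cases "e = c") (auto simp: high_simps)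
  qed (simp_all add: high_simps)
qed

text \<open>The clauses of \<open>low\<close> and \<open>high\<close> are forced by the pattern. For
  x outside P with s x > 0, the upper condition gives z (c, x) \<ge> i + 1, and planarity gives z
  (d, x) \<ge> z (d, k) = s d if d is in P. For x in P, the lower condition gives z (c, x) \<le> i,
  and transitivity gives z (d, x) \<le> z (d, k) = 0 if d < c is outside P.\<close>

lemma between_low_high:
  assumes z: "z \<in> stage (Suc i)"
  shows "low i P \<le> z \<and> z \<le> high i P \<longleftrightarrow> z (c, k) = i \<and> upper_ok z (Suc i) \<and> pattern z = P"
proof
  assume *: "low i P \<le> z \<and> z \<le> high i P"
  then have le: "low i P p \<le> z p" "z p \<le> high i P p" for p unfolding le_fun_def by blast+
  have "z (c, k) = i" using le[of "(c, k)"] by (simp add: low_def high_def)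
  moreover have in_P: "z (b, k) = s b" if "b \<in> P" for b
    using le[of "(b, k)"] P_bounds[OF that] that by (simp add: low_def high_def)
  moreover have notin_P: "z (b, k) = 0 \<and> (0 < s b \<longrightarrow> Suc i \<le> z (c, b))" if "k < b" "b < c" "b \<notin> P" for b
    using le[of "(b, k)"] le[of "(c, b)"] that by (simp add: low_def high_def split: if_splits)
  have "upper_ok z (Suc i)"
    unfolding upper_ok_def
  proof (intro allI impI)
    fix b assume "k < b \<and> b < c"
    then show "z (b, k) = s b \<or> Suc i \<le> z (c, b)"
      using in_P[of b] notin_P[of b] by (cases "b \<in> P"; cases "s b = 0") auto
  qed
  moreover have "pattern z = P"
    using in_P notin_P P by (fastforce simp: pattern_def)
  ultimately show "z (c, k) = i \<and> upper_ok z (Suc i) \<and> pattern z = P" by simp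
next
  assume "z (c, k) = i \<and> upper_ok z (Suc i) \<and> pattern z = P"
  then have zi: "z (c, k) = i" and up: "upper_ok z (Suc i)" and pat: "pattern z = P" by auto
  have lo: "lower_ok z i" using stageD(3)[OF z] zi by simp
  have in_P: "z (b, k) = s b" "z (c, b) \<le> i" if "b \<in> P" for b
    using that lo unfolding pat[symmetric] pattern_def lower_ok_def by auto
  have bd: "z (b, k) \<le> s b" if "b \<noteq> c" for b using stage_bound[OF z] that by simp
  have notin_P: "z (b, k) = 0" "0 < s b \<Longrightarrow> Suc i \<le> z (c, b)" if "k < b" "b < c" "b \<notin> P" for b
  proof -
    show *: "Suc i \<le> z (c, b)" if "0 < s b"
      using \<open>b \<notin> P\<close> \<open>k < b\<close> \<open>b < c\<close> that up unfolding pat[symmetric] pattern_def upper_ok_def by auto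
    show "z (b, k) = 0"
    proof (cases "s b = 0")
      case False
      then have "\<not> z (c, b) \<le> i" using * by simp
      then show ?thesis using lo that unfolding lower_ok_def by blast
    qed (use bd[of b] that in simp)
  qed
  have cap: "z p \<le> stage_cap s n k c (Suc i) p" for p
    using z unfolding inversion_functions_iff le_fun_def by blast
  have "low i P (d, x) \<le> z (d, x)" for d x
  proof -
    have "s d \<le> z (d, x)" if "k < x" "x < d" "d \<in> P" "x \<notin> P" "0 < s x"
      using stage_planar[OF z, of k x d] that notin_P(1)[of x] in_P(1)[of d] P_bounds[of d] by auto
    then show ?thesis using in_P(1)[of d] notin_P(2)[of x] zi by (simp add: low_def)
  qed
  moreover have "z (d, x) \<le> high i P (d, x)" for d x
  proof -
    have "z (d, x) = 0" if "k < x" "x < d" "d < c" "d \<notin> P" "x \<in> P"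
      using stage_trans[OF z, of k x d] that in_P(1)[of x] notin_P(1)[of d] P_bounds[of x] by auto
    moreover have "z (d, k) = 0" if "d \<noteq> c" "d \<notin> P"
      using that notin_P(1)[of d] cap[of "(d, k)"] k1
      by (cases "k < d \<and> d < c") (auto simp: stage_cap_def split: if_splits)
    ultimately show ?thesis
      using in_P zi bd[of d] cap[of "(d, x)"]
      by (auto simp: high_def stage_cap_def split: if_splits)
  qed
  ultimately show "low i P \<le> z \<and> z \<le> high i P" by (auto simp: le_fun_def)
qed

end

text \<open>As P is not in Q, only the lower copy of its component is present so far, and it is an
  interval of the partial stage. The order relations between the new upper copies and the old
  elements come from \<open>doubled_pattern\<close>. A component may also be empty, and then nothing
  is added.\<close>

lemma partial_stage_insert:
  assumes dc: "doubling_constructible (pord (partial_stage i Q))" and i: "i < s c" and PQ: "P \<notin> Q"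
  shows "doubling_constructible (pord (partial_stage i (insert P Q)))"
proof -
  let ?I = "{z \<in> stage (Suc i). z (c, k) = i \<and> upper_ok z (Suc i) \<and> pattern z = P}"
  define t :: "(nat \<times> nat \<Rightarrow> nat) \<Rightarrow> nat \<times> nat \<Rightarrow> nat" where "t z = z((c, k) := Suc i)" for z
  have t_in: "t z \<in> stage (Suc i)" if "z \<in> ?I" for z
  proof -
    have z: "z \<in> stage (Suc i)" "upper_ok z (Suc i)" using that by auto
    show ?thesis unfolding t_def by (subst stage_upd) (use stageD(1)[OF z(1)] z(2) in simp)
  qed
  have lok: "lower_ok z i" if "z \<in> ?I" for z
  proof -
    have "z \<in> stage (Suc i)" "z (c, k) = i" using that by auto
    then show ?thesis using stageD(3)[of z "Suc i"] by (metis lessI)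
  qed
  have ins: "partial_stage i (insert P Q) = partial_stage i Q \<union> t ` ?I"
  proof
    show "partial_stage i (insert P Q) \<subseteq> partial_stage i Q \<union> t ` ?I"
    proof
      fix g assume g: "g \<in> partial_stage i (insert P Q)"
      show "g \<in> partial_stage i Q \<union> t ` ?I"
      proof (cases "g \<in> partial_stage i Q")
        case False
        then have *: "g \<in> stage (Suc i)" "g (c, k) = Suc i" "lower_ok g i" "pattern g = P"
          using g by (auto simp: partial_stage_def)
        let ?z = "g((c, k) := i)"
        have "g((c, k) := 0) \<in> stage 0" "upper_ok g (Suc i)" using stageD(1,4)[OF *(1)] *(2) by auto
        then have "?z \<in> stage (Suc i)"
          by (subst stage_upd) (use * upper_ok_mono[of g "Suc i" i] in simp)
        then have "?z \<in> ?I" using * \<open>upper_ok g (Suc i)\<close> by simp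
        moreover have "g = t ?z" using *(2) by (auto simp: t_def)
        ultimately have "g \<in> t ` ?I" by (intro rev_image_eqI[of ?z])
        then show ?thesis by (rule UnI2)
      qed simp
    qed
    show "partial_stage i Q \<union> t ` ?I \<subseteq> partial_stage i (insert P Q)"
    proof
      fix g assume "g \<in> partial_stage i Q \<union> t ` ?I"
      then consider "g \<in> partial_stage i Q" | z where "z \<in> ?I" "g = t z" by blast
      then show "g \<in> partial_stage i (insert P Q)"
      proof cases
        case 2
        then have "pattern g = P" by (simp add: t_def)
        then show ?thesis using t_in[OF 2(1)] 2(2) by (simp add: partial_stage_def)
      qed (simp add: partial_stage_def)
    qed
  qed
  show ?thesis
  proof (cases "?I = {}")
    case True
    show ?thesis using dc unfolding ins True by simp
  next
    case False
    then obtain z0 where "z0 \<in> ?I" by blast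
    then have P: "P \<subseteq> {b. k < b \<and> b < c \<and> 0 < s b}" by (auto simp: pattern_def)
    note between = between_low_high[OF i P]
    have I: "?I = {z \<in> partial_stage i Q. low i P \<le> z \<and> z \<le> high i P}"
      using between by (auto simp: partial_stage_def)
    have bounds: "low i P \<in> ?I" "high i P \<in> ?I"
    proof -
      have "low i P \<le> z0" "z0 \<le> high i P" using between[of z0] \<open>z0 \<in> ?I\<close> by auto
      then have "low i P \<le> high i P" by (rule order.trans)
      then show "low i P \<in> ?I" "high i P \<in> ?I"
        using between[OF low_in[OF i P]] between[OF high_in[OF i P]] low_in[OF i P] high_in[OF i P] by auto
    qed
    have zt: "z \<le> t z" if "z \<in> ?I" for z
      using that by (auto simp: t_def le_fun_def)
    have t_le: "x \<le> z((c, k) := v) \<longleftrightarrow> x \<le> z((c, k) := x (c, k)) \<and> x (c, k) \<le> v" for x z :: "nat \<times> nat \<Rightarrow> nat" and v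
      by (auto simp: le_fun_def)
    have le_t: "z((c, k) := v) \<le> x \<longleftrightarrow> z((c, k) := x (c, k)) \<le> x \<and> v \<le> x (c, k)" for x z :: "nat \<times> nat \<Rightarrow> nat" and v
      by (auto simp: le_fun_def)
    have val: "x (c, k) \<le> Suc i" if "x \<in> stage (Suc i)" for x using stageD(2)[OF that] .
    show ?thesis
      unfolding ins
    proof (rule doubling_constructible_double[OF dc, of "low i P" "high i P"])
      show "finite (partial_stage i Q)"
        by (rule finite_subset[OF _ finite_stage]) (auto simp: partial_stage_def)
      show "low i P \<in> partial_stage i Q" "high i P \<in> partial_stage i Q" "low i P \<le> high i P"
        using bounds unfolding I by auto
      show "inj_on t ?I"
      proof (rule inj_onI)
        fix z z' assume z: "z \<in> ?I" "z' \<in> ?I" "t z = t z'"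
        then have "z((c, k) := i) = z'((c, k) := i)" unfolding t_def by (metis fun_upd_upd)
        moreover have "z((c, k) := i) = z" "z'((c, k) := i) = z'"
          using z by (simp_all add: fun_upd_idem)
        ultimately show "z = z'" by simp
      qed
      show "t ` ?I \<inter> partial_stage i Q = {}"
        using lok PQ by (auto simp: partial_stage_def t_def)
      fix x z assume x: "x \<in> partial_stage i Q" and z: "z \<in> ?I"
      have xs: "x \<in> stage (Suc i)" using x by (simp add: partial_stage_def)
      show "x \<le> t z \<longleftrightarrow> x \<le> z"
      proof
        assume "x \<le> t z"
        show "x \<le> z"
        \<comment> \<open>Only an x with value i + 1 could be below the upper copy but not below z.
          It would have pattern P and satisfy the lower condition at i, so it would not be present
          yet.\<close>
        proof (cases "x (c, k) = Suc i")
          case True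
          have "x((c, k) := i) \<le> z"
          proof (rule le_funI)
            fix p show "(x((c, k) := i)) p \<le> z p"
              using le_funD[OF \<open>x \<le> t z\<close>, of p] z by (cases "p = (c, k)") (auto simp: t_def)
          qed
          then have "lower_ok x i" "pattern x = P"
            using doubled_pattern[OF xs True, of z] z by auto
          then show ?thesis using x True PQ by (simp add: partial_stage_def)
        next
          case False
          then have "x (c, k) \<le> z (c, k)" using val[OF xs] z by simp
          then show ?thesis using \<open>x \<le> t z\<close> by (auto simp: t_def le_fun_def split: if_splits)
        qed
      qed (rule order.trans[OF _ zt[OF z]])
      show "t z \<le> x \<longleftrightarrow> z \<le> x \<and> \<not> x \<le> high i P"
      proof
        assume tz: "t z \<le> x"
        then have "Suc i \<le> x (c, k)" by (auto simp: t_def le_fun_def dest: spec[of _ c] split: if_splits)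
        moreover have "high i P (c, k) = i" by (simp add: high_def)
        ultimately have "\<not> x \<le> high i P" by (metis le_funD not_less_eq_eq order.trans)
        then show "z \<le> x \<and> \<not> x \<le> high i P" using zt[OF z] tz by auto
      next
        assume zx: "z \<le> x \<and> \<not> x \<le> high i P"
        \<comment> \<open>With the value i, x would belong to the component of P by
          \<open>doubled_pattern\<close>, applied to the upper copy of z, and so lie below
          \<open>high i P\<close>.\<close>
        have "x (c, k) \<noteq> i"
        proof
          assume xi: "x (c, k) = i"
          have "(t z)((c, k) := i) \<le> x" using zx z by (auto simp: t_def fun_upd_idem)
          then have "upper_ok x (Suc i)" "pattern x = P"
            using doubled_pattern[OF t_in[OF z] _ xs xi] z by (auto simp: t_def)
          then have "x \<le> high i P" using between[OF xs] xi by simp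
          then show False using zx by simp
        qed
        moreover have "i \<le> x (c, k)" using zx z by (auto simp: le_fun_def)
        ultimately show "t z \<le> x" using zx by (auto simp: t_def le_fun_def)
      qed
    next
      fix z z' assume "z \<in> ?I" "z' \<in> ?I"
      then have "t z p \<le> t z' p \<longleftrightarrow> z p \<le> z' p" for p
        by (cases "p = (c, k)") (auto simp: t_def)
      then show "t z \<le> t z' \<longleftrightarrow> z \<le> z'"
        unfolding le_fun_def by blast
    qed (rule I)
  qed
qed

text \<open>Without upper copies, a value i + 1 occurs only where the lower condition fails at i, so
  truncation at i merges no two elements. It is onto since an f with value i that fails this
  condition can be raised, by \<open>lower_or_upper_ok\<close>.\<close>

lemma partial_stage_empty:
  "order_isomorphic (pord (partial_stage i {})) (pord (stage i))"
proof -
  define \<phi> :: "(nat \<times> nat \<Rightarrow> nat) \<Rightarrow> nat \<times> nat \<Rightarrow> nat" where "\<phi> g = g((c, k) := min (g (c, k)) i)" for g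
  have val: "g (c, k) \<le> Suc i" if "g \<in> stage (Suc i)" for g using stageD(2)[OF that] .
  have mono: "\<phi> g \<le> \<phi> h" if "g \<le> h" for g h
    using that by (auto simp: \<phi>_def le_fun_def min_le_iff_disj)
  have refl: "g \<le> h" if g: "g \<in> partial_stage i {}" and h: "h \<in> partial_stage i {}" and le: "\<phi> g \<le> \<phi> h" for g h
  proof -
    have gh: "g \<in> stage (Suc i)" "h \<in> stage (Suc i)" using g h by (auto simp: partial_stage_def)
    have le': "\<phi> g p \<le> \<phi> h p" for p using le unfolding le_fun_def by blast
    have "g (c, k) \<le> h (c, k)"
    proof (rule ccontr)
      assume *: "\<not> g (c, k) \<le> h (c, k)"
      moreover have "min (g (c, k)) i \<le> min (h (c, k)) i" using le'[of "(c, k)"] by (simp add: \<phi>_def)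
      ultimately have v: "g (c, k) = Suc i" "h (c, k) = i" using val[OF gh(1)] by auto
      then have "g((c, k) := i) \<le> h" using le by (simp add: \<phi>_def fun_upd_idem)
      then have "lower_ok g i" using doubled_pattern[OF gh(1) v(1) gh(2) v(2)] by simp
      then show False using g v by (simp add: partial_stage_def)
    qed
    moreover have "g p \<le> h p" if "p \<noteq> (c, k)" for p using le'[of p] that by (simp add: \<phi>_def)
    ultimately show ?thesis unfolding le_fun_def by (metis)
  qed
  have into: "\<phi> g \<in> stage i" if "g \<in> partial_stage i {}" for g
  proof -
    have g: "g \<in> stage (Suc i)" using that by (simp add: partial_stage_def)
    then show ?thesis
      unfolding \<phi>_def
      by (subst stage_upd)
        (use stageD[OF g] upper_ok_mono[of g "g (c, k)"] in \<open>cases "g (c, k) < i"; simp add: min_def\<close>)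
  qed
  have onto: "\<exists>g\<in>partial_stage i {}. \<phi> g = f" if f: "f \<in> stage i" for f
  proof (cases "f (c, k) < i \<or> lower_ok f i")
    case True
    have "f \<in> stage (Suc i)"
      using stageD[OF f] True by (subst stage_iff) (cases "f (c, k) = i"; auto)
    moreover have "f (c, k) \<le> i" using stageD(2)[OF f] .
    ultimately show ?thesis
      by (intro bexI[of _ f]) (auto simp: partial_stage_def \<phi>_def min_absorb1)
  next
    case False
    then have fi: "f (c, k) = i" and nl: "\<not> lower_ok f i" and up: "upper_ok f (Suc i)"
      using stageD(2)[OF f] lower_or_upper_ok[OF f, of i] by auto
    then have "f((c, k) := Suc i) \<in> stage (Suc i)"
      by (subst stage_upd) (use stageD(1)[OF f] in simp)
    moreover have "\<phi> (f((c, k) := Suc i)) = f" using fi by (auto simp: \<phi>_def)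
    ultimately show ?thesis
      using nl by (intro bexI[of _ "f((c, k) := Suc i)"]) (auto simp: partial_stage_def)
  qed
  have "bij_betw \<phi> (partial_stage i {}) (stage i)"
    unfolding bij_betw_def
  proof
    show "inj_on \<phi> (partial_stage i {})"
      using refl by (intro inj_onI antisym) simp_all
    show "\<phi> ` partial_stage i {} = stage i" using into onto by blast
  qed
  then show ?thesis
    unfolding order_isomorphic_def pord_simps using mono refl by blast
qed

lemma doubling_constructible_stage_Suc:
  assumes "doubling_constructible (pord (stage i))" "i < s c"
  shows "doubling_constructible (pord (stage (Suc i)))"
proof -
  have "doubling_constructible (pord (partial_stage i Q))" if "finite Q" for Q
    using that
  proof (induction Q)
    case empty
    then show ?case using doubling_constructible_iso[OF partial_stage_empty assms(1)] .
  next
    case (insert P Q)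
    then show ?case using partial_stage_insert assms(2) by simp
  qed
  then have "doubling_constructible (pord (partial_stage i (Pow {k..c})))" by simp
  moreover have "partial_stage i (Pow {k..c}) = stage (Suc i)"
    by (auto simp: partial_stage_def pattern_def)
  ultimately show ?thesis by simp
qed

end

text \<open>Three nested inductions: on the value i at one entry, upwards on c along a row, and
  downwards on k over the rows. A completed row \<open>Suc k\<close> is the empty beginning of row
  k; k = n gives the zero function alone and k = 0 the full cap.\<close>

lemma doubling_constructible_tree_inversions:
  "doubling_constructible (pord (tree_inversions s n))"
proof -
  let ?dc = "\<lambda>u. doubling_constructible (pord (inversion_functions s u))"
  have row: "?dc (stage_cap s n k c 0)"
    if k: "1 \<le> k" and base: "?dc (stage_cap s n k (Suc k) 0)" and "Suc k \<le> c" "c \<le> Suc n" for k c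
    using that(3,4)
  proof (induction c rule: dec_induct)
    case base
    then show ?case using that(2) by simp
  next
    case (step c)
    interpret cap_step s n k c by unfold_locales (use step k in auto)
    have "?dc (stage_cap s n k c i)" if "i \<le> s c" for i
      using that by (induction i) (use step doubling_constructible_stage_Suc in auto)
    moreover have "stage_cap s n k c (s c) = stage_cap s n k (Suc c) 0"
      using k step by (auto simp: stage_cap_def fun_eq_iff)
    ultimately show ?case by (metis order_refl)
  qed
  have "?dc (stage_cap s n k (Suc k) 0)" if "k \<le> n" for k
    using that
  proof (induction k rule: inc_induct)
    case base
    have "stage_cap s n n (Suc n) 0 = (\<lambda>_. 0)"
      by (auto simp: stage_cap_def fun_eq_iff)
    moreover have "inversion_functions s (\<lambda>_. 0) = {\<lambda>_. 0}"
      by (auto simp: inversion_functions_def le_fun_def fun_eq_iff)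
    ultimately show ?case using doubling_constructible_singleton by simp
  next
    case (step k)
    have "?dc (stage_cap s n (Suc k) (Suc n) 0)"
      using row[of "Suc k" "Suc n"] step by simp
    moreover have "stage_cap s n (Suc k) (Suc n) 0 = stage_cap s n k (Suc k) 0"
      by (auto simp: stage_cap_def fun_eq_iff)
    ultimately show ?case by simp
  qed
  moreover have "stage_cap s n 0 (Suc 0) 0 = full_cap s n"
    by (auto simp: stage_cap_def full_cap_def fun_eq_iff)
  ultimately show ?thesis by (metis le0)
qed

section \<open>Doubling preserves semidistributive lattices\<close>

locale lattice_iso =
  fixes L :: "('a, 'c) gorder_scheme" and M :: "('b, 'd) gorder_scheme" and f
  assumes L: "partial_order L" and M: "lattice M"
    and bij: "bij_betw f (carrier L) (carrier M)"
    and le_iff: "\<And>x y. x \<in> carrier L \<Longrightarrow> y \<in> carrier L \<Longrightarrow> x \<sqsubseteq>\<^bsub>L\<^esub> y \<longleftrightarrow> f x \<sqsubseteq>\<^bsub>M\<^esub> f y"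
begin

interpretation M: lattice M by (rule M)

lemma closed: "x \<in> carrier L \<Longrightarrow> f x \<in> carrier M"
  using bij by (auto simp: bij_betw_def)

lemma preimage:
  assumes "y \<in> carrier M"
  obtains x where "x \<in> carrier L" "f x = y"
proof -
  have "y \<in> f ` carrier L" using bij assms by (simp add: bij_betw_def)
  then show thesis using that by auto
qed

lemma inj: "x \<in> carrier L \<Longrightarrow> y \<in> carrier L \<Longrightarrow> f x = f y \<Longrightarrow> x = y"
  using bij by (auto simp: bij_betw_def inj_on_def)

lemma join_exists:
  assumes xy: "x \<in> carrier L" "y \<in> carrier L"
  shows "\<exists>j\<in>carrier L. f j = f x \<squnion>\<^bsub>M\<^esub> f y \<and> x \<sqsubseteq>\<^bsub>L\<^esub> j \<and> y \<sqsubseteq>\<^bsub>L\<^esub> j \<and>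
    (\<forall>z\<in>carrier L. x \<sqsubseteq>\<^bsub>L\<^esub> z \<and> y \<sqsubseteq>\<^bsub>L\<^esub> z \<longrightarrow> j \<sqsubseteq>\<^bsub>L\<^esub> z)"
proof -
  have c: "f x \<in> carrier M" "f y \<in> carrier M" using xy closed by auto
  then obtain j where "j \<in> carrier L" "f j = f x \<squnion>\<^bsub>M\<^esub> f y"
    using preimage M.join_closed by metis
  then show ?thesis
    using xy c closed M.join_left M.join_right M.join_le by (intro bexI[of _ j]) (auto simp: le_iff)
qed

lemma meet_exists:
  assumes xy: "x \<in> carrier L" "y \<in> carrier L"
  shows "\<exists>j\<in>carrier L. f j = f x \<sqinter>\<^bsub>M\<^esub> f y \<and> j \<sqsubseteq>\<^bsub>L\<^esub> x \<and> j \<sqsubseteq>\<^bsub>L\<^esub> y \<and>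
    (\<forall>z\<in>carrier L. z \<sqsubseteq>\<^bsub>L\<^esub> x \<and> z \<sqsubseteq>\<^bsub>L\<^esub> y \<longrightarrow> z \<sqsubseteq>\<^bsub>L\<^esub> j)"
proof -
  have c: "f x \<in> carrier M" "f y \<in> carrier M" using xy closed by auto
  then obtain j where "j \<in> carrier L" "f j = f x \<sqinter>\<^bsub>M\<^esub> f y"
    using preimage M.meet_closed by metis
  then show ?thesis
    using xy c closed M.meet_left M.meet_right M.meet_le by (intro bexI[of _ j]) (auto simp: le_iff)
qed

lemma lattice: "lattice L"
  using join_exists meet_exists by (intro latticeI[OF L]) blast+

lemma f_join: "x \<in> carrier L \<Longrightarrow> y \<in> carrier L \<Longrightarrow> f (x \<squnion>\<^bsub>L\<^esub> y) = f x \<squnion>\<^bsub>M\<^esub> f y"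
  using join_exists[of x y] join_eqI[OF L, of x y] by blast

lemma f_meet: "x \<in> carrier L \<Longrightarrow> y \<in> carrier L \<Longrightarrow> f (x \<sqinter>\<^bsub>L\<^esub> y) = f x \<sqinter>\<^bsub>M\<^esub> f y"
  using meet_exists[of x y] meet_eqI[OF L, of x y] by blast

lemma semidistributive:
  assumes sd: "semidistributive M"
  shows "semidistributive L"
  unfolding semidistributive_def
proof (intro conjI ballI impI)
  interpret L: lattice L by (rule lattice)
  fix x y z assume xyz: "x \<in> carrier L" "y \<in> carrier L" "z \<in> carrier L"
  note c = closed[OF xyz(1)] closed[OF xyz(2)] closed[OF xyz(3)]
  {
    assume "z \<sqinter>\<^bsub>L\<^esub> x = z \<sqinter>\<^bsub>L\<^esub> y"
    then have "f z \<sqinter>\<^bsub>M\<^esub> f x = f z \<sqinter>\<^bsub>M\<^esub> f y" using xyz by (metis f_meet)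
    then have "f z \<sqinter>\<^bsub>M\<^esub> (f x \<squnion>\<^bsub>M\<^esub> f y) = f z \<sqinter>\<^bsub>M\<^esub> f x"
      using sd c unfolding semidistributive_def by blast
    then show "z \<sqinter>\<^bsub>L\<^esub> (x \<squnion>\<^bsub>L\<^esub> y) = z \<sqinter>\<^bsub>L\<^esub> x"
      using xyz by (intro inj) (auto simp: f_meet f_join)
  }
  {
    assume "z \<squnion>\<^bsub>L\<^esub> x = z \<squnion>\<^bsub>L\<^esub> y"
    then have "f z \<squnion>\<^bsub>M\<^esub> f x = f z \<squnion>\<^bsub>M\<^esub> f y" using xyz by (metis f_join)
    then have "f z \<squnion>\<^bsub>M\<^esub> (f x \<sqinter>\<^bsub>M\<^esub> f y) = f z \<squnion>\<^bsub>M\<^esub> f x"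
      using sd c unfolding semidistributive_def by blast
    then show "z \<squnion>\<^bsub>L\<^esub> (x \<sqinter>\<^bsub>L\<^esub> y) = z \<squnion>\<^bsub>L\<^esub> x"
      using xyz by (intro inj) (auto simp: f_meet f_join)
  }
qed (rule lattice)

end

lemma lattice_semidistributive_iso:
  assumes "partial_order L" "order_isomorphic L M" "lattice M" "semidistributive M"
  shows "lattice L \<and> semidistributive L"
proof -
  obtain f where f: "bij_betw f (carrier L) (carrier M)"
      "\<forall>x\<in>carrier L. \<forall>y\<in>carrier L. x \<sqsubseteq>\<^bsub>L\<^esub> y \<longleftrightarrow> f x \<sqsubseteq>\<^bsub>M\<^esub> f y"
    using assms(2) by (auto simp: order_isomorphic_def)
  then interpret lattice_iso L M f using assms(1,3) by (simp add: lattice_iso_def)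
  show ?thesis using lattice semidistributive assms(4) by simp
qed

locale interval_doubling = lattice L for L :: "('a, 'b) gorder_scheme" (structure) +
  fixes a b
  assumes a: "a \<in> carrier L" and b: "b \<in> carrier L" and ab: "a \<sqsubseteq> b"
begin

definition "D = doubling L \<lbrace>a..b\<rbrace>"
definition "I = {x \<in> carrier L. a \<sqsubseteq> x \<and> x \<sqsubseteq> b}"

lemma I_eq: "\<lbrace>a..b\<rbrace> = I"
  by (auto simp: at_least_at_most_def I_def)

lemma down: "down_closure L I = {x \<in> carrier L. x \<sqsubseteq> b}"
  using a b ab by (auto simp: down_closure_def I_def intro: le_trans)

lemma carrier_D: "(x, v) \<in> carrier D \<longleftrightarrow> x \<in> carrier L \<and> (v \<longrightarrow> x \<sqsubseteq> b \<longrightarrow> a \<sqsubseteq> x) \<and> (\<not> v \<longrightarrow> x \<sqsubseteq> b)"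
  unfolding D_def I_eq doubling_def down using b by (auto simp: I_def)

lemma le_D: "(x, v) \<sqsubseteq>\<^bsub>D\<^esub> (y, w) \<longleftrightarrow> x \<sqsubseteq> y \<and> (v \<longrightarrow> w)"
  by (auto simp: D_def doubling_def)

lemma partial_order_D: "partial_order D"
proof
  show "(.=\<^bsub>D\<^esub>) = (=)" by (simp add: D_def doubling_def)
  show "x .=\<^bsub>D\<^esub> x" for x by (simp add: D_def doubling_def)
  show "y .=\<^bsub>D\<^esub> x" if "x .=\<^bsub>D\<^esub> y" for x y using that by (simp add: D_def doubling_def)
  show "x .=\<^bsub>D\<^esub> z" if "x .=\<^bsub>D\<^esub> y" "y .=\<^bsub>D\<^esub> z" for x y z using that by (simp add: D_def doubling_def)
  show "x \<sqsubseteq>\<^bsub>D\<^esub> x" if "x \<in> carrier D" for x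
    using that by (cases x) (auto simp: le_D carrier_D)
  show "x .=\<^bsub>D\<^esub> y" if "x \<sqsubseteq>\<^bsub>D\<^esub> y" "y \<sqsubseteq>\<^bsub>D\<^esub> x" "x \<in> carrier D" "y \<in> carrier D" for x y
  proof -
    have "x = y" using that by (cases x; cases y) (auto simp: le_D carrier_D intro: le_antisym)
    then show ?thesis by (simp add: D_def doubling_def)
  qed
  show "x \<sqsubseteq>\<^bsub>D\<^esub> z" if "x \<sqsubseteq>\<^bsub>D\<^esub> y" "y \<sqsubseteq>\<^bsub>D\<^esub> z" "x \<in> carrier D" "y \<in> carrier D" "z \<in> carrier D" for x y z
    using that by (cases x; cases y; cases z) (auto simp: le_D carrier_D intro: le_trans)
  show "(x \<sqsubseteq>\<^bsub>D\<^esub> z) = (y \<sqsubseteq>\<^bsub>D\<^esub> w)" if "x .=\<^bsub>D\<^esub> y" "z .=\<^bsub>D\<^esub> w" for x y z w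
    using that by (simp add: D_def doubling_def)
qed

text \<open>Over the doubled interval the second component is free; elsewhere it is determined by
  the first one, being true exactly off the down-set of b. The same holds for
  \<open>D_meet\<close>.\<close>

definition D_join where
  "D_join x v y w = (x \<squnion> y, if a \<sqsubseteq> x \<squnion> y \<and> x \<squnion> y \<sqsubseteq> b then v \<or> w else \<not> x \<squnion> y \<sqsubseteq> b)"

definition D_meet where
  "D_meet x v y w = (x \<sqinter> y, if a \<sqsubseteq> x \<sqinter> y \<and> x \<sqinter> y \<sqsubseteq> b then v \<and> w else \<not> x \<sqinter> y \<sqsubseteq> b)"

lemma D_join_least:
  assumes x: "(x, v) \<in> carrier D" and y: "(y, w) \<in> carrier D"
  shows "D_join x v y w \<in> carrier D" "(x, v) \<sqsubseteq>\<^bsub>D\<^esub> D_join x v y w" "(y, w) \<sqsubseteq>\<^bsub>D\<^esub> D_join x v y w"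
    "\<And>z u. (z, u) \<in> carrier D \<Longrightarrow> (x, v) \<sqsubseteq>\<^bsub>D\<^esub> (z, u) \<Longrightarrow> (y, w) \<sqsubseteq>\<^bsub>D\<^esub> (z, u) \<Longrightarrow> D_join x v y w \<sqsubseteq>\<^bsub>D\<^esub> (z, u)"
proof -
  have c: "x \<in> carrier L" "y \<in> carrier L" using x y by (auto simp: carrier_D)
  note j = join_closed[OF c] join_left[OF c] join_right[OF c]
  have up: "a \<sqsubseteq> x \<squnion> y" if "a \<sqsubseteq> x \<or> a \<sqsubseteq> y"
    using that le_trans[OF _ j(2) a c(1) j(1)] le_trans[OF _ j(3) a c(2) j(1)] by blast
  have dn: "x \<sqsubseteq> b \<and> y \<sqsubseteq> b" if "x \<squnion> y \<sqsubseteq> b"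
    using le_trans[OF j(2) that c(1) j(1) b] le_trans[OF j(3) that c(2) j(1) b] by blast
  show "D_join x v y w \<in> carrier D"
    using j by (auto simp: D_join_def carrier_D)
  show "(x, v) \<sqsubseteq>\<^bsub>D\<^esub> D_join x v y w" "(y, w) \<sqsubseteq>\<^bsub>D\<^esub> D_join x v y w"
  proof -
    have "v \<or> w \<Longrightarrow> x \<squnion> y \<sqsubseteq> b \<Longrightarrow> a \<sqsubseteq> x \<squnion> y" using up dn x y by (auto simp: carrier_D)
    then show "(x, v) \<sqsubseteq>\<^bsub>D\<^esub> D_join x v y w" "(y, w) \<sqsubseteq>\<^bsub>D\<^esub> D_join x v y w"
      using j by (auto simp: D_join_def le_D)
  qed
  fix z u assume z: "(z, u) \<in> carrier D" "(x, v) \<sqsubseteq>\<^bsub>D\<^esub> (z, u)" "(y, w) \<sqsubseteq>\<^bsub>D\<^esub> (z, u)"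
  then have zc: "z \<in> carrier L" "x \<sqsubseteq> z" "y \<sqsubseteq> z" by (auto simp: carrier_D le_D)
  have le: "x \<squnion> y \<sqsubseteq> z" using join_le[OF zc(2,3) c zc(1)] .
  moreover have "x \<squnion> y \<sqsubseteq> b" if "z \<sqsubseteq> b" using le_trans[OF le that j(1) zc(1) b] .
  ultimately show "D_join x v y w \<sqsubseteq>\<^bsub>D\<^esub> (z, u)"
    using z by (auto simp: D_join_def le_D carrier_D)
qed

lemma D_meet_greatest:
  assumes x: "(x, v) \<in> carrier D" and y: "(y, w) \<in> carrier D"
  shows "D_meet x v y w \<in> carrier D" "D_meet x v y w \<sqsubseteq>\<^bsub>D\<^esub> (x, v)" "D_meet x v y w \<sqsubseteq>\<^bsub>D\<^esub> (y, w)"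
    "\<And>z u. (z, u) \<in> carrier D \<Longrightarrow> (z, u) \<sqsubseteq>\<^bsub>D\<^esub> (x, v) \<Longrightarrow> (z, u) \<sqsubseteq>\<^bsub>D\<^esub> (y, w) \<Longrightarrow> (z, u) \<sqsubseteq>\<^bsub>D\<^esub> D_meet x v y w"
proof -
  have c: "x \<in> carrier L" "y \<in> carrier L" using x y by (auto simp: carrier_D)
  note j = meet_closed[OF c] meet_left[OF c] meet_right[OF c]
  have up: "x \<sqinter> y \<sqsubseteq> b" if "x \<sqsubseteq> b \<or> y \<sqsubseteq> b"
    using that le_trans[OF j(2) _ j(1) c(1) b] le_trans[OF j(3) _ j(1) c(2) b] by blast
  show "D_meet x v y w \<in> carrier D"
    using j by (auto simp: D_meet_def carrier_D)
  show "D_meet x v y w \<sqsubseteq>\<^bsub>D\<^esub> (x, v)" "D_meet x v y w \<sqsubseteq>\<^bsub>D\<^esub> (y, w)"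
  proof -
    have "\<not> x \<sqinter> y \<sqsubseteq> b \<Longrightarrow> v \<and> w" using up x y by (auto simp: carrier_D)
    then show "D_meet x v y w \<sqsubseteq>\<^bsub>D\<^esub> (x, v)" "D_meet x v y w \<sqsubseteq>\<^bsub>D\<^esub> (y, w)"
      using j by (auto simp: D_meet_def le_D)
  qed
  fix z u assume z: "(z, u) \<in> carrier D" "(z, u) \<sqsubseteq>\<^bsub>D\<^esub> (x, v)" "(z, u) \<sqsubseteq>\<^bsub>D\<^esub> (y, w)"
  then have zc: "z \<in> carrier L" "z \<sqsubseteq> x" "z \<sqsubseteq> y" by (auto simp: carrier_D le_D)
  have le: "z \<sqsubseteq> x \<sqinter> y" using meet_le[OF zc(2,3) c zc(1)] .
  moreover have "z \<sqsubseteq> b" if "x \<sqinter> y \<sqsubseteq> b" using le_trans[OF le that zc(1) j(1) b] .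
  moreover have "a \<sqsubseteq> x \<sqinter> y" if "a \<sqsubseteq> z" using le_trans[OF that le a zc(1) j(1)] .
  ultimately show "(z, u) \<sqsubseteq>\<^bsub>D\<^esub> D_meet x v y w"
    using z by (auto simp: D_meet_def le_D carrier_D)
qed

lemma join_D: "(x, v) \<in> carrier D \<Longrightarrow> (y, w) \<in> carrier D \<Longrightarrow> (x, v) \<squnion>\<^bsub>D\<^esub> (y, w) = D_join x v y w"
  using D_join_least[of x v y w] by (intro join_eqI[OF partial_order_D]) auto

lemma meet_D: "(x, v) \<in> carrier D \<Longrightarrow> (y, w) \<in> carrier D \<Longrightarrow> (x, v) \<sqinter>\<^bsub>D\<^esub> (y, w) = D_meet x v y w"
  using D_meet_greatest[of x v y w] by (intro meet_eqI[OF partial_order_D]) auto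

lemma lattice_D: "lattice D"
proof (rule latticeI[OF partial_order_D])
  fix p q assume "p \<in> carrier D" "q \<in> carrier D"
  moreover obtain x v y w where "p = (x, v)" "q = (y, w)" by (cases p; cases q)
  ultimately show "\<exists>j\<in>carrier D. p \<sqsubseteq>\<^bsub>D\<^esub> j \<and> q \<sqsubseteq>\<^bsub>D\<^esub> j \<and> (\<forall>z\<in>carrier D. p \<sqsubseteq>\<^bsub>D\<^esub> z \<and> q \<sqsubseteq>\<^bsub>D\<^esub> z \<longrightarrow> j \<sqsubseteq>\<^bsub>D\<^esub> z)"
    "\<exists>j\<in>carrier D. j \<sqsubseteq>\<^bsub>D\<^esub> p \<and> j \<sqsubseteq>\<^bsub>D\<^esub> q \<and> (\<forall>z\<in>carrier D. z \<sqsubseteq>\<^bsub>D\<^esub> p \<and> z \<sqsubseteq>\<^bsub>D\<^esub> q \<longrightarrow> z \<sqsubseteq>\<^bsub>D\<^esub> j)"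
    using D_join_least[of x v y w] D_meet_greatest[of x v y w] by auto
qed

text \<open>
  The projection of the doubling to \<open>L\<close> is a lattice homomorphism, so an implication that holds in
  \<open>L\<close> can only fail between the two copies of an element of the doubled interval.
\<close>

lemma semidistributive_D:
  assumes sd: "semidistributive L"
  shows "semidistributive D"
  unfolding semidistributive_def
proof (intro conjI ballI impI)
  fix p q r assume pqr: "p \<in> carrier D" "q \<in> carrier D" "r \<in> carrier D"
  obtain x v y w z u where eq: "p = (x, v)" "q = (y, w)" "r = (z, u)" by (cases p; cases q; cases r)
  note c = pqr[unfolded eq]
  have cL: "x \<in> carrier L" "y \<in> carrier L" "z \<in> carrier L" using c by (auto simp: carrier_D)
  have cj: "(x \<squnion> y, snd (D_join x v y w)) \<in> carrier D" "(x \<sqinter> y, snd (D_meet x v y w)) \<in> carrier D"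
    using D_join_least(1)[OF c(1,2)] D_meet_greatest(1)[OF c(1,2)] by (auto simp: D_join_def D_meet_def)
  have jm: "p \<squnion>\<^bsub>D\<^esub> q = (x \<squnion> y, snd (D_join x v y w))" "p \<sqinter>\<^bsub>D\<^esub> q = (x \<sqinter> y, snd (D_meet x v y w))"
    using join_D[OF c(1,2)] meet_D[OF c(1,2)] by (auto simp: eq D_join_def D_meet_def)
  {
    assume "r \<sqinter>\<^bsub>D\<^esub> p = r \<sqinter>\<^bsub>D\<^esub> q"
    then have e: "D_meet z u x v = D_meet z u y w" using c by (simp add: eq meet_D)
    then have m: "z \<sqinter> x = z \<sqinter> y" by (simp add: D_meet_def)
    then have m': "z \<sqinter> (x \<squnion> y) = z \<sqinter> x" using sd cL unfolding semidistributive_def by blast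
    have le: "z \<sqinter> x \<sqsubseteq> x" "z \<sqinter> x \<sqsubseteq> y" "z \<sqinter> x \<in> carrier L"
      using cL m meet_right meet_closed by (auto, metis)
    have "D_meet z u (x \<squnion> y) (snd (D_join x v y w)) = D_meet z u x v"
    \<comment> \<open>In the remaining cases the second component of the meet depends only on the
      first components and u.\<close>
    proof (cases "a \<sqsubseteq> z \<sqinter> x \<and> z \<sqinter> x \<sqsubseteq> b \<and> u")
      case True
      have ax: "a \<sqsubseteq> x" "a \<sqsubseteq> y"
        using True le_trans[OF _ le(1) a le(3) cL(1)] le_trans[OF _ le(2) a le(3) cL(2)] by auto
      have "a \<sqsubseteq> x \<squnion> y"
        using le_trans[OF ax(1) join_left[OF cL(1,2)] a cL(1) join_closed[OF cL(1,2)]] .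
      moreover have "v = w" using e m True by (auto simp: D_meet_def)
      moreover have "x \<squnion> y \<sqsubseteq> b" if "\<not> v" "\<not> w"
        using that c by (intro join_le) (auto simp: carrier_D b)
      moreover have "\<not> x \<squnion> y \<sqsubseteq> b \<Longrightarrow> snd (D_join x v y w)" by (simp add: D_join_def)
      ultimately have "snd (D_join x v y w) = v" by (auto simp: D_join_def)
      then show ?thesis using m' by (simp add: D_meet_def)
    qed (auto simp: D_meet_def m')
    then show "r \<sqinter>\<^bsub>D\<^esub> (p \<squnion>\<^bsub>D\<^esub> q) = r \<sqinter>\<^bsub>D\<^esub> p"
      using c cj(1) unfolding jm by (simp add: eq meet_D)
  }
  {
    assume "r \<squnion>\<^bsub>D\<^esub> p = r \<squnion>\<^bsub>D\<^esub> q"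
    then have e: "D_join z u x v = D_join z u y w" using c by (simp add: eq join_D)
    then have m: "z \<squnion> x = z \<squnion> y" by (simp add: D_join_def)
    then have m': "z \<squnion> (x \<sqinter> y) = z \<squnion> x" using sd cL unfolding semidistributive_def by blast
    have le: "x \<sqsubseteq> z \<squnion> x" "y \<sqsubseteq> z \<squnion> x" "z \<squnion> x \<in> carrier L"
      using cL m join_right join_closed by (auto, metis)
    have "D_join z u (x \<sqinter> y) (snd (D_meet x v y w)) = D_join z u x v"
    proof (cases "a \<sqsubseteq> z \<squnion> x \<and> z \<squnion> x \<sqsubseteq> b \<and> \<not> u")
      case True
      have xb: "x \<sqsubseteq> b" "y \<sqsubseteq> b"
        using True le_trans[OF le(1) _ cL(1) le(3) b] le_trans[OF le(2) _ cL(2) le(3) b] by auto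
      have "x \<sqinter> y \<sqsubseteq> b"
        using le_trans[OF meet_left[OF cL(1,2)] xb(1) meet_closed[OF cL(1,2)] cL(1) b] .
      moreover have "v = w" using e m True by (auto simp: D_join_def)
      moreover have "a \<sqsubseteq> x \<sqinter> y" if "v" "w"
        using that c xb by (intro meet_le) (auto simp: carrier_D a)
      ultimately have "snd (D_meet x v y w) = v" by (auto simp: D_meet_def)
      then show ?thesis using m' by (simp add: D_join_def)
    qed (auto simp: D_join_def m')
    then show "r \<squnion>\<^bsub>D\<^esub> (p \<sqinter>\<^bsub>D\<^esub> q) = r \<squnion>\<^bsub>D\<^esub> p"
      using c cj(2) unfolding jm by (simp add: eq join_D)
  }
qed (rule lattice_D)

end

lemma interval_doubling_built_lattice:
  "interval_doubling_built M \<Longrightarrow> lattice M \<and> semidistributive M"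
proof (induction rule: interval_doubling_built.induct)
  case (singleton M a)
  then interpret partial_order M by simp
  have "lattice M" using singleton by (intro latticeI) auto
  then interpret lattice M .
  have "semidistributive M"
    unfolding semidistributive_def using \<open>lattice M\<close> join_closed meet_closed singleton(2) by auto
  then show ?case using \<open>lattice M\<close> by simp
next
  case (doubling M a b N)
  then interpret interval_doubling M a b
    by (simp add: interval_doubling_def interval_doubling_axioms_def)
  show ?case
    using lattice_semidistributive_iso[OF doubling(5,6)] lattice_D semidistributive_D doubling by (simp add: D_def)
qed

lemma doubling_constructible_lattice:
  assumes "doubling_constructible L" "partial_order L"
  shows "lattice L" "semidistributive L"
proof -
  obtain M where "interval_doubling_built M" "order_isomorphic L M"
    using assms(1) by (auto simp: doubling_constructible_def)
  then have "lattice L \<and> semidistributive L"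
    using lattice_semidistributive_iso[OF assms(2)] interval_doubling_built_lattice by blast
  then show "lattice L" "semidistributive L" by auto
qed

section \<open>Trees and their inversion functions\<close>

text \<open>A hereditary form, for induction over trees: the children carry label sets that need not
  be initial segments.\<close>

definition decreasing :: "nat list \<Rightarrow> ptree \<Rightarrow> bool" where
  "decreasing s T \<longleftrightarrow> distinct (labels T) \<and>
     (\<forall>i ts. Node i ts \<in> subtrees T \<longrightarrow>
        length ts = entry s i + 1 \<and> (\<forall>t\<in>set ts. \<forall>j\<in>set (labels t). j < i))"

lemma decreasing_tree_iff:
  "decreasing_tree s T \<longleftrightarrow> decreasing s T \<and> set (labels T) = {1..length s}"
  by (auto simp: decreasing_tree_def decreasing_def)

lemma set_labels_Node: "set (labels (Node m ts)) = insert m (\<Union>t\<in>set ts. set (labels t))"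
  by simp

lemma distinct_concat_nth:
  "distinct (concat xss) \<longleftrightarrow> (\<forall>i<length xss. distinct (xss ! i)) \<and>
     (\<forall>j<length xss. \<forall>i<j. set (xss ! i) \<inter> set (xss ! j) = {})"
proof (induction xss)
  case (Cons xs xss)
  have "distinct (concat (xs # xss)) \<longleftrightarrow>
      distinct xs \<and> distinct (concat xss) \<and> (\<forall>j<length xss. set xs \<inter> set (xss ! j) = {})"
    unfolding all_set_conv_all_nth[of xss "\<lambda>ys. set xs \<inter> set ys = {}", symmetric]
    by (simp add: disjoint_iff) blast
  then show ?case
    unfolding Cons.IH length_Cons All_less_Suc2 nth_Cons_0 nth_Cons_Suc by blast
qed simp

lemma decreasing_Node:
  "decreasing s (Node m ts) \<longleftrightarrow>
     length ts = entry s m + 1 \<and>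
     (\<forall>i<length ts. decreasing s (ts ! i) \<and> (\<forall>a\<in>set (labels (ts ! i)). a < m)) \<and>
     (\<forall>j<length ts. \<forall>i<j. set (labels (ts ! i)) \<inter> set (labels (ts ! j)) = {})"
  (is "?lhs \<longleftrightarrow> ?rhs")
proof
  assume l: ?lhs
  then have d: "distinct (concat (map labels ts))" by (simp add: decreasing_def)
  have top: "length ts = entry s m + 1 \<and> (\<forall>t\<in>set ts. \<forall>j\<in>set (labels t). j < m)"
    using l by (simp add: decreasing_def)
  moreover have "decreasing s (ts ! i)" if "i < length ts" for i
  proof -
    have "ts ! i \<in> set ts" using that by simp
    moreover have "distinct (labels (ts ! i))" using d that by (simp add: distinct_concat_nth)
    moreover have "Node j us \<in> subtrees (Node m ts)" if "Node j us \<in> subtrees (ts ! i)" for j us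
      using that \<open>ts ! i \<in> set ts\<close> by auto
    ultimately show ?thesis using l unfolding decreasing_def by blast
  qed
  ultimately show ?rhs using d by (simp add: distinct_concat_nth) (metis nth_mem)
next
  assume r: ?rhs
  then have r1: "\<forall>i<length ts. decreasing s (ts ! i) \<and> (\<forall>a\<in>set (labels (ts ! i)). a < m)" by (elim conjE)
  have lt: "a < m" if t: "t \<in> set ts" "a \<in> set (labels t)" for t a
  proof -
    obtain i where "i < length ts" "t = ts ! i" using t(1) by (metis in_set_conv_nth)
    then show ?thesis using r1 t by simp
  qed
  have sub: "decreasing s t" if t: "t \<in> set ts" for t
  proof -
    obtain i where "i < length ts" "t = ts ! i" using t by (metis in_set_conv_nth)
    then show ?thesis using r1 by simp
  qed
  moreover have "distinct (concat (map labels ts))"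
    using r by (simp add: distinct_concat_nth decreasing_def)
  moreover have "m \<notin> (\<Union>t\<in>set ts. set (labels t))" using lt by blast
  moreover have "length us = entry s i + 1 \<and> (\<forall>t\<in>set us. \<forall>j\<in>set (labels t). j < i)"
    if i: "Node i us \<in> subtrees (Node m ts)" for i us
  proof (cases "i = m \<and> us = ts")
    case True
    then show ?thesis using r lt by blast
  next
    case False
    then obtain t where "t \<in> set ts" "Node i us \<in> subtrees t" using i by auto
    then show ?thesis using sub unfolding decreasing_def by blast
  qed
  ultimately show ?lhs unfolding decreasing_def by simp
qed

lemma subtrees_labels: "Node y us \<in> subtrees T \<Longrightarrow> insert y (\<Union>t\<in>set us. set (labels t)) \<subseteq> set (labels T)"
proof (induction T)
  case (Node m ts)
  show ?case
  proof (cases "y = m \<and> us = ts")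
    case False
    then obtain t where "t \<in> set ts" "Node y us \<in> subtrees t" using Node.prems by auto
    then show ?thesis using Node.IH by fastforce
  qed auto
qed simp

lemma in_child_labels:
  assumes "in_child T y i x"
  shows "y \<in> set (labels T)" "x \<in> set (labels T)"
proof -
  obtain ts where ts: "Node y ts \<in> subtrees T" "i < length ts" "x \<in> set (labels (ts ! i))"
    using assms by (auto simp: in_child_def)
  then have "x \<in> (\<Union>t\<in>set ts. set (labels t))" by (meson UN_I nth_mem)
  then show "y \<in> set (labels T)" "x \<in> set (labels T)" using subtrees_labels[OF ts(1)] by auto
qed

lemma in_child_Node:
  "in_child (Node m ts) y i x \<longleftrightarrow>
     y = m \<and> i < length ts \<and> x \<in> set (labels (ts ! i)) \<or> (\<exists>t\<in>set ts. in_child t y i x)"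
  unfolding in_child_def by auto

section \<open>Cardinalities as seen from the root\<close>

locale decreasing_node =
  fixes s m ts
  assumes dec: "decreasing s (Node m ts)"
begin

abbreviation "T \<equiv> Node m ts"

lemma len: "length ts = entry s m + 1"
  and child: "i < length ts \<Longrightarrow> decreasing s (ts ! i)"
  and less_root: "i < length ts \<Longrightarrow> a \<in> set (labels (ts ! i)) \<Longrightarrow> a < m"
  using dec by (auto simp: decreasing_Node)

lemma child_unique:
  assumes "i < length ts" "j < length ts" "a \<in> set (labels (ts ! i))" "a \<in> set (labels (ts ! j))"
  shows "i = j"
proof (rule ccontr)
  assume "i \<noteq> j"
  then consider "i < j" | "j < i" by linarith
  then show False
  proof cases
    case 1
    then show ?thesis using dec assms unfolding decreasing_Node by blast
  next
    case 2
    then show ?thesis using dec assms unfolding decreasing_Node by blast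
  qed
qed

lemma in_child_root:
  assumes "i < length ts" "a \<in> set (labels (ts ! i))"
  shows "in_child T m j a \<longleftrightarrow> j = i"
proof -
  have "\<not> in_child t m j a" if "t \<in> set ts" for t
    using in_child_labels(1)[of t m j a] less_root that by (auto simp: in_set_conv_nth)
  then show ?thesis using assms child_unique by (auto simp: in_child_Node)
qed

lemma in_child_sub:
  assumes "i < length ts" "a \<in> set (labels (ts ! i))" "y \<noteq> m"
  shows "in_child T y j a \<longleftrightarrow> in_child (ts ! i) y j a"
  using assms child_unique in_child_labels(2)[of _ y j a] by (fastforce simp: in_child_Node in_set_conv_nth)

lemma descendant_root:
  assumes "i < length ts" "a \<in> set (labels (ts ! i))"
  shows "descendant T a m"
  using in_child_root[OF assms] by (auto simp: descendant_def)

lemma descendant_sub: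
  assumes "i < length ts" "a \<in> set (labels (ts ! i))" "y \<noteq> m"
  shows "descendant T a y \<longleftrightarrow> descendant (ts ! i) a y"
  using in_child_sub[OF assms] by (simp add: descendant_def)

lemma descendant_labels: "descendant U x y \<Longrightarrow> x \<in> set (labels U) \<and> y \<in> set (labels U)"
  using in_child_labels by (auto simp: descendant_def)

lemma cardinality_root:
  assumes "i < length ts" "a \<in> set (labels (ts ! i))"
  shows "cardinality s T m a = i"
  using descendant_root[OF assms] in_child_root[OF assms] by (simp add: cardinality_def)

text \<open>Compared with the child, the whole tree has just one more common ancestor, the root, and
  it is the farthest. It cannot witness \<open>left_of\<close>, as both labels lie in the same child
  of it.\<close>

lemma cardinality_same:
  assumes i: "i < length ts" and a: "a \<in> set (labels (ts ! i))" and c: "c \<in> set (labels (ts ! i))"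
  shows "cardinality s T c a = cardinality s (ts ! i) c a"
proof -
  have cm: "c \<noteq> m" "a \<noteq> m" using less_root[OF i] a c by auto
  note d = descendant_sub[OF i] and ic = in_child_sub[OF i] and icr = in_child_root[OF i]
  have fca: "first_common_ancestor T z a c \<longleftrightarrow> first_common_ancestor (ts ! i) z a c" if z: "z \<noteq> m" for z
  proof -
    have "w = m \<or> (descendant (ts ! i) a w \<and> descendant (ts ! i) c w \<longrightarrow> w = z \<or> descendant T z w)
        \<longleftrightarrow> w = m \<or> (descendant (ts ! i) a w \<and> descendant (ts ! i) c w \<longrightarrow> w = z \<or> descendant (ts ! i) z w)"
      if "descendant (ts ! i) a z" for w
      using d[of z w] descendant_labels[OF that] by auto
    moreover have "descendant T z m" if "descendant (ts ! i) a z"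
      using descendant_root[OF i, of z] descendant_labels[OF that] by auto
    moreover have "\<not> descendant (ts ! i) a m"
      using descendant_labels[of "ts ! i" a m] less_root[OF i] by blast
    ultimately show ?thesis
      unfolding first_common_ancestor_def using d[OF a] d[OF c] z by metis
  qed
  have "left_of T a c \<longleftrightarrow> left_of (ts ! i) a c"
  proof
    assume "left_of T a c"
    then obtain z p q where z: "first_common_ancestor T z a c" "in_child T z q a" "in_child T z p c" "q < p"
      by (auto simp: left_of_def)
    then have "z \<noteq> m" using icr[OF a] icr[OF c] by auto
    then show "left_of (ts ! i) a c" using z fca ic[OF a] ic[OF c] unfolding left_of_def by blast
  next
    assume "left_of (ts ! i) a c"
    then obtain z p q where z: "first_common_ancestor (ts ! i) z a c" "in_child (ts ! i) z q a"
        "in_child (ts ! i) z p c" "q < p"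
      by (auto simp: left_of_def)
    then have "z \<noteq> m" using in_child_labels(1) less_root[OF i] by blast
    then show "left_of T a c" using z fca ic[OF a] ic[OF c] unfolding left_of_def by blast
  qed
  then show ?thesis
    using d[OF a cm(1)] ic[OF a cm(1)] by (simp add: cardinality_def)
qed

lemma cardinality_different:
  assumes i: "i < length ts" and a: "a \<in> set (labels (ts ! i))"
    and j: "j < length ts" and c: "c \<in> set (labels (ts ! j))" and ij: "i \<noteq> j"
  shows "cardinality s T c a = (if i < j then 0 else entry s c)"
proof -
  have cm: "c \<noteq> m" "a \<noteq> m" using less_root i j a c by auto
  have nd: "\<not> descendant T a c"
  proof
    assume "descendant T a c"
    then have "c \<in> set (labels (ts ! i))"
      using descendant_sub[OF i a cm(1)] descendant_labels by blast
    then show False using child_unique[OF i j _ c] ij by simp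
  qed
  have common: "w = m" if "descendant T a w" "descendant T c w" for w
  proof (rule ccontr)
    assume "w \<noteq> m"
    then have "w \<in> set (labels (ts ! i))" "w \<in> set (labels (ts ! j))"
      using that descendant_sub[OF i a] descendant_sub[OF j c] descendant_labels by blast+
    then show False using child_unique[OF i j] ij by simp
  qed
  have "first_common_ancestor T m a c"
    unfolding first_common_ancestor_def
    using descendant_root[OF i a] descendant_root[OF j c] common by blast
  then have "left_of T a c \<longleftrightarrow> i < j"
    unfolding left_of_def first_common_ancestor_def
    using common in_child_root[OF i a] in_child_root[OF j c] by metis
  then show ?thesis using nd by (simp add: cardinality_def)
qed

end

definition tree_inv :: "nat list \<Rightarrow> ptree \<Rightarrow> nat \<times> nat \<Rightarrow> nat" where
  "tree_inv s T = (\<lambda>(c, a).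
     if a \<in> set (labels T) \<and> c \<in> set (labels T) \<and> a < c then cardinality s T c a else 0)"

text \<open>The description of tree inversions over an arbitrary label set, as needed for the
  children of a node.\<close>

definition inversions_on :: "(nat \<Rightarrow> nat) \<Rightarrow> nat set \<Rightarrow> (nat \<times> nat \<Rightarrow> nat) \<Rightarrow> bool" where
  "inversions_on s S f \<longleftrightarrow>
     (\<forall>c a. f (c, a) \<le> s c \<and> (0 < f (c, a) \<longrightarrow> a \<in> S \<and> c \<in> S \<and> a < c)) \<and>
     (\<forall>a\<in>S. \<forall>b\<in>S. \<forall>c\<in>S. a < b \<and> b < c \<longrightarrow>
        (0 < f (b, a) \<longrightarrow> f (c, b) \<le> f (c, a)) \<and> (f (b, a) < s b \<longrightarrow> f (c, a) \<le> f (c, b)))"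

lemma tree_inversions_iff: "f \<in> tree_inversions s n \<longleftrightarrow> inversions_on s {1..n} f"
proof
  assume f: "f \<in> tree_inversions s n"
  show "inversions_on s {1..n} f"
    unfolding inversions_on_def
  proof (intro conjI allI ballI impI)
    fix c a show "f (c, a) \<le> s c" by (rule tree_inversions_bound(1)[OF f])
    assume "0 < f (c, a)"
    from tree_inversions_bound(2)[OF f this] show "a \<in> {1..n}" "c \<in> {1..n}" "a < c" by auto
  next
    fix a b c :: nat assume "a < b \<and> b < c"
    then show "f (c, b) \<le> f (c, a)" if "0 < f (b, a)"
      using tree_inversions_trans[OF f that] by simp
    show "f (c, a) \<le> f (c, b)" if "f (b, a) < s b"
      using tree_inversions_planar[OF f that] \<open>a < b \<and> b < c\<close> by simp
  qed
next
  assume "inversions_on s {1..n} f"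
  then show "f \<in> tree_inversions s n"
  proof (intro tree_inversionsI)
    fix a b c :: nat assume "1 \<le> a" "a < b" "b < c" "c \<le> n"
    then have "a \<in> {1..n}" "b \<in> {1..n}" "c \<in> {1..n}" by auto
    then show "0 < f (b, a) \<Longrightarrow> f (c, b) \<le> f (c, a)" "f (b, a) < s b \<Longrightarrow> f (c, a) \<le> f (c, b)"
      using \<open>inversions_on s {1..n} f\<close> \<open>a < b\<close> \<open>b < c\<close> unfolding inversions_on_def by blast+
  qed (auto simp: inversions_on_def)
qed

context decreasing_node
begin

lemma tree_inv_root:
  assumes "i < length ts" "a \<in> set (labels (ts ! i))"
  shows "tree_inv s T (m, a) = i"
  using assms less_root[OF assms] cardinality_root[OF assms] by (auto simp: tree_inv_def)

lemma tree_inv_same: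
  assumes "i < length ts" "a \<in> set (labels (ts ! i))" "c \<in> set (labels (ts ! i))"
  shows "tree_inv s T (c, a) = tree_inv s (ts ! i) (c, a)"
  using assms cardinality_same[OF assms] by (auto simp: tree_inv_def)

lemma tree_inv_different:
  assumes "i < length ts" "a \<in> set (labels (ts ! i))" "j < length ts" "c \<in> set (labels (ts ! j))" "i \<noteq> j" "a < c"
  shows "tree_inv s T (c, a) = (if i < j then 0 else entry s c)"
  using assms cardinality_different[OF assms(1-5)] by (auto simp: tree_inv_def)

lemma labels_cases:
  assumes "a \<in> set (labels T)"
  obtains "a = m" | i where "i < length ts" "a \<in> set (labels (ts ! i))"
proof -
  consider "a = m" | t where "t \<in> set ts" "a \<in> set (labels t)" using assms by auto
  then show thesis
  proof cases
    case (2 t)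
    obtain i where "i < length ts" "t = ts ! i" using 2(1) by (metis in_set_conv_nth)
    then show thesis using that 2 by blast
  qed (rule that(1))
qed

lemma le_root:
  assumes "a \<in> set (labels T)"
  shows "a \<le> m"
  using assms by (rule labels_cases) (auto intro: less_imp_le less_root)

end

text \<open>Entries in the row of the root are child numbers, and entries between different children
  are 0 or maximal. So the induction hypothesis is needed only if all three labels lie in one
  child.\<close>

lemma inversions_on_tree_inv: "decreasing s T \<Longrightarrow> inversions_on (entry s) (set (labels T)) (tree_inv s T)"
proof (induction T)
  case Leaf
  then show ?case by (simp add: inversions_on_def tree_inv_def)
next
  case (Node m ts)
  let ?T = "Node m ts"
  interpret decreasing_node s m ts by unfold_locales (rule Node.prems)
  have IH: "inversions_on (entry s) (set (labels (ts ! i))) (tree_inv s (ts ! i))" if "i < length ts" for i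
    using Node.IH[of "ts ! i"] child that by simp
  have dom: "a \<in> set (labels ?T) \<and> c \<in> set (labels ?T) \<and> a < c" if "0 < tree_inv s ?T (c, a)" for c a
    using that by (auto simp: tree_inv_def split: if_splits)
  have bound: "tree_inv s ?T (c, a) \<le> entry s c" for c a
  proof (cases "0 < tree_inv s ?T (c, a)")
    case True
    note d = dom[OF True]
    have "c \<le> m" using d le_root by blast
    then have "a \<noteq> m" using d by auto
    then obtain i where i: "i < length ts" "a \<in> set (labels (ts ! i))" using d labels_cases by metis
    consider "c = m" | j where "j < length ts" "c \<in> set (labels (ts ! j))" using d labels_cases by metis
    then show ?thesis
    proof cases
      case 1
      then show ?thesis using tree_inv_root[OF i] i len by simp
    next
      case (2 j)
      show ?thesis
      proof (cases "i = j")
        case True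
        then show ?thesis
          using tree_inv_same[OF i] 2 IH[OF i(1)] by (auto simp: inversions_on_def)
      next
        case False
        then show ?thesis using tree_inv_different[OF i 2 False] d by auto
      qed
    qed
  qed simp
  have "(0 < tree_inv s ?T (b, a) \<longrightarrow> tree_inv s ?T (c, b) \<le> tree_inv s ?T (c, a)) \<and>
      (tree_inv s ?T (b, a) < entry s b \<longrightarrow> tree_inv s ?T (c, a) \<le> tree_inv s ?T (c, b))"
    if abc: "a \<in> set (labels ?T)" "b \<in> set (labels ?T)" "c \<in> set (labels ?T)" "a < b" "b < c" for a b c
  proof -
    have "c \<le> m" using abc(3) by (rule le_root)
    then have "a \<noteq> m" "b \<noteq> m" using abc by auto
    then obtain i j where i: "i < length ts" "a \<in> set (labels (ts ! i))" and j: "j < length ts" "b \<in> set (labels (ts ! j))"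
      using abc labels_cases by metis
    have ba: "tree_inv s ?T (b, a) = (if i = j then tree_inv s (ts ! i) (b, a) else if i < j then 0 else entry s b)"
      using tree_inv_same[OF i, of b] tree_inv_different[OF i j] abc j by auto
    consider "c = m" | k where "k < length ts" "c \<in> set (labels (ts ! k))" using abc(3) labels_cases by metis
    then show ?thesis
    proof cases
      case 1
      then show ?thesis using tree_inv_root[OF i] tree_inv_root[OF j] ba by auto
    next
      case (2 k)
      have ca: "tree_inv s ?T (c, a) = (if i = k then tree_inv s (ts ! i) (c, a) else if i < k then 0 else entry s c)"
        using tree_inv_same[OF i, of c] tree_inv_different[OF i 2] abc 2 by auto
      have cb: "tree_inv s ?T (c, b) = (if j = k then tree_inv s (ts ! j) (c, b) else if j < k then 0 else entry s c)"
        using tree_inv_same[OF j, of c] tree_inv_different[OF j 2] abc 2 by auto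
      show ?thesis
      proof (cases "i = j \<and> j = k")
        case True
        then show ?thesis
          using IH[OF i(1)] i j 2 abc ba ca cb unfolding inversions_on_def by auto
      next
        case False
        then show ?thesis
          using ba ca cb bound[of c a] bound[of c b] by (cases i j rule: linorder_cases; cases j k rule: linorder_cases) auto
      qed
    qed
  qed
  then show ?case using dom bound unfolding inversions_on_def by blast
qed

text \<open>The root is the largest label, its row tells which labels lie in which child, and the
  rest follows by induction.\<close>

lemma tree_inv_inj:
  "decreasing s T \<Longrightarrow> decreasing s U \<Longrightarrow> set (labels T) = set (labels U) \<Longrightarrow> tree_inv s T = tree_inv s U \<Longrightarrow> T = U"
proof (induction T arbitrary: U)
  case Leaf
  then show ?case by (cases U) auto
next
  case (Node m ts)
  then obtain m' us where U: "U = Node m' us" by (cases U) auto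
  interpret T: decreasing_node s m ts by unfold_locales (rule Node.prems)
  interpret U: decreasing_node s m' us by unfold_locales (use Node.prems U in simp)
  have root: "m = m'"
  proof (rule antisym)
    have "m \<in> set (labels (Node m' us))" "m' \<in> set (labels (Node m ts))" using Node.prems(3) U by auto
    then show "m \<le> m'" "m' \<le> m"
      using T.le_root U.le_root by blast+
  qed
  have len: "length ts = length us" using T.len U.len root by simp
  have us: "decreasing_node s m us" "set (labels (Node m ts)) = set (labels (Node m us))"
      "tree_inv s (Node m ts) = tree_inv s (Node m us)"
    using U.decreasing_node_axioms Node.prems(3,4) U root by metis+
  have sub: "set (labels (ts ! i)) \<subseteq> set (labels (us ! i))"
    if i: "i < length ts" and "decreasing_node s m ts" "decreasing_node s m us" "length ts = length us"
      "set (labels (Node m ts)) = set (labels (Node m us))" "tree_inv s (Node m ts) = tree_inv s (Node m us)" for i ts us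
  proof
    interpret A: decreasing_node s m ts by fact
    interpret B: decreasing_node s m us by fact
    fix a assume a: "a \<in> set (labels (ts ! i))"
    then have "a \<in> set (labels (Node m us))" using that(5) i by auto
    moreover have "a \<noteq> m" using A.less_root[OF i a] by simp
    ultimately obtain j where j: "j < length us" "a \<in> set (labels (us ! j))"
      using B.labels_cases by metis
    have "i = j" using A.tree_inv_root[OF i a] B.tree_inv_root[OF j] that(6) by simp
    then show "a \<in> set (labels (us ! i))" using j by simp
  qed
  have "ts ! i = us ! i" if i: "i < length ts" for i
  proof -
    have iu: "i < length us" using i len by simp
    have "set (labels (ts ! i)) = set (labels (us ! i))"
      using sub[OF i T.decreasing_node_axioms us(1) len us(2,3)]
        sub[OF iu us(1) T.decreasing_node_axioms len[symmetric] us(2)[symmetric] us(3)[symmetric]] by blast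
    moreover from this have "tree_inv s (ts ! i) (c, a) = tree_inv s (us ! i) (c, a)" for c a
    proof (cases "a \<in> set (labels (ts ! i)) \<and> c \<in> set (labels (ts ! i))")
      case True
      then have "a \<in> set (labels (us ! i))" "c \<in> set (labels (us ! i))"
        using \<open>set (labels (ts ! i)) = set (labels (us ! i))\<close> by auto
      then show ?thesis
        using T.tree_inv_same[OF i, of a c] U.tree_inv_same[OF iu, of a c] True us(3) root by metis
    next
      case False
      then show ?thesis
        using \<open>set (labels (ts ! i)) = set (labels (us ! i))\<close> by (auto simp: tree_inv_def)
    qed
    then have "tree_inv s (ts ! i) = tree_inv s (us ! i)" by (auto simp: fun_eq_iff)
    ultimately show ?thesis using Node.IH[of "ts ! i" "us ! i"] T.child U.child i iu by auto
  qed
  then show ?case using len root U by (simp add: list_eq_iff_nth_eq)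
qed

text \<open>The tree is rebuilt from its root \<open>Max S\<close>, whose row sorts the other labels
  into children. Between different children f agrees with the tree: f (m, a) < f (m, c) forces f (c,
  a) = 0 by transitivity, and f (m, c) < f (m, a) forces f (c, a) = s c by planarity.\<close>

lemma tree_inv_surj:
  assumes "finite S" "inversions_on (entry s) S f"
  shows "\<exists>T. decreasing s T \<and> set (labels T) = S \<and> tree_inv s T = f"
  using assms
proof (induction S arbitrary: f rule: finite_psubset_induct)
  case (psubset S)
  have bd: "f (c, a) \<le> entry s c" and dom: "0 < f (c, a) \<Longrightarrow> a \<in> S \<and> c \<in> S \<and> a < c" for c a
    using psubset.prems unfolding inversions_on_def by auto
  have tr: "0 < f (b, a) \<Longrightarrow> f (c, b) \<le> f (c, a)" and pl: "f (b, a) < entry s b \<Longrightarrow> f (c, a) \<le> f (c, b)"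
    if "a \<in> S" "b \<in> S" "c \<in> S" "a < b" "b < c" for a b c
    using psubset.prems that unfolding inversions_on_def by blast+
  show ?case
  proof (cases "S = {}")
    case True
    then have "f (c, a) = 0" for c a using dom[of c a] by auto
    then have "tree_inv s Leaf = f" by (auto simp: tree_inv_def fun_eq_iff)
    then show ?thesis using True by (intro exI[of _ Leaf]) (simp add: decreasing_def)
  next
    case False
    define m where "m = Max S"
    have m: "m \<in> S" "\<And>a. a \<in> S \<Longrightarrow> a \<le> m" using psubset.hyps False by (auto simp: m_def)
    define S' where "S' i = {a \<in> S. a < m \<and> f (m, a) = i}" for i
    define f' where "f' i = (\<lambda>(c, a). if c \<in> S' i \<and> a \<in> S' i then f (c, a) else 0)" for i
    have "\<exists>T. decreasing s T \<and> set (labels T) = S' i \<and> tree_inv s T = f' i" for i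
    proof (rule psubset.IH)
      show "S' i \<subset> S" using m by (auto simp: S'_def)
      show "inversions_on (entry s) (S' i) (f' i)"
        unfolding inversions_on_def
      proof (intro conjI allI ballI impI)
        show "f' i (c, a) \<le> entry s c" for c a using bd[of c a] by (simp add: f'_def)
        show "a \<in> S' i" "c \<in> S' i" "a < c" if "0 < f' i (c, a)" for c a
          using that dom[of c a] by (auto simp: f'_def split: if_splits)
        fix a b c assume abc: "a \<in> S' i" "b \<in> S' i" "c \<in> S' i" "a < b \<and> b < c"
        then have "a \<in> S" "b \<in> S" "c \<in> S" by (auto simp: S'_def)
        then show "0 < f' i (b, a) \<Longrightarrow> f' i (c, b) \<le> f' i (c, a)"
          "f' i (b, a) < entry s b \<Longrightarrow> f' i (c, a) \<le> f' i (c, b)"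
          using tr[of a b c] pl[of a b c] abc by (auto simp: f'_def)
      qed
    qed
    then obtain t where t: "\<And>i. decreasing s (t i)" "\<And>i. set (labels (t i)) = S' i" "\<And>i. tree_inv s (t i) = f' i"
      by metis
    define ts where "ts = map t [0..<entry s m + 1]"
    have ts: "length ts = entry s m + 1" "\<And>i. i < length ts \<Longrightarrow> ts ! i = t i" by (auto simp: ts_def simp del: upt_Suc)
    have dec: "decreasing s (Node m ts)"
      unfolding decreasing_Node using ts t by (auto simp: S'_def)
    then interpret decreasing_node s m ts by unfold_locales
    have lab: "set (labels T) = S"
    proof -
      have "set (labels T) = insert m (\<Union>i<length ts. S' i)"
      proof -
        have "set ts = (!) ts ` {..<length ts}" by (simp add: nth_image lessThan_atLeast0)
        then have "set (labels T) = insert m (\<Union>i<length ts. set (labels (ts ! i)))"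
          unfolding set_labels_Node by simp
        then show ?thesis using ts t(2) by auto
      qed
      also have "\<dots> = S"
      proof -
        have "f (m, x) < entry s m + 1" for x using bd[of m x] by simp
        then show ?thesis using m unfolding ts(1) S'_def by (auto simp: nat_less_le)
      qed
      finally show ?thesis .
    qed
    have "tree_inv s T (c, a) = f (c, a)" for c a
    proof (cases "a \<in> S \<and> c \<in> S \<and> a < c")
      case False
      then have "tree_inv s T (c, a) = 0" unfolding tree_inv_def lab by auto
      moreover have "f (c, a) = 0" using dom[of c a] False by auto
      ultimately show ?thesis by simp
    next
      case True
      have in_child: "x \<in> set (labels (ts ! f (m, x)))" "f (m, x) < length ts" if "x \<in> S" "x < m" for x
        using ts bd[of m x] t(2) that by (auto simp: S'_def)
      have am: "a < m" using True m(2)[of c] by simp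
      note ia = in_child(2,1)[OF _ am]
      show ?thesis
      proof (cases "c = m")
        case c: True
        then show ?thesis using tree_inv_root[OF ia] True by simp
      next
        case False
        then have cm: "c < m" using m(2)[of c] True by simp
        note ic = in_child(2,1)[OF _ cm]
        consider "f (m, a) = f (m, c)" | "f (m, a) < f (m, c)" | "f (m, c) < f (m, a)" by linarith
        then show ?thesis
        proof cases
          case 1
          then have "tree_inv s T (c, a) = f' (f (m, a)) (c, a)"
            using tree_inv_same[OF ia, of c] ic ts t(3) True by auto
          then show ?thesis using 1 True am cm by (auto simp: f'_def S'_def)
        next
          case 2
          have "f (c, a) = 0" using tr[of a c m] True m cm 2 by auto
          then show ?thesis using tree_inv_different[OF ia ic] True 2 by simp
        next
          case 3
          have "f (c, a) = entry s c" using pl[of a c m] True m cm 3 bd[of c a] by fastforce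
          then show ?thesis using tree_inv_different[OF ia ic] True 3 by simp
        qed
      qed
    qed
    then show ?thesis using dec lab by (intro exI[of _ T]) auto
  qed
qed

lemma s_weak_order_isomorphic:
  "order_isomorphic (s_weak_order s) (pord (tree_inversions (entry s) (length s)))"
  unfolding order_isomorphic_def
proof (intro exI[of _ "tree_inv s"] conjI ballI)
  show "bij_betw (tree_inv s) (carrier (s_weak_order s))
      (carrier (pord (tree_inversions (entry s) (length s))))"
    unfolding bij_betw_def
  proof
    show "inj_on (tree_inv s) (carrier (s_weak_order s))"
      by (rule inj_onI) (auto simp: s_weak_order_def decreasing_tree_iff intro: tree_inv_inj)
    show "tree_inv s ` carrier (s_weak_order s) = carrier (pord (tree_inversions (entry s) (length s)))"
    proof
      show "tree_inv s ` carrier (s_weak_order s) \<subseteq> carrier (pord (tree_inversions (entry s) (length s)))"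
        using inversions_on_tree_inv
        by (fastforce simp: s_weak_order_def decreasing_tree_iff tree_inversions_iff)
      show "carrier (pord (tree_inversions (entry s) (length s))) \<subseteq> tree_inv s ` carrier (s_weak_order s)"
        using tree_inv_surj[of "{1..length s}" s]
        by (fastforce simp: s_weak_order_def decreasing_tree_iff tree_inversions_iff)
    qed
  qed
  fix T U assume "T \<in> carrier (s_weak_order s)" "U \<in> carrier (s_weak_order s)"
  then have "set (labels T) = {1..length s}" "set (labels U) = {1..length s}"
    by (auto simp: s_weak_order_def decreasing_tree_iff)
  then show "T \<sqsubseteq>\<^bsub>s_weak_order s\<^esub> U \<longleftrightarrow> tree_inv s T \<sqsubseteq>\<^bsub>pord (tree_inversions (entry s) (length s))\<^esub> tree_inv s U"
    by (auto simp: s_weak_order_def le_fun_def tree_inv_def)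
qed

section \<open>Transfer along isomorphisms and duality\<close>

lemma maxchain_image:
  assumes inj: "inj_on g A" and PQ: "\<And>x y. x \<in> A \<Longrightarrow> y \<in> A \<Longrightarrow> P x y \<longleftrightarrow> Q (g x) (g y)"
  shows "{E. pred_on.maxchain (g ` A) Q E} = (`) g ` {E. pred_on.maxchain A P E}"
proof -
  have chain: "pred_on.chain (g ` A) Q (g ` E) \<longleftrightarrow> pred_on.chain A P E" if "E \<subseteq> A" for E
  proof -
    have "Q\<^sup>=\<^sup>= (g x) (g y) \<longleftrightarrow> P\<^sup>=\<^sup>= x y" if "x \<in> E" "y \<in> E" for x y
      using that \<open>E \<subseteq> A\<close> PQ inj by (auto simp: inj_on_def subset_iff)
    then show ?thesis using that unfolding pred_on.chain_def ball_simps(9) by (metis image_mono)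
  qed
  have sub: "\<exists>E\<subseteq>A. E' = g ` E" if "pred_on.chain (g ` A) Q E'" for E'
    using that by (auto simp: pred_on.chain_def subset_image_iff)
  have psub: "g ` E \<subset> g ` S \<longleftrightarrow> E \<subset> S" if "E \<subseteq> A" "S \<subseteq> A" for E S
  proof -
    have "g ` E \<subseteq> g ` S \<longleftrightarrow> E \<subseteq> S"
      using inj_on_image_mem_iff[OF inj _ that(2)] that(1) by blast
    then show ?thesis unfolding psubset_eq inj_on_image_eq_iff[OF inj that] by simp
  qed
  have max: "pred_on.maxchain (g ` A) Q (g ` E) \<longleftrightarrow> pred_on.maxchain A P E" if E: "E \<subseteq> A" for E
  proof
    assume m: "pred_on.maxchain (g ` A) Q (g ` E)"
    then have "pred_on.chain A P E" using chain[OF E] by (simp add: pred_on.maxchain_def)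
    moreover have "\<not> E \<subset> S" if "pred_on.chain A P S" for S
    proof
      assume "E \<subset> S"
      have S: "S \<subseteq> A" using that by (simp add: pred_on.chain_def)
      have "g ` E \<subset> g ` S" using psub[OF E S] \<open>E \<subset> S\<close> by simp
      moreover have "pred_on.chain (g ` A) Q (g ` S)" using chain[OF S] that by simp
      ultimately show False using m by (auto simp: pred_on.maxchain_def)
    qed
    ultimately show "pred_on.maxchain A P E" by (auto simp: pred_on.maxchain_def)
  next
    assume m: "pred_on.maxchain A P E"
    then have "pred_on.chain (g ` A) Q (g ` E)" using chain[OF E] by (simp add: pred_on.maxchain_def)
    moreover have "\<not> g ` E \<subset> S'" if S': "pred_on.chain (g ` A) Q S'" for S'
    proof
      assume "g ` E \<subset> S'"
      obtain S where S: "S \<subseteq> A" "S' = g ` S" using sub[OF S'] by blast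
      have "E \<subset> S" using psub[OF E S(1)] \<open>g ` E \<subset> S'\<close> S(2) by simp
      moreover have "pred_on.chain A P S" using chain[OF S(1)] S' S(2) by simp
      ultimately show False using m by (auto simp: pred_on.maxchain_def)
    qed
    ultimately show "pred_on.maxchain (g ` A) Q (g ` E)" by (auto simp: pred_on.maxchain_def)
  qed
  show ?thesis
  proof (intro equalityI subsetI)
    fix E' assume "E' \<in> {E. pred_on.maxchain (g ` A) Q E}"
    then have E': "pred_on.maxchain (g ` A) Q E'" by simp
    then obtain E where "E \<subseteq> A" "E' = g ` E" using sub[of E'] by (auto simp: pred_on.maxchain_def)
    then show "E' \<in> (`) g ` {E. pred_on.maxchain A P E}" using E' max by auto
  next
    fix E' assume "E' \<in> (`) g ` {E. pred_on.maxchain A P E}"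
    then obtain E where "E' = g ` E" "pred_on.maxchain A P E" by auto
    moreover from this have "E \<subseteq> A" by (simp add: pred_on.maxchain_def pred_on.chain_def)
    ultimately show "E' \<in> {E. pred_on.maxchain (g ` A) Q E}" using max by simp
  qed
qed

lemma polygon_chains_maxchain:
  assumes "polygon_chains L x y C D"
  shows "pred_on.maxchain \<lbrace>x..y\<rbrace>\<^bsub>L\<^esub> (le L) C" "pred_on.maxchain \<lbrace>x..y\<rbrace>\<^bsub>L\<^esub> (le L) D"
    "C \<subseteq> \<lbrace>x..y\<rbrace>\<^bsub>L\<^esub>" "D \<subseteq> \<lbrace>x..y\<rbrace>\<^bsub>L\<^esub>" "x \<in> C" "y \<in> C" "x \<in> D" "y \<in> D"
proof -
  have "C \<in> {C, D}" "D \<in> {C, D}" by auto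
  then have "C \<in> {E. pred_on.maxchain \<lbrace>x..y\<rbrace>\<^bsub>L\<^esub> (le L) E}" "D \<in> {E. pred_on.maxchain \<lbrace>x..y\<rbrace>\<^bsub>L\<^esub> (le L) E}"
    using assms unfolding polygon_chains_def by blast+
  then show C: "pred_on.maxchain \<lbrace>x..y\<rbrace>\<^bsub>L\<^esub> (le L) C" and D: "pred_on.maxchain \<lbrace>x..y\<rbrace>\<^bsub>L\<^esub> (le L) D"
    by auto
  then show "C \<subseteq> \<lbrace>x..y\<rbrace>\<^bsub>L\<^esub>" "D \<subseteq> \<lbrace>x..y\<rbrace>\<^bsub>L\<^esub>"
    by (auto simp: pred_on.maxchain_def pred_on.chain_def)
  have "x \<in> C \<inter> D" "y \<in> C \<inter> D" using assms unfolding polygon_chains_def by auto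
  then show "x \<in> C" "y \<in> C" "x \<in> D" "y \<in> D" by auto
qed

text \<open>Makes the positions 1 and \<open>length xs - 2\<close> valid, so that they commute with
  mapping the list. A shorter C would be {x}, properly contained in D.\<close>

lemma polygon_chains_length:
  assumes pol: "polygon_chains L x y C D" and xs: "set xs = C"
  shows "2 \<le> length xs"
proof (rule ccontr)
  note m = polygon_chains_maxchain[OF pol]
  assume "\<not> 2 \<le> length xs"
  then have "length xs = 0 \<or> length xs = 1" by linarith
  then have "C \<subseteq> {x}" using xs m(5) by (auto simp: length_Suc_conv)
  then have "C \<subset> D" using m(7) pol by (auto simp: polygon_chains_def)
  then show False using m(1,2) by (auto simp: pred_on.maxchain_def)
qed

context lattice_iso
begin

interpretation L: partial_order L by (rule L)
interpretation M: lattice M by (rule M)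

lemma lless_iff: "x \<in> carrier L \<Longrightarrow> y \<in> carrier L \<Longrightarrow> x \<sqsubset>\<^bsub>L\<^esub> y \<longleftrightarrow> f x \<sqsubset>\<^bsub>M\<^esub> f y"
  using le_iff inj by (auto simp: lless_def L.eq_is_equal M.eq_is_equal)

lemma interval_image:
  assumes "x \<in> carrier L" "y \<in> carrier L"
  shows "\<lbrace>f x..f y\<rbrace>\<^bsub>M\<^esub> = f ` \<lbrace>x..y\<rbrace>\<^bsub>L\<^esub>"
proof (intro equalityI subsetI)
  fix z assume z: "z \<in> \<lbrace>f x..f y\<rbrace>\<^bsub>M\<^esub>"
  then have "z \<in> carrier M" by (simp add: at_least_at_most_def)
  then obtain w where "w \<in> carrier L" "f w = z" by (rule preimage)
  then show "z \<in> f ` \<lbrace>x..y\<rbrace>\<^bsub>L\<^esub>" using z assms le_iff by (auto simp: at_least_at_most_def)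
qed (use assms le_iff closed in \<open>auto simp: at_least_at_most_def\<close>)

lemma interval_subset: "\<lbrace>x..y\<rbrace>\<^bsub>L\<^esub> \<subseteq> carrier L"
  by (auto simp: at_least_at_most_def)

lemma maxchains_image:
  assumes "x \<in> carrier L" "y \<in> carrier L"
  shows "{E. pred_on.maxchain \<lbrace>f x..f y\<rbrace>\<^bsub>M\<^esub> (le M) E} = (`) f ` {E. pred_on.maxchain \<lbrace>x..y\<rbrace>\<^bsub>L\<^esub> (le L) E}"
  unfolding interval_image[OF assms]
proof (rule maxchain_image)
  show "inj_on f \<lbrace>x..y\<rbrace>\<^bsub>L\<^esub>"
    using inj interval_subset by (meson inj_onI subsetD)
  show "u \<sqsubseteq>\<^bsub>L\<^esub> v \<longleftrightarrow> f u \<sqsubseteq>\<^bsub>M\<^esub> f v" if "u \<in> \<lbrace>x..y\<rbrace>\<^bsub>L\<^esub>" "v \<in> \<lbrace>x..y\<rbrace>\<^bsub>L\<^esub>" for u v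
    using that interval_subset by (intro le_iff) auto
qed

lemma polygon_chains_image:
  assumes pol: "polygon_chains L x y C D"
  shows "polygon_chains M (f x) (f y) (f ` C) (f ` D)"
proof -
  note m = polygon_chains_maxchain[OF pol]
  have sub: "C \<subseteq> carrier L" "D \<subseteq> carrier L" using m(3,4) interval_subset by blast+
  then have xy: "x \<in> carrier L" "y \<in> carrier L" using m(5,6) by auto
  have inj_f: "inj_on f (carrier L)" using bij by (simp add: bij_betw_def)
  have "{E. pred_on.maxchain \<lbrace>f x..f y\<rbrace>\<^bsub>M\<^esub> (le M) E} = {f ` C, f ` D}"
    unfolding maxchains_image[OF xy] using pol by (simp add: polygon_chains_def)
  moreover have "f ` C \<noteq> f ` D"
    using inj_on_image_eq_iff[OF inj_f sub] pol by (simp add: polygon_chains_def)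
  moreover have "f ` C \<inter> f ` D = {f x, f y}"
    using inj_on_image_Int[OF inj_f sub] pol by (simp add: polygon_chains_def)
  ultimately show ?thesis using pol by (simp add: polygon_chains_def)
qed

lemma polygon_preimage:
  assumes xy: "x \<in> carrier L" "y \<in> carrier L" and pol: "polygon M (f x) (f y)"
  shows "polygon L x y"
proof -
  obtain C' D' where pol': "polygon_chains M (f x) (f y) C' D'" using pol by (auto simp: polygon_def)
  have "{C', D'} = (`) f ` {E. pred_on.maxchain \<lbrace>x..y\<rbrace>\<^bsub>L\<^esub> (le L) E}"
    using pol' unfolding polygon_chains_def maxchains_image[OF xy] by simp
  then have img: "(`) f ` {E. pred_on.maxchain \<lbrace>x..y\<rbrace>\<^bsub>L\<^esub> (le L) E} = {C', D'}" by (rule sym)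
  have mem: "E' \<in> (`) f ` {E. pred_on.maxchain \<lbrace>x..y\<rbrace>\<^bsub>L\<^esub> (le L) E} \<longleftrightarrow> E' = C' \<or> E' = D'" for E'
    unfolding img by simp
  obtain C where C: "C' = f ` C" "pred_on.maxchain \<lbrace>x..y\<rbrace>\<^bsub>L\<^esub> (le L) C"
    using mem[of C'] by blast
  obtain D where D: "D' = f ` D" "pred_on.maxchain \<lbrace>x..y\<rbrace>\<^bsub>L\<^esub> (le L) D"
    using mem[of D'] by blast
  have only: "f ` E = C' \<or> f ` E = D'" if "pred_on.maxchain \<lbrace>x..y\<rbrace>\<^bsub>L\<^esub> (le L) E" for E
    using mem[of "f ` E"] that by blast
  have inj_f: "inj_on f (carrier L)" using bij by (simp add: bij_betw_def)
  have sub: "E \<subseteq> carrier L" if "pred_on.maxchain \<lbrace>x..y\<rbrace>\<^bsub>L\<^esub> (le L) E" for E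
  proof -
    have "E \<subseteq> \<lbrace>x..y\<rbrace>\<^bsub>L\<^esub>" using that unfolding pred_on.maxchain_def pred_on.chain_def by (elim conjE)
    then show ?thesis using interval_subset by (rule subset_trans)
  qed
  have "E = C \<or> E = D" if "pred_on.maxchain \<lbrace>x..y\<rbrace>\<^bsub>L\<^esub> (le L) E" for E
    using only[OF that] C(1) D(1) inj_on_image_eq_iff[OF inj_f sub[OF that] sub[OF C(2)]]
      inj_on_image_eq_iff[OF inj_f sub[OF that] sub[OF D(2)]] by auto
  then have "{E. pred_on.maxchain \<lbrace>x..y\<rbrace>\<^bsub>L\<^esub> (le L) E} = {C, D}" using C(2) D(2) by auto
  moreover have "C \<noteq> D" using pol' C(1) D(1) unfolding polygon_chains_def by blast
  moreover have "finite C" "finite D"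
  proof -
    have "inj_on f C" "inj_on f D"
      using inj_on_subset[OF inj_f sub[OF C(2)]] inj_on_subset[OF inj_f sub[OF D(2)]] .
    moreover have "finite (f ` C)" "finite (f ` D)" using pol' C(1) D(1) by (simp_all add: polygon_chains_def)
    ultimately show "finite C" "finite D" using finite_imageD[of f C] finite_imageD[of f D] by auto
  qed
  moreover have "C \<inter> D = {x, y}"
  proof -
    have "f ` (C \<inter> D) = f ` {x, y}"
      using inj_on_image_Int[OF inj_f sub[OF C(2)] sub[OF D(2)]] pol' C(1) D(1) by (simp add: polygon_chains_def)
    moreover have "C \<inter> D \<subseteq> carrier L" "{x, y} \<subseteq> carrier L" using sub C xy by auto
    ultimately show ?thesis using inj_on_image_eq_iff[OF inj_f] by blast
  qed
  ultimately show ?thesis unfolding polygon_def polygon_chains_def by blast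
qed

lemma covers_image:
  assumes "covers L y x"
  shows "covers M (f y) (f x)"
proof -
  have xy: "x \<in> carrier L" "y \<in> carrier L" "x \<sqsubset>\<^bsub>L\<^esub> y" using assms by (auto simp: covers_def)
  have "\<not> (f x \<sqsubset>\<^bsub>M\<^esub> z \<and> z \<sqsubset>\<^bsub>M\<^esub> f y)" if z: "z \<in> carrier M" for z
  proof -
    obtain w where "w \<in> carrier L" "f w = z" using preimage[OF z] .
    then show ?thesis using assms xy by (auto simp: covers_def lless_iff)
  qed
  then show ?thesis using xy closed by (auto simp: covers_def lless_iff)
qed

lemma polygonal:
  assumes "polygonal M"
  shows "polygonal L"
  unfolding polygonal_def
proof (intro conjI allI impI)
  interpret L: lattice L by (rule lattice)
  show "lattice L" by (rule lattice)
  fix x y1 y2 assume c: "covers L y1 x \<and> covers L y2 x \<and> y1 \<noteq> y2"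
  then have cL: "x \<in> carrier L" "y1 \<in> carrier L" "y2 \<in> carrier L" by (auto simp: covers_def)
  have "polygon M (f x) (f y1 \<squnion>\<^bsub>M\<^esub> f y2)"
    using assms c covers_image inj[OF cL(2,3)] unfolding polygonal_def by blast
  then show "polygon L x (y1 \<squnion>\<^bsub>L\<^esub> y2)"
    using polygon_preimage[OF cL(1), of "y1 \<squnion>\<^bsub>L\<^esub> y2"] cL by (simp add: f_join)
next
  interpret L: lattice L by (rule lattice)
  fix y x1 x2 assume c: "covers L y x1 \<and> covers L y x2 \<and> x1 \<noteq> x2"
  then have cL: "y \<in> carrier L" "x1 \<in> carrier L" "x2 \<in> carrier L" by (auto simp: covers_def)
  have "polygon M (f x1 \<sqinter>\<^bsub>M\<^esub> f x2) (f y)"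
    using assms c covers_image inj[OF cL(2,3)] unfolding polygonal_def by blast
  then show "polygon L (x1 \<sqinter>\<^bsub>L\<^esub> x2) y"
    using polygon_preimage[of "x1 \<sqinter>\<^bsub>L\<^esub> x2" y] cL by (simp add: f_meet)
qed

lemma HH_labeling:
  assumes "HH_labeling M l r"
  shows "HH_labeling L (\<lambda>x y. l (f x) (f y)) r"
  unfolding HH_labeling_def Let_def
proof (intro allI impI)
  fix x y C D xs ys assume *: "polygon_chains L x y C D \<and> lists_chain L xs C \<and> lists_chain L ys D"
  then have pol: "polygon_chains L x y C D" by simp
  have sub: "C \<subseteq> carrier L" "D \<subseteq> carrier L"
    using polygon_chains_maxchain(3,4)[OF pol] interval_subset by blast+
  have lc: "lists_chain M (map f zs) (f ` E)" if "lists_chain L zs E" "E \<subseteq> carrier L" for zs E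
  proof -
    have zs: "sorted_wrt (lless L) zs" "set zs = E" using that(1) by (auto simp: lists_chain_def)
    have "sorted_wrt (\<lambda>u v. f u \<sqsubset>\<^bsub>M\<^esub> f v) zs"
    proof (rule sorted_wrt_mono_rel[OF _ zs(1)])
      show "f u \<sqsubset>\<^bsub>M\<^esub> f v" if "u \<in> set zs" "v \<in> set zs" "u \<sqsubset>\<^bsub>L\<^esub> v" for u v
        using lless_iff[of u v] that zs(2) \<open>E \<subseteq> carrier L\<close> by blast
    qed
    then show ?thesis using zs(2) by (simp add: lists_chain_def sorted_wrt_map)
  qed
  have len: "2 \<le> length xs" "2 \<le> length ys"
    using polygon_chains_length[OF pol, of xs] polygon_chains_length[OF polygon_chains_commute[OF pol], of ys] *
    by (simp_all add: lists_chain_def)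
  have labels: "chain_labels l (map f zs) = chain_labels (\<lambda>x y. l (f x) (f y)) zs" for zs
    by (auto simp: chain_labels_def)
  have "lists_chain M (map f xs) (f ` C)" "lists_chain M (map f ys) (f ` D)" using lc * sub by auto
  then have "(l (f x) (map f xs ! 1) = l (map f ys ! (length (map f ys) - 2)) (f y) \<and>
      l (f x) (map f ys ! 1) = l (map f xs ! (length (map f xs) - 2)) (f y)) \<and>
      ranks_increase_inwards r (chain_labels l (map f xs)) \<and>
      ranks_increase_inwards r (chain_labels l (map f ys))"
    using assms polygon_chains_image[OF pol] unfolding HH_labeling_def Let_def by blast
  then show "(l (f x) (f (xs ! 1)) = l (f (ys ! (length ys - 2))) (f y) \<and>
      l (f x) (f (ys ! 1)) = l (f (xs ! (length xs - 2))) (f y)) \<and>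
      ranks_increase_inwards r (chain_labels (\<lambda>x y. l (f x) (f y)) xs) \<and>
      ranks_increase_inwards r (chain_labels (\<lambda>x y. l (f x) (f y)) ys)"
    unfolding labels using len by auto
qed

end

lemma polygon_dual: "polygon (inv_gorder L) y x \<longleftrightarrow> polygon L x y"
proof -
  have "\<lbrace>y..x\<rbrace>\<^bsub>inv_gorder L\<^esub> = \<lbrace>x..y\<rbrace>\<^bsub>L\<^esub>" by (auto simp: at_least_at_most_def)
  moreover have "pred_on.chain A (\<lambda>x y. y \<sqsubseteq>\<^bsub>L\<^esub> x) = pred_on.chain A (le L)" for A
  proof -
    have "(\<lambda>x y. y \<sqsubseteq>\<^bsub>L\<^esub> x)\<^sup>=\<^sup>= u v \<longleftrightarrow> (le L)\<^sup>=\<^sup>= v u" for u v by auto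
    then show ?thesis unfolding pred_on.chain_def fun_eq_iff by (metis (no_types, lifting))
  qed
  then have "pred_on.maxchain A (\<lambda>x y. y \<sqsubseteq>\<^bsub>L\<^esub> x) = pred_on.maxchain A (le L)" for A
    unfolding pred_on.maxchain_def fun_eq_iff by simp
  moreover have "{y, x} = {x, y}" by auto
  ultimately show ?thesis unfolding polygon_def polygon_chains_def by simp
qed

definition complement :: "(nat \<Rightarrow> nat) \<Rightarrow> nat \<Rightarrow> (nat \<times> nat \<Rightarrow> nat) \<Rightarrow> nat \<times> nat \<Rightarrow> nat" where
  "complement s n f = (\<lambda>p. full_cap s n p - f p)"

text \<open>Complementation exchanges transitivity and planarity.\<close>

lemma complement_in:
  assumes f: "f \<in> tree_inversions s n"
  shows "complement s n f \<in> tree_inversions s n"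
proof (rule tree_inversionsI)
  show "complement s n f (c, a) \<le> s c" for c a
    by (auto simp: complement_def full_cap_def)
  show "0 < complement s n f (c, a) \<Longrightarrow> 1 \<le> a \<and> a < c \<and> c \<le> n" for c a
    by (auto simp: complement_def full_cap_def split: if_splits)
  fix a b c assume "1 \<le> a" "a < b" "b < c" "c \<le> n"
  then have eq: "complement s n f (b, a) = s b - f (b, a)" "complement s n f (c, b) = s c - f (c, b)"
    "complement s n f (c, a) = s c - f (c, a)"
    by (auto simp: complement_def full_cap_def)
  show "complement s n f (c, b) \<le> complement s n f (c, a)" if "0 < complement s n f (b, a)"
    using tree_inversions_planar[OF f, of b a c] that \<open>a < b\<close> \<open>b < c\<close> unfolding eq by simp
  show "complement s n f (c, a) \<le> complement s n f (c, b)" if "complement s n f (b, a) < s b"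
    using tree_inversions_trans[OF f, of b a c] that \<open>b < c\<close> unfolding eq by (simp add: diff_le_mono2)
qed

lemma complement_complement:
  "f \<in> tree_inversions s n \<Longrightarrow> complement s n (complement s n f) = f"
  by (auto simp: complement_def inversion_functions_iff le_fun_def fun_eq_iff)

lemma complement_le_iff:
  assumes "f \<in> tree_inversions s n" "g \<in> tree_inversions s n"
  shows "complement s n g \<le> complement s n f \<longleftrightarrow> f \<le> g"
proof -
  have anti: "complement s n g \<le> complement s n f" if "f \<le> g" for f g
    using that by (auto simp: complement_def le_fun_def intro: diff_le_mono2)
  show ?thesis
    using anti[of f g] anti[of "complement s n g" "complement s n f"] assms complement_complement by auto
qed

lemma polygonal_tree_inversions:
  assumes "lattice (pord (tree_inversions s n))"
  shows "polygonal (pord (tree_inversions s n))"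
proof -
  let ?L = "pord (tree_inversions s n)"
  interpret L: lattice ?L by fact
  have up: "polygon ?L x (y1 \<squnion>\<^bsub>?L\<^esub> y2)" if c: "covers ?L y1 x" "covers ?L y2 x" "y1 \<noteq> y2" for x y1 y2
  proof -
    obtain J xs ys where J: "HH_polygon (tree_inversions s n) inversion_label x J xs ys"
      "J \<in> tree_inversions s n" "y1 \<le> J" "y2 \<le> J"
      "\<And>z. z \<in> tree_inversions s n \<Longrightarrow> y1 \<le> z \<Longrightarrow> y2 \<le> z \<Longrightarrow> J \<le> z"
      using HH_polygon_tree_inversions[OF c] by blast
    have "y1 \<squnion>\<^bsub>?L\<^esub> y2 = J"
      using c J(2-) by (intro join_eqI) (auto simp: covers_pord partial_order_pord)
    then show ?thesis using J(1) by (auto simp: HH_polygon_def polygon_def)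
  qed
  \<comment> \<open>Complementation is viewed as an isomorphism onto the dual lattice, so the
    transport lemmas turn the result on joins of covers into the one on meets.\<close>
  interpret iso: lattice_iso ?L "inv_gorder ?L" "complement s n"
  proof (unfold lattice_iso_def, intro conjI allI impI)
    show "partial_order ?L" by (rule partial_order_pord)
    show "lattice (inv_gorder ?L)" by (rule L.dual_lattice)
    have "bij_betw (complement s n) (tree_inversions s n) (tree_inversions s n)"
      by (rule bij_betw_byWitness[where f' = "complement s n"]) (auto simp: complement_complement complement_in)
    then show "bij_betw (complement s n) (carrier ?L) (carrier (inv_gorder ?L))" by simp
  qed (simp add: complement_le_iff)
  have down: "polygon ?L (x1 \<sqinter>\<^bsub>?L\<^esub> x2) y" if c: "covers ?L y x1" "covers ?L y x2" "x1 \<noteq> x2" for y x1 x2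
  proof -
    let ?c = "complement s n"
    have cL: "y \<in> carrier ?L" "x1 \<in> carrier ?L" "x2 \<in> carrier ?L" using c by (auto simp: covers_pord)
    have "covers ?L (?c x) (?c y)" if "covers ?L y x" for x
      using iso.covers_image[OF that] by (auto simp: covers_def lless_def)
    then have "polygon ?L (?c y) (?c x1 \<squnion>\<^bsub>?L\<^esub> ?c x2)"
      using up c iso.inj[OF cL(2,3)] by blast
    then have "polygon (inv_gorder ?L) (?c (x1 \<sqinter>\<^bsub>?L\<^esub> x2)) (?c y)"
      unfolding polygon_dual iso.f_meet[OF cL(2,3)] meet_dual .
    then show ?thesis using iso.polygon_preimage[of "x1 \<sqinter>\<^bsub>?L\<^esub> x2" y] cL L.meet_closed by simp
  qed
  show ?thesis unfolding polygonal_def using up down assms by blast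
qed

text \<open>Antisymmetry means that a tree is determined by its cardinalities; it comes from the
  injectivity of the isomorphism.\<close>

lemma partial_order_s_weak_order: "partial_order (s_weak_order s)"
proof -
  let ?F = "pord (tree_inversions (entry s) (length s))"
  obtain f where f: "bij_betw f (carrier (s_weak_order s)) (carrier ?F)"
      "\<And>x y. x \<in> carrier (s_weak_order s) \<Longrightarrow> y \<in> carrier (s_weak_order s) \<Longrightarrow> x \<sqsubseteq>\<^bsub>s_weak_order s\<^esub> y \<longleftrightarrow> f x \<le> f y"
    using s_weak_order_isomorphic[of s] by (auto simp: order_isomorphic_def)
  have eq: "(.=\<^bsub>s_weak_order s\<^esub>) = (=)" by (simp add: s_weak_order_def)
  have "x = y" if "x \<sqsubseteq>\<^bsub>s_weak_order s\<^esub> y" "y \<sqsubseteq>\<^bsub>s_weak_order s\<^esub> x" "x \<in> carrier (s_weak_order s)" "y \<in> carrier (s_weak_order s)" for x y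
    using that f by (auto simp: bij_betw_def inj_on_def)
  then show ?thesis
    by unfold_locales (auto simp: eq f(2) intro: order.trans)
qed

theorem theorem1p40:
  fixes s :: "nat list"
  shows "HH_lattice (s_weak_order s) \<and>
    polygonal (s_weak_order s) \<and> semidistributive (s_weak_order s) \<and>
    congruence_uniform (s_weak_order s)"
proof -
  let ?X = "tree_inversions (entry s) (length s)"
  let ?L = "s_weak_order s" and ?F = "pord ?X"
  have dcF: "doubling_constructible ?F" by (rule doubling_constructible_tree_inversions)
  have F: "lattice ?F" using doubling_constructible_lattice[OF dcF partial_order_pord] by simp
  obtain f where f: "bij_betw f (carrier ?L) (carrier ?F)"
      "\<forall>x\<in>carrier ?L. \<forall>y\<in>carrier ?L. x \<sqsubseteq>\<^bsub>?L\<^esub> y \<longleftrightarrow> f x \<sqsubseteq>\<^bsub>?F\<^esub> f y"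
    using s_weak_order_isomorphic[of s] unfolding order_isomorphic_def by blast
  interpret lattice_iso ?L ?F f
    unfolding lattice_iso_def using partial_order_s_weak_order F f by blast
  have dc: "doubling_constructible ?L"
    using doubling_constructible_iso[OF s_weak_order_isomorphic dcF] .
  have fin: "finite (carrier ?L)"
    using bij_betw_finite[OF f(1)] finite_tree_inversions by simp
  have lat: "lattice ?L" and sd: "semidistributive ?L"
    using doubling_constructible_lattice[OF dc partial_order_s_weak_order] by auto
  have pol: "polygonal ?L" by (rule polygonal[OF polygonal_tree_inversions[OF F]])
  have "HH_labeling ?L (\<lambda>x y. inversion_label (f x) (f y)) id"
    by (rule HH_labeling[OF HH_labeling_tree_inversions[OF F]])
  then have "HH_lattice ?L" unfolding HH_lattice_def using lat fin sd pol by blast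
  moreover have "congruence_uniform ?L"
    using lat fin dc unfolding congruence_uniform_def doubling_constructible_def by blast
  ultimately show ?thesis using pol sd by simp
qed

end
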